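(* Let $k$ be an algebraically closed field of characteristic $p>0$, let $\mathcal{C}_k$ be the set of isomorphism classes of SG pairs over $k$, and let $H(\mathbb{C})$ be the ring of entire functions. The map $\tilde\Phi:\mathcal{C}_k\to H(\mathbb{C})$ given by $$(R,I)\mapsto F_{R,I},\qquad F_{R,I}(z)=\lim_{n\to\infty}\widehat{f_n(R,I)}(z)\quad (z\in\mathbb{C}),$$ is a well-defined function; that is, for every SG pair $(R,I)$ the limit exists for every $z\in\mathbb{C}$, defines an entire function, and depends only on the isomorphism class of $(R,I)$. Moreover, if $\dim R\ge1$ then $F_{R,I}=\widehat{f_{R,I}}$, where $f_{R,I}$ is the HK density function of $(R,I)$.
   Context: Fix an algebraically closed field $k$ of characteristic $p>0$. An SG pair $(R,I)$ over $k$ consists of a Noetherian standard graded ring $R=\bigoplus_{n\ge 0}R_n$ with $R_0=k$ (generated over $k$ by $R_1$) and a proper graded ideal $I\subset R$ with $\ell(R/I)<\infty$. Two SG pairs $(R,I)$, $(S,J)$ are isomorphic if there is a degree-$0$ graded ring isomorphism $\eta:R\to S$ with $\eta(I)=J$. For $d=\dim R\ge0$, $q=p^n$ and $x\ge0$ put $$f_n(R,I)(x)=\frac{1}{q^{d-1}}\,\ell\Big(\big(R/I^{[q]}\big)_{\lfloor xq\rfloor}\Big),$$ and $f_n(R,I)(x)=0$ for $x<0$, where $I^{[q]}$ is the ideal generated by $q$-th powers of elements of $I$; this is a compactly supported step function. The Fourier transform is $\widehat f(z)=\int_{\mathbb{R}}f(t)e^{itz}\,dt$, $z\in\mathbb{C}$.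 For $d\ge1$ the HK density function is $f_{R,I}(x)=\lim_{n\to\infty}f_n(R,I)(x)$. For $d\ge2$ it is known that the convergence is uniform on $\mathbb{R}$ and $f_{R,I}$ is continuous with compact support; for $d=1$ the limit exists for all $x$ outside a finite set. *)

theory Defs
  imports "HOL-Analysis.Analysis" "HOL-Algebra.Algebra"
begin

section \<open>Algebraic notions\<close>

text \<open>The additive order of the unit; \<^const>\<open>group.ord\<close> is 0 for elements of infinite order.\<close>

definition ring_char :: "('a, 'm) ring_scheme \<Rightarrow> nat" where
  "ring_char R = group.ord (add_monoid R) \<one>\<^bsub>R\<^esub>"

definition krull_dim :: "('a, 'm) ring_scheme \<Rightarrow> enat" where
  "krull_dim R = (SUP n \<in> {n. \<exists>P. (\<forall>i\<le>n. primeideal (P i) R) \<and> (\<forall>i<n. P i \<subset> P (Suc i))}. enat n)"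

definition module_length ::
    "('r, 'm) ring_scheme \<Rightarrow> ('r, 'a, 'n) module_scheme \<Rightarrow> enat" where
  "module_length A M =
    (SUP n \<in> {n. \<exists>N. (\<forall>i\<le>n. submodule (N i) A M) \<and> (\<forall>i<n. N i \<subset> N (Suc i))}. enat n)"

text \<open>For a ring homomorphism \<open>\<phi>\<close> from \<open>A\<close> to \<open>B\<close>, an additive subgroup \<open>M\<close> of \<open>B\<close> that is
  stable under multiplication by the image of \<open>\<phi>\<close>, regarded as an \<open>A\<close>-module. The multiplicative
  fields of the module record play no role.\<close>

definition restrict_scalars ::
    "('r \<Rightarrow> 'b) \<Rightarrow> ('b, 'm) ring_scheme \<Rightarrow> 'b set \<Rightarrow> ('r, 'b) module" where
  "restrict_scalars \<phi> B M =
    \<lparr>carrier = M, monoid.mult = monoid.mult B, one = \<one>\<^bsub>B\<^esub>,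
     ring.zero = \<zero>\<^bsub>B\<^esub>, add = add B,
     smult = (\<lambda>a x. \<phi> a \<otimes>\<^bsub>B\<^esub> x)\<rparr>"

definition quotient_length :: "('a, 'm) ring_scheme \<Rightarrow> 'a set \<Rightarrow> enat" where
  "quotient_length R I =
    module_length R (restrict_scalars (\<lambda>r. I +>\<^bsub>R\<^esub> r) (R Quot I) (carrier (R Quot I)))"

definition frobenius_power :: "('a, 'm) ring_scheme \<Rightarrow> 'a set \<Rightarrow> nat \<Rightarrow> 'a set" where
  "frobenius_power R I q = genideal R ((\<lambda>a. a [^]\<^bsub>R\<^esub> q) ` I)"

text \<open>\<open>G n\<close> is the component of degree \<open>n\<close>; the second clause says that \<open>R\<close> is the internal
  direct sum of the components.\<close>

definition graded_ring :: "('a, 'm) ring_scheme \<Rightarrow> (nat \<Rightarrow> 'a set) \<Rightarrow> bool" where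
  "graded_ring R G \<longleftrightarrow>
    (\<forall>n. additive_subgroup (G n) R) \<and>
    (\<forall>x\<in>carrier R. \<exists>!a. (\<forall>n. a n \<in> G n) \<and> finite {n. a n \<noteq> \<zero>\<^bsub>R\<^esub>} \<and>
        x = finsum R a {n. a n \<noteq> \<zero>\<^bsub>R\<^esub>}) \<and>
    (\<forall>m n. \<forall>x\<in>G m. \<forall>y\<in>G n. x \<otimes>\<^bsub>R\<^esub> y \<in> G (m + n))"

definition graded_ideal :: "('a, 'm) ring_scheme \<Rightarrow> (nat \<Rightarrow> 'a set) \<Rightarrow> 'a set \<Rightarrow> bool" where
  "graded_ideal R G I \<longleftrightarrow> ideal I R \<and> I = genideal R (\<Union>n. I \<inter> G n)"

section \<open>SG pairs\<close>

text \<open>The identification of the ground field with the degree-0 component is part of the data.\<close>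

record ('k, 'a) sg_data =
  sg_ring :: "'a ring"
  sg_embed :: "'k \<Rightarrow> 'a"
  sg_grade :: "nat \<Rightarrow> 'a set"
  sg_ideal :: "'a set"

definition sg_pair :: "'k ring \<Rightarrow> ('k, 'a) sg_data \<Rightarrow> bool" where
  "sg_pair K P \<longleftrightarrow>
    cring (sg_ring P) \<and> noetherian_ring (sg_ring P) \<and>
    graded_ring (sg_ring P) (sg_grade P) \<and>
    sg_embed P \<in> ring_hom K (sg_ring P) \<and> bij_betw (sg_embed P) (carrier K) (sg_grade P 0) \<and>
    generate_ring (sg_ring P) (sg_grade P 0 \<union> sg_grade P 1) = carrier (sg_ring P) \<and>
    graded_ideal (sg_ring P) (sg_grade P) (sg_ideal P) \<and>
    sg_ideal P \<noteq> carrier (sg_ring P) \<and>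
    quotient_length (sg_ring P) (sg_ideal P) < \<infinity>"

text \<open>The isomorphisms are ring isomorphisms; they need not be linear over the ground field.\<close>

definition sg_isomorphic :: "('k, 'a) sg_data \<Rightarrow> ('k, 'b) sg_data \<Rightarrow> bool" where
  "sg_isomorphic P Q \<longleftrightarrow>
    (\<exists>\<eta>\<in>ring_iso (sg_ring P) (sg_ring Q).
       (\<forall>n. \<eta> ` sg_grade P n = sg_grade Q n) \<and> \<eta> ` sg_ideal P = sg_ideal Q)"

definition sg_iso_rel :: "'k ring \<Rightarrow> (('k, 'a) sg_data \<times> ('k, 'a) sg_data) set" where
  "sg_iso_rel K = {(P, Q). sg_pair K P \<and> sg_pair K Q \<and> sg_isomorphic P Q}"

definition sg_classes :: "'k ring \<Rightarrow> ('k, 'a) sg_data set set" where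
  "sg_classes K = {P. sg_pair K P} // sg_iso_rel K"

section \<open>Hilbert--Kunz density and Fourier transforms\<close>

text \<open>The length of the degree-\<open>m\<close> component of \<open>R/J\<close> over the degree-0 part.\<close>

definition graded_quotient_length :: "'k ring \<Rightarrow> ('k, 'a) sg_data \<Rightarrow> 'a set \<Rightarrow> nat \<Rightarrow> enat" where
  "graded_quotient_length K P J m =
    (let R = sg_ring P in
     module_length K (restrict_scalars (\<lambda>c. J +>\<^bsub>R\<^esub> sg_embed P c) (R Quot J)
       ((\<lambda>x. J +>\<^bsub>R\<^esub> x) ` sg_grade P m)))"

definition sg_dim :: "('k, 'a) sg_data \<Rightarrow> nat" where
  "sg_dim P = the_enat (krull_dim (sg_ring P))"

text \<open>The exponent \<open>d - 1\<close> is an integer, being \<open>-1\<close> in dimension 0.\<close>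

definition hk_fn :: "'k ring \<Rightarrow> ('k, 'a) sg_data \<Rightarrow> nat \<Rightarrow> real \<Rightarrow> real" where
  "hk_fn K P n x =
    (let q = ring_char K ^ n in
     if x < 0 then 0
     else 1 / real q powi (int (sg_dim P) - 1) *
       real (the_enat (graded_quotient_length K P
         (frobenius_power (sg_ring P) (sg_ideal P) q) (nat \<lfloor>x * real q\<rfloor>))))"

text \<open>In dimension 1 the limit may fail to exist at finitely many points, where the value is
  unspecified; this does not affect integrals.\<close>

definition hk_density :: "'k ring \<Rightarrow> ('k, 'a) sg_data \<Rightarrow> real \<Rightarrow> real" where
  "hk_density K P x = lim (\<lambda>n. hk_fn K P n x)"

definition fourier_integrand :: "(real \<Rightarrow> real) \<Rightarrow> complex \<Rightarrow> real \<Rightarrow> complex" where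
  "fourier_integrand f z t = complex_of_real (f t) * exp (\<i> * complex_of_real t * z)"

definition fourier_transform :: "(real \<Rightarrow> real) \<Rightarrow> complex \<Rightarrow> complex" where
  "fourier_transform f z = (LINT t|lborel. fourier_integrand f z t)"

definition hk_F :: "'k ring \<Rightarrow> ('k, 'a) sg_data \<Rightarrow> complex \<Rightarrow> complex" where
  "hk_F K P z = lim (\<lambda>n. fourier_transform (hk_fn K P n) z)"

end

theory Submission imports Defs "HOL-Real_Asymp.Real_Asymp"
begin

text \<open>All lengths are lengths of chains of subspaces over the degree-0 field. A graded ring has a
  filtration with quotients \<open>R/P\<close> for homogeneous primes \<open>P\<close>, so Hilbert functions are eventually
  polynomial, and the Krull dimension \<open>d\<close> is one more than the degree of that of \<open>R\<close>. Let \<open>d \<ge> 1\<close>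
  and let \<open>q\<close> be a large power of \<open>p\<close>. Since the \<open>q\<close>-th power map is surjective on the field, the
  pieces \<open>\<Oplus>\<^sub>m R\<^sub>q\<^sub>m\<^sub>+\<^sub>r\<close>, as modules over \<open>R\<close> through this map, are up to lower-dimensional error direct sums
  of shifted copies of the rings \<open>R/P\<close> with \<open>P\<close> of maximal dimension, the same copies for all \<open>r\<close>.
  Hence the length of \<open>R/I\<^sup>[\<^sup>q\<^sup>q\<^sup>'\<^sup>]\<close> in degree \<open>q m + r\<close> is the sum of those of \<open>(R/P)/I\<^sup>[\<^sup>q\<^sup>'\<^sup>]\<close> in degree \<open>m\<close>
  up to lower order; over \<open>R/P\<close> itself the number of copies must be \<open>q\<^sup>d\<^sup>-\<^sup>1\<close>, so normalized lengths change by
  \<open>O(1/q')\<close> from one power to the next. They therefore converge at all \<open>x > 0\<close> except degrees of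
  generators of \<open>I\<close>. The functions \<open>f\<^sub>n\<close> are bounded with supports in a common compact interval, so dominated convergence passes
  to the Fourier transforms, and the limit is entire by its power series. If \<open>d = 0\<close>, then
  \<open>I\<^sup>[\<^sup>q\<^sup>] = 0\<close> for large \<open>q\<close>, so \<open>f\<^sub>n(x) = q w(q x)\<close> for a fixed \<open>w\<close> and the transforms tend to the
  constant \<open>\<integral> w\<close>.\<close>

section \<open>Chain lengths\<close>

text \<open>In the comparison argument no quotient and no twisted module is formed: each module is a
  subquotient of the ring, given by families of subspaces, and \<open>q\<close>-th powers act by
  maps that are linear up to a change of scalars. The obstacle is that the ring may have nilpotents
  and several components, so a prime filtration need not split up to small error. Taking
  \<open>q\<close> at least the length of a filtration cures this: an element lying in all primes of
  the filtration then dies under the \<open>q\<close>-th power. This price is paid once, in passing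
  from the ring to its primes of top dimension. Modulo a single prime the filtration has length 1,
  so every \<open>q\<close> is allowed and the step repeats at each power of \<open>p\<close>. For
  the repetition the error must be uniform in the ideal. It is a fixed sequence \<open>u\<close>,
  chosen before the generators \<open>hs\<close> and combined only with their degrees; Frobenius
  powers merely multiply these degrees. A linear form outside a prime removes both the dependence on
  the residue \<open>r\<close> and the degree shifts of the copies: multiplication by its powers is
  injective modulo the prime and has a cokernel of lower order.\<close>

definition chain_length :: "'a set set \<Rightarrow> enat" where
  "chain_length S = (SUP n \<in> {n. \<exists>N. (\<forall>i\<le>n. N i \<in> S) \<and> (\<forall>i<n. N i \<subset> N (Suc i))}. enat n)"

lemma chain_length_geI:
  "(\<forall>i\<le>n. N i \<in> S) \<Longrightarrow> (\<forall>i<n. N i \<subset> N (Suc i)) \<Longrightarrow> enat n \<le> chain_length S"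
  unfolding chain_length_def by (rule SUP_upper) auto

text \<open>A supremum that reaches a finite \<open>n\<close> is witnessed by a chain of at least
  that length, and such a chain can be truncated. A nonempty \<open>S\<close> provides the chain of
  length 0.\<close>

lemma le_chain_length_iff:
  assumes "S \<noteq> {}"
  shows "enat n \<le> chain_length S \<longleftrightarrow> (\<exists>N. (\<forall>i\<le>n. N i \<in> S) \<and> (\<forall>i<n. N i \<subset> N (Suc i)))"
    (is "_ \<longleftrightarrow> ?C n")
proof
  assume le: "enat n \<le> chain_length S"
  show "?C n"
  proof (rule ccontr)
    assume no: "\<not> ?C n"
    have "n \<noteq> 0" using no assms by (auto simp: ex_in_conv)
    have "m \<le> n - 1" if "?C m" for m
    proof (rule ccontr)
      assume "\<not> m \<le> n - 1"
      then have "n \<le> m" by simp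
      from that obtain N where "(\<forall>i\<le>m. N i \<in> S) \<and> (\<forall>i<m. N i \<subset> N (Suc i))" by blast
      with \<open>n \<le> m\<close> have "(\<forall>i\<le>n. N i \<in> S) \<and> (\<forall>i<n. N i \<subset> N (Suc i))" by simp
      with no show False by blast
    qed
    then have "chain_length S \<le> enat (n - 1)"
      unfolding chain_length_def by (intro SUP_least) auto
    with le have "enat n \<le> enat (n - 1)" by (rule order_trans)
    with \<open>n \<noteq> 0\<close> show False by simp
  qed
qed (auto intro: chain_length_geI)

lemma chain_length_mono_map:
  assumes "\<And>U. U \<in> S \<Longrightarrow> f U \<in> T"
    and "\<And>U W. U \<in> S \<Longrightarrow> W \<in> S \<Longrightarrow> U \<subset> W \<Longrightarrow> f U \<subset> f W"
  shows "chain_length S \<le> chain_length T"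
  unfolding chain_length_def[of S]
proof (rule SUP_least)
  fix n assume "n \<in> {n. \<exists>N. (\<forall>i\<le>n. N i \<in> S) \<and> (\<forall>i<n. N i \<subset> N (Suc i))}"
  then obtain N where N: "\<forall>i\<le>n. N i \<in> S" "\<forall>i<n. N i \<subset> N (Suc i)" by blast
  show "enat n \<le> chain_length T"
  proof (rule chain_length_geI)
    show "\<forall>i\<le>n. f (N i) \<in> T" using N(1) assms(1) by blast
    show "\<forall>i<n. f (N i) \<subset> f (N (Suc i))"
      using N assms(2) by (meson Suc_leI less_imp_le)
  qed
qed

lemma chain_length_mono: "S \<subseteq> T \<Longrightarrow> chain_length S \<le> chain_length T"
  by (rule chain_length_mono_map[where f = "\<lambda>x. x"]) auto

lemma chain_length_bij:
  assumes "\<And>U. U \<in> S \<Longrightarrow> f U \<in> T" and "\<And>W. W \<in> T \<Longrightarrow> g W \<in> S"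
    and "\<And>U. U \<in> S \<Longrightarrow> g (f U) = U" and "\<And>W. W \<in> T \<Longrightarrow> f (g W) = W"
    and "\<And>U U'. U \<in> S \<Longrightarrow> U' \<in> S \<Longrightarrow> U \<subseteq> U' \<Longrightarrow> f U \<subseteq> f U'"
    and "\<And>W W'. W \<in> T \<Longrightarrow> W' \<in> T \<Longrightarrow> W \<subseteq> W' \<Longrightarrow> g W \<subseteq> g W'"
  shows "chain_length S = chain_length T"
proof (rule antisym)
  show "chain_length S \<le> chain_length T"
    by (rule chain_length_mono_map[where f = f]) (use assms in \<open>metis psubset_eq\<close>)+
  show "chain_length T \<le> chain_length S"
    by (rule chain_length_mono_map[where f = g]) (use assms in \<open>metis psubset_eq\<close>)+
qed

lemma enat_eqI_le: "(\<And>n. enat n \<le> a \<longleftrightarrow> enat n \<le> b) \<Longrightarrow> a = b"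
proof (rule antisym)
  have *: "u \<le> v" if "\<And>n. enat n \<le> u \<Longrightarrow> enat n \<le> v" for u v :: enat
  proof (cases u)
    case (enat k)
    then show ?thesis using that by simp
  next
    case infinity
    show ?thesis
    proof (cases v)
      case (enat k)
      then show ?thesis using that[of "Suc k"] infinity by simp
    qed simp
  qed
  assume "\<And>n. enat n \<le> a \<longleftrightarrow> enat n \<le> b"
  then show "a \<le> b" "b \<le> a" by (auto intro: *)
qed

section \<open>Growth of sequences\<close>

text \<open>\<open>eventually_poly d u\<close> says that \<open>u\<close> agrees eventually with a polynomial of degree less
  than \<open>d\<close>; this is expressed by iterated differences.\<close>

primrec eventually_poly :: "nat \<Rightarrow> (nat \<Rightarrow> real) \<Rightarrow> bool" where
  "eventually_poly 0 u \<longleftrightarrow> (\<exists>M. \<forall>m\<ge>M. u m = 0)"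
| "eventually_poly (Suc d) u \<longleftrightarrow> eventually_poly d (\<lambda>m. u (Suc m) - u m)"

text \<open>The order of the Hilbert function of a ring of dimension \<open>d\<close>: degree at
  most \<open>d - 1\<close>, and eventually zero when \<open>d\<close> is 0. One constant serves as
  factor or as threshold, and \<open>m + 1\<close> keeps the bound usable at
  \<open>m = 0\<close>.\<close>

definition growth :: "nat \<Rightarrow> (nat \<Rightarrow> real) \<Rightarrow> bool" where
  "growth d u \<longleftrightarrow>
     (\<exists>C::nat. \<forall>m. if d = 0 then m \<ge> C \<longrightarrow> u m = 0 else \<bar>u m\<bar> \<le> C * (real m + 1) ^ (d - 1))"

text \<open>The Hilbert function of a graded module whose generator has been moved to degree
  \<open>a\<close>.\<close>

definition shift_seq :: "nat \<Rightarrow> (nat \<Rightarrow> real) \<Rightarrow> nat \<Rightarrow> real" where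
  "shift_seq a u m = (if a \<le> m then u (m - a) else 0)"

lemma eventually_poly_zero: "eventually_poly d (\<lambda>m. 0)"
  by (induction d) auto

lemma eventually_poly_add:
  "eventually_poly d u \<Longrightarrow> eventually_poly d v \<Longrightarrow> eventually_poly d (\<lambda>m. u m + v m)"
proof (induction d arbitrary: u v)
  case 0
  then obtain M M' where "\<forall>m\<ge>M. u m = 0" "\<forall>m\<ge>M'. v m = 0" by auto
  then have "\<forall>m\<ge>max M M'. u m + v m = 0" by simp
  then show ?case by (simp, blast)
next
  case (Suc d)
  have "eventually_poly d (\<lambda>m. (u (Suc m) - u m) + (v (Suc m) - v m))"
    by (rule Suc.IH) (use Suc.prems in auto)
  then show ?case by (simp add: algebra_simps)
qed

lemma eventually_poly_Suc: "eventually_poly d u \<Longrightarrow> eventually_poly (Suc d) u"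
proof (induction d arbitrary: u)
  case 0
  then obtain M where "\<forall>m\<ge>M. u m = 0" by auto
  then have "\<forall>m\<ge>M. u (Suc m) - u m = 0" by auto
  then show ?case by (simp, blast)
next
  case (Suc d)
  then show ?case using Suc.IH[of "\<lambda>m. u (Suc m) - u m"] by (simp only: eventually_poly.simps)
qed

lemma eventually_poly_mono: "d \<le> e \<Longrightarrow> eventually_poly d u \<Longrightarrow> eventually_poly e u"
  by (induction e rule: dec_induct) (auto dest: eventually_poly_Suc simp del: eventually_poly.simps)

lemma eventually_poly_shift: "eventually_poly d u \<Longrightarrow> eventually_poly d (\<lambda>m. u (m + a))"
proof (induction d arbitrary: u)
  case 0
  then obtain M where "\<forall>m\<ge>M. u m = 0" by auto
  then have "\<forall>m\<ge>M. u (m + a) = 0" by auto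
  then show ?case by (simp, blast)
next
  case (Suc d)
  have "eventually_poly d (\<lambda>m. u (Suc (m + a)) - u (m + a))"
    by (rule Suc.IH[of "\<lambda>m. u (Suc m) - u m"]) (use Suc.prems in auto)
  then show ?case by simp
qed

lemma eventually_poly_unshift: "eventually_poly d (\<lambda>m. u (m + a)) \<Longrightarrow> eventually_poly d u"
proof (induction d arbitrary: u)
  case 0
  then obtain M where M: "\<forall>m\<ge>M. u (m + a) = 0" by auto
  have "\<forall>m\<ge>M + a. u m = 0"
  proof (intro allI impI)
    fix m assume "m \<ge> M + a"
    then show "u m = 0" using M[rule_format, of "m - a"] by simp
  qed
  then show ?case by (simp, blast)
next
  case (Suc d)
  have "eventually_poly d (\<lambda>m. u (Suc m) - u m)"
    by (rule Suc.IH) (use Suc.prems in auto)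
  then show ?case by simp
qed

lemma eventually_poly_shift_seq: "eventually_poly d u \<Longrightarrow> eventually_poly d (shift_seq a u)"
  by (rule eventually_poly_unshift[where a = a]) (simp add: shift_seq_def)

lemma eventually_poly_diff_shift:
  "eventually_poly (Suc d) u \<Longrightarrow> eventually_poly d (\<lambda>m. u (m + a) - u m)"
proof (induction a)
  case 0
  then show ?case by (simp add: eventually_poly_zero)
next
  case (Suc a)
  have "eventually_poly d (\<lambda>m. u (Suc m) - u m)" using Suc.prems by simp
  from eventually_poly_shift[OF this, of a]
  have "eventually_poly d (\<lambda>m. (u (Suc (m + a)) - u (m + a)) + (u (m + a) - u m))"
    by (intro eventually_poly_add Suc.IH Suc.prems)
  then show ?case by simp
qed

lemma eventually_poly_sum_list:
  "(\<And>x. x \<in> set xs \<Longrightarrow> eventually_poly d (f x)) \<Longrightarrow>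
    eventually_poly d (\<lambda>m. \<Sum>x\<leftarrow>xs. f x m)"
  by (induction xs) (auto intro: eventually_poly_zero eventually_poly_add)

section \<open>Orders of growth\<close>

lemma growth_zero [simp]: "growth d (\<lambda>m. 0)"
  unfolding growth_def by (rule exI[of _ 0]) auto

lemma growth_le:
  assumes "growth d v" and "\<And>m. \<bar>u m\<bar> \<le> \<bar>v m\<bar>"
  shows "growth d u"
proof -
  from assms(1) obtain C where
    C: "\<And>m. if d = 0 then m \<ge> C \<longrightarrow> v m = 0 else \<bar>v m\<bar> \<le> real C * (real m + 1) ^ (d - 1)"
    unfolding growth_def by blast
  have "if d = 0 then m \<ge> C \<longrightarrow> u m = 0 else \<bar>u m\<bar> \<le> real C * (real m + 1) ^ (d - 1)" for m
    using C[of m] assms(2)[of m] by (auto split: if_splits)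
  then show ?thesis unfolding growth_def by blast
qed

lemma growth_add:
  assumes "growth d u" "growth d v"
  shows "growth d (\<lambda>m. u m + v m)"
proof -
  from assms obtain C D where
    C: "\<And>m. if d = 0 then m \<ge> C \<longrightarrow> u m = 0 else \<bar>u m\<bar> \<le> real C * (real m + 1) ^ (d - 1)" and
    D: "\<And>m. if d = 0 then m \<ge> D \<longrightarrow> v m = 0 else \<bar>v m\<bar> \<le> real D * (real m + 1) ^ (d - 1)"
    unfolding growth_def by blast
  have "if d = 0 then m \<ge> C + D \<longrightarrow> u m + v m = 0
     else \<bar>u m + v m\<bar> \<le> real (C + D) * (real m + 1) ^ (d - 1)" for m
    using C[of m] D[of m] abs_triangle_ineq[of "u m" "v m"]
    by (auto split: if_splits simp: algebra_simps)
  then show ?thesis unfolding growth_def by blast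
qed

lemma growth_minus: "growth d u \<Longrightarrow> growth d (\<lambda>m. - u m)"
  by (rule growth_le) auto

lemma growth_diff: "growth d u \<Longrightarrow> growth d v \<Longrightarrow> growth d (\<lambda>m. u m - v m)"
  using growth_add[OF _ growth_minus, of d u v] by simp

lemma growth_sum_list:
  "(\<And>x. x \<in> set xs \<Longrightarrow> growth d (f x)) \<Longrightarrow> growth d (\<lambda>m. \<Sum>x\<leftarrow>xs. f x m)"
  by (induction xs) (auto intro: growth_add)

lemma growth_affine:
  assumes "growth d u" "q > 0"
  shows "growth d (\<lambda>m. u (q * m + r))"
proof -
  from assms obtain C where
    C: "\<And>m. if d = 0 then m \<ge> C \<longrightarrow> u m = 0 else \<bar>u m\<bar> \<le> real C * (real m + 1) ^ (d - 1)"
    unfolding growth_def by blast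
  have "if d = 0 then m \<ge> C \<longrightarrow> u (q * m + r) = 0
     else \<bar>u (q * m + r)\<bar> \<le> real (C * (q + r) ^ (d - 1) + C) * (real m + 1) ^ (d - 1)" for m
  proof (cases "d = 0")
    case True
    have "m \<le> q * m + r" using assms(2) by (simp add: trans_le_add1)
    then show ?thesis using C[of "q * m + r"] True by auto
  next
    case False
    have "real (q * m + r) + 1 \<le> real (q + r) * (real m + 1)"
      using assms(2) by (cases q) (auto simp: algebra_simps)
    then have "(real (q * m + r) + 1) ^ (d - 1) \<le> (real (q + r) * (real m + 1)) ^ (d - 1)"
      by (intro power_mono) auto
    then have "real C * (real (q * m + r) + 1) ^ (d - 1)
        \<le> real C * ((real (q + r)) ^ (d - 1) * (real m + 1) ^ (d - 1))"
      by (simp add: mult_left_mono power_mult_distrib)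
    moreover have "\<bar>u (q * m + r)\<bar> \<le> real C * (real (q * m + r) + 1) ^ (d - 1)"
      using C[of "q * m + r"] False by simp
    ultimately show ?thesis using False
      by (simp add: algebra_simps) (smt (verit) mult_nonneg_nonneg of_nat_0_le_iff zero_le_power)
  qed
  moreover have "u (q * m + r) = 0" if "d = 0" "m \<ge> C" for m
  proof -
    have "1 * m \<le> q * m" using assms(2) by (intro mult_right_mono) auto
    then have "C \<le> q * m + r" using that(2) by linarith
    then show ?thesis using C[of "q * m + r"] that(1) by simp
  qed
  ultimately show ?thesis unfolding growth_def
    by (cases "d = 0") (auto intro: exI[of _ C] exI[of _ "C * (q + r) ^ (d - 1) + C"])
qed

lemma growth_shift_seq:
  assumes "growth d u" shows "growth d (shift_seq a u)"
proof -
  from assms obtain C where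
    C: "\<And>m. if d = 0 then m \<ge> C \<longrightarrow> u m = 0 else \<bar>u m\<bar> \<le> real C * (real m + 1) ^ (d - 1)"
    unfolding growth_def by blast
  have "if d = 0 then m \<ge> C + a \<longrightarrow> shift_seq a u m = 0
     else \<bar>shift_seq a u m\<bar> \<le> real (C + a) * (real m + 1) ^ (d - 1)" for m
  proof (cases "d = 0 \<or> m < a")
    case True
    then show ?thesis using C[of "m - a"] by (auto simp: shift_seq_def)
  next
    case False
    have "\<bar>u (m - a)\<bar> \<le> real C * (real (m - a) + 1) ^ (d - 1)"
      using C[of "m - a"] False by simp
    also have "\<dots> \<le> real (C + a) * (real m + 1) ^ (d - 1)"
      by (intro mult_mono power_mono) auto
    finally show ?thesis using False by (simp add: shift_seq_def)
  qed
  then show ?thesis unfolding growth_def by blast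
qed

lemma growth_Suc: "growth d u \<Longrightarrow> growth (Suc d) u"
proof -
  assume "growth d u"
  then obtain C where
    C: "\<And>m. if d = 0 then m \<ge> C \<longrightarrow> u m = 0 else \<bar>u m\<bar> \<le> real C * (real m + 1) ^ (d - 1)"
    unfolding growth_def by blast
  show "growth (Suc d) u"
  proof (cases "d = 0")
    case True
    define D where "D = nat \<lceil>\<Sum>m<C. \<bar>u m\<bar>\<rceil>"
    have "\<bar>u m\<bar> \<le> D" for m
    proof (cases "m < C")
      case True
      have "\<bar>u m\<bar> \<le> (\<Sum>m<C. \<bar>u m\<bar>)" by (rule member_le_sum) (use True in auto)
      then show ?thesis unfolding D_def by linarith
    qed (use C[of m] True in auto)
    then show ?thesis unfolding growth_def using True by auto
  next
    case False
    have "\<bar>u m\<bar> \<le> real C * (real m + 1) ^ d" for m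
    proof -
      have "(real m + 1) ^ (d - 1) \<le> (real m + 1) ^ d" by (rule power_increasing) auto
      then show ?thesis using C[of m] False
        by (smt (verit) mult_left_mono of_nat_0_le_iff)
    qed
    then show ?thesis unfolding growth_def by auto
  qed
qed

lemma growth_partial_sums:
  assumes "growth d u" shows "growth (Suc d) (\<lambda>m. \<Sum>k<m. u k)"
proof -
  have "growth (Suc d) u" by (rule growth_Suc[OF assms])
  show ?thesis
  proof (cases "d = 0")
    case True
    then obtain C where C: "\<And>m. m \<ge> C \<Longrightarrow> u m = 0" using assms unfolding growth_def by auto
    define D where "D = nat \<lceil>\<Sum>m<C. \<bar>u m\<bar>\<rceil>"
    have "\<bar>\<Sum>k<m. u k\<bar> \<le> D" for m
    proof -
      have "\<bar>\<Sum>k<m. u k\<bar> \<le> (\<Sum>k<m. \<bar>u k\<bar>)" by (rule sum_abs)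
      also have "\<dots> \<le> (\<Sum>k\<in>{..<m} \<union> {..<C}. \<bar>u k\<bar>)" by (rule sum_mono2) auto
      also have "\<dots> = (\<Sum>k<C. \<bar>u k\<bar>)" by (rule sum.mono_neutral_right) (use C in auto)
      finally show ?thesis unfolding D_def by linarith
    qed
    then show ?thesis unfolding growth_def using True by auto
  next
    case False
    then obtain C where C: "\<And>m. \<bar>u m\<bar> \<le> real C * (real m + 1) ^ (d - 1)"
      using assms unfolding growth_def by auto
    have "\<bar>\<Sum>k<m. u k\<bar> \<le> real C * (real m + 1) ^ d" for m
    proof -
      have "\<bar>\<Sum>k<m. u k\<bar> \<le> (\<Sum>k<m. \<bar>u k\<bar>)" by (rule sum_abs)
      also have "\<dots> \<le> (\<Sum>k<m. real C * (real m + 1) ^ (d - 1))"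
      proof (rule sum_mono)
        fix k assume "k \<in> {..<m}"
        then have "(real k + 1) ^ (d - 1) \<le> (real m + 1) ^ (d - 1)" by (intro power_mono) auto
        then show "\<bar>u k\<bar> \<le> real C * (real m + 1) ^ (d - 1)"
          using C[of k] by (smt (verit) mult_left_mono of_nat_0_le_iff)
      qed
      also have "\<dots> = real m * (real C * (real m + 1) ^ (d - 1))" by simp
      also have "\<dots> \<le> (real m + 1) * (real C * (real m + 1) ^ (d - 1))"
        by (intro mult_right_mono) auto
      also have "\<dots> = real C * (real m + 1) ^ d" using False by (cases d) auto
      finally show ?thesis .
    qed
    then show ?thesis unfolding growth_def by auto
  qed
qed

lemma growth_const: "growth (Suc d) (\<lambda>m. c)"
proof -
  have "growth (Suc 0) (\<lambda>m. c)" unfolding growth_def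
    by (rule exI[of _ "nat \<lceil>\<bar>c\<bar>\<rceil>"]) auto
  then show ?thesis by (induction d) (auto dest: growth_Suc)
qed

lemma eventually_poly_growth: "eventually_poly d u \<Longrightarrow> growth d u"
proof (induction d arbitrary: u)
  case 0
  then show ?case by (auto simp: growth_def)
next
  case (Suc d)
  have "growth (Suc d) (\<lambda>m. (\<Sum>k<m. u (Suc k) - u k) + u 0)"
    by (intro growth_add growth_partial_sums growth_const Suc.IH) (use Suc.prems in auto)
  moreover have "(\<Sum>k<m. u (Suc k) - u k) + u 0 = u m" for m
    by (induction m) auto
  ultimately show ?case by simp
qed

text \<open>Binomial coefficients replace powers because the difference of
  \<open>m choose Suc d\<close> is \<open>m choose d\<close>: subtracting the leading term is
  compatible with taking differences.\<close>

lemma eventually_poly_leading_term: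
  "eventually_poly (Suc d) u \<Longrightarrow> \<exists>e. eventually_poly d (\<lambda>m. u m - e * real (m choose d))"
proof (induction d arbitrary: u)
  case 0
  then obtain M where M: "\<forall>m\<ge>M. u (Suc m) - u m = 0" by auto
  have "u m - u M = 0" if "m \<ge> M" for m
    using that by (induction m rule: dec_induct) (use M in auto)
  then have "\<forall>m\<ge>M. u m - u M * real (m choose 0) = 0"
    by (simp only: binomial_n_0 of_nat_1 mult_1_right) blast
  then have "eventually_poly 0 (\<lambda>m. u m - u M * real (m choose 0))"
    unfolding eventually_poly.simps by blast
  then show ?case by blast
next
  case (Suc d)
  from Suc.prems have "eventually_poly (Suc d) (\<lambda>m. u (Suc m) - u m)"
    by (simp only: eventually_poly.simps)
  from Suc.IH[OF this]
  obtain e where "eventually_poly d (\<lambda>m. (u (Suc m) - u m) - e * real (m choose d))" by blast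
  then have "eventually_poly (Suc d) (\<lambda>m. u m - e * real (m choose Suc d))"
    by (simp add: algebra_simps)
  then show ?case by blast
qed

lemma binomial_asymp: "(\<lambda>m. real (m choose d) / real m ^ d) \<longlonglongrightarrow> 1 / fact d"
proof (induction d)
  case 0
  show ?case by simp
next
  case (Suc d)
  have eq: "real (m choose Suc d) / real m ^ Suc d =
      real (m choose d) / real m ^ d * ((real m - real d) / real m) / real (Suc d)" for m
  proof (cases "d \<le> m")
    case True
    have "Suc d * (m choose Suc d) = (m - d) * (m choose d)"
      using binomial_absorb_comp[of m d] binomial_absorption[of d m] by simp
    then have "real (Suc d) * real (m choose Suc d) = (real m - real d) * real (m choose d)"
      using True by (metis of_nat_diff of_nat_mult)
    then have "real (m choose Suc d) = (real m - real d) * real (m choose d) / real (Suc d)"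
      by (simp add: field_simps del: binomial_Suc_Suc)
    then show ?thesis by (simp del: binomial_Suc_Suc add: mult_ac)
  qed (auto simp: binomial_eq_0)
  have "(\<lambda>m. (real m - real d) / real m) \<longlonglongrightarrow> 1" by real_asymp
  from tendsto_divide[OF tendsto_mult[OF Suc this] tendsto_const[of "real (Suc d)"]]
  show ?case unfolding eq by (simp add: field_simps)
qed

lemma growth_tendsto_0:
  assumes "growth d u" shows "(\<lambda>m. u m / real m ^ d) \<longlonglongrightarrow> 0"
proof -
  from assms obtain C where
    C: "\<And>m. if d = 0 then m \<ge> C \<longrightarrow> u m = 0 else \<bar>u m\<bar> \<le> real C * (real m + 1) ^ (d - 1)"
    unfolding growth_def by blast
  show ?thesis
  proof (cases d)
    case 0
    then show ?thesis using C
      by (intro tendsto_eventually) (auto simp: eventually_at_top_linorder)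
  next
    case (Suc k)
    have lim: "(\<lambda>m. real C * ((real m + 1) / real m) ^ k * (1 / real m)) \<longlonglongrightarrow> real C * 1 ^ k * 0"
      by (intro tendsto_intros) real_asymp+
    have "\<bar>u m / real m ^ d\<bar> \<le> real C * ((real m + 1) / real m) ^ k * (1 / real m)" for m
    proof -
      have "\<bar>u m / real m ^ d\<bar> \<le> real C * (real m + 1) ^ k / real m ^ d"
        using C[of m] Suc by (simp add: divide_right_mono)
      also have "\<dots> = real C * ((real m + 1) / real m) ^ k * (1 / real m)"
        using Suc by (simp add: power_divide)
      finally show ?thesis .
    qed
    then have "\<forall>\<^sub>F m in sequentially. norm (u m / real m ^ d)
        \<le> real C * ((real m + 1) / real m) ^ k * (1 / real m)"
      by (intro always_eventually allI) (simp only: real_norm_def)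
    from Lim_null_comparison[OF this] lim show ?thesis by simp
  qed
qed

text \<open>Comparing leading coefficients along \<open>m \<mapsto> q m\<close>.\<close>

lemma growth_ratio:
  assumes "eventually_poly (Suc d) u" and "\<not> growth d u" and "q > 0"
    and "growth d (\<lambda>m. u (q * m) - \<rho> * u m)"
  shows "\<rho> = real q ^ d"
proof -
  obtain e where "eventually_poly d (\<lambda>m. u m - e * real (m choose d))"
    using eventually_poly_leading_term[OF assms(1)] by blast
  then have g: "growth d (\<lambda>m. u m - e * real (m choose d))" by (rule eventually_poly_growth)
  \<comment> \<open>A zero leading coefficient would give \<open>u\<close> growth of order
    \<open>d\<close>, which is excluded.\<close>
  have "e \<noteq> 0" using g assms(2) by auto
  have "(\<lambda>m. (u m - e * real (m choose d)) / real m ^ d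
      + e * (real (m choose d) / real m ^ d)) \<longlonglongrightarrow> 0 + e * (1 / fact d)"
    by (intro tendsto_intros growth_tendsto_0 g binomial_asymp)
  then have L: "(\<lambda>m. u m / real m ^ d) \<longlonglongrightarrow> e / fact d"
    by (simp add: diff_divide_distrib)
  have "filterlim (\<lambda>m. q * m) at_top sequentially"
    using assms(3) by (intro filterlim_subseq) (auto simp: strict_mono_def)
  from filterlim_compose[OF L this]
  have "(\<lambda>m. u (q * m) / real (q * m) ^ d) \<longlonglongrightarrow> e / fact d" .
  from tendsto_mult[OF this tendsto_const[of "real q ^ d"]]
  have "(\<lambda>m. u (q * m) / real (q * m) ^ d * real q ^ d) \<longlonglongrightarrow> e / fact d * real q ^ d" .
  moreover have "u (q * m) / real (q * m) ^ d * real q ^ d = u (q * m) / real m ^ d" for m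
    using assms(3) by (simp add: power_mult_distrib)
  ultimately have L': "(\<lambda>m. u (q * m) / real m ^ d) \<longlonglongrightarrow> e / fact d * real q ^ d" by simp
  have "(\<lambda>m. u (q * m) / real m ^ d - \<rho> * (u m / real m ^ d))
      \<longlonglongrightarrow> e / fact d * real q ^ d - \<rho> * (e / fact d)"
    by (intro tendsto_intros L L')
  moreover have "(\<lambda>m. u (q * m) / real m ^ d - \<rho> * (u m / real m ^ d)) \<longlonglongrightarrow> 0"
    using growth_tendsto_0[OF assms(4)] by (simp add: diff_divide_distrib)
  ultimately have "e / fact d * real q ^ d - \<rho> * (e / fact d) = 0"
    by (rule LIMSEQ_unique)
  then show ?thesis using \<open>e \<noteq> 0\<close> by (simp add: field_simps)
qed

section \<open>Subspaces of a graded algebra and their lengths\<close>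

text \<open>The ground field appears as \<open>G 0\<close>, which \<open>one_neq_zero\<close> and
  \<open>G0_inverse\<close> make a field. Subspaces and lengths are taken over it, so that
  everything happens inside one ring.\<close>

locale graded_algebra = cring R + noetherian_ring R for R (structure) +
  fixes G :: "nat \<Rightarrow> 'a set"
  assumes graded: "graded_ring R G"
    and one_G0: "\<one> \<in> G 0"
    and one_neq_zero: "\<one> \<noteq> \<zero>"
    and G0_inverse: "c \<in> G 0 \<Longrightarrow> c \<noteq> \<zero> \<Longrightarrow> \<exists>d\<in>G 0. c \<otimes> d = \<one>"
    and generated: "generate_ring R (G 0 \<union> G 1) = carrier R"
begin

lemma additive_subgroup_G: "additive_subgroup (G n) R"
  using graded by (auto simp: graded_ring_def)

lemma G_carrier: "x \<in> G n \<Longrightarrow> x \<in> carrier R"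
  using additive_subgroup.a_subset[OF additive_subgroup_G[of n]] by blast

lemma G_zero [simp, intro]: "\<zero> \<in> G n"
  using additive_subgroup.zero_closed[OF additive_subgroup_G[of n]] .

lemma G_add: "x \<in> G n \<Longrightarrow> y \<in> G n \<Longrightarrow> x \<oplus> y \<in> G n"
  using additive_subgroup.a_closed[OF additive_subgroup_G[of n]] .

lemma G_mult: "x \<in> G m \<Longrightarrow> y \<in> G n \<Longrightarrow> x \<otimes> y \<in> G (m + n)"
  using graded by (auto simp: graded_ring_def)

lemma G0_mult: "x \<in> G 0 \<Longrightarrow> y \<in> G n \<Longrightarrow> x \<otimes> y \<in> G n"
  using G_mult[of x 0 y n] by simp

lemma minus_one_G0: "\<ominus> \<one> \<in> G 0"
  using additive_subgroup.a_inv_closed[OF additive_subgroup_G one_G0] .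

lemma G_pow: "x \<in> G m \<Longrightarrow> x [^] (n::nat) \<in> G (n * m)"
proof (induction n)
  case 0
  then show ?case by (simp add: one_G0)
next
  case (Suc n)
  then show ?case using G_mult[of "x [^] n" "n * m" x m] by (simp add: add.commute)
qed

lemma mem_set_add: "z \<in> A <+>\<^bsub>R\<^esub> B \<longleftrightarrow> (\<exists>x\<in>A. \<exists>y\<in>B. z = x \<oplus> y)"
  by (auto simp: set_add_def')

definition ksub :: "'a set \<Rightarrow> bool" where
  "ksub V \<longleftrightarrow> V \<subseteq> carrier R \<and> \<zero> \<in> V \<and> (\<forall>x\<in>V. \<forall>y\<in>V. x \<oplus> y \<in> V) \<and> (\<forall>c\<in>G 0. \<forall>x\<in>V. c \<otimes> x \<in> V)"

lemma ksub_carrier: "ksub V \<Longrightarrow> x \<in> V \<Longrightarrow> x \<in> carrier R"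
  and ksub_zero: "ksub V \<Longrightarrow> \<zero> \<in> V"
  and ksub_add: "ksub V \<Longrightarrow> x \<in> V \<Longrightarrow> y \<in> V \<Longrightarrow> x \<oplus> y \<in> V"
  and ksub_smult: "ksub V \<Longrightarrow> c \<in> G 0 \<Longrightarrow> x \<in> V \<Longrightarrow> c \<otimes> x \<in> V"
  by (auto simp: ksub_def)

lemma ksubI:
  "(\<And>x. x \<in> V \<Longrightarrow> x \<in> carrier R) \<Longrightarrow> \<zero> \<in> V \<Longrightarrow> (\<And>x y. x \<in> V \<Longrightarrow> y \<in> V \<Longrightarrow> x \<oplus> y \<in> V) \<Longrightarrow>
   (\<And>c x. c \<in> G 0 \<Longrightarrow> x \<in> V \<Longrightarrow> c \<otimes> x \<in> V) \<Longrightarrow> ksub V"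
  by (auto simp: ksub_def)

lemma ksub_neg: assumes "ksub V" "x \<in> V" shows "\<ominus> x \<in> V"
proof -
  have "\<ominus> x = (\<ominus> \<one>) \<otimes> x" using ksub_carrier[OF assms] by (simp add: l_minus)
  then show ?thesis using ksub_smult[OF assms(1) minus_one_G0 assms(2)] by simp
qed

lemma ksub_diff: "ksub V \<Longrightarrow> x \<in> V \<Longrightarrow> y \<in> V \<Longrightarrow> x \<ominus> y \<in> V"
  by (simp add: minus_eq ksub_add ksub_neg)

lemma ksub_add_cancel: assumes "ksub V" "x \<oplus> y \<in> V" "x \<in> V" "y \<in> carrier R" shows "y \<in> V"
proof -
  have "y = (x \<oplus> y) \<ominus> x" using assms ksub_carrier[OF assms(1,3)] by algebra
  then show ?thesis using ksub_diff[OF assms(1,2,3)] by simp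
qed

lemma ksub_add_cancel2: "ksub V \<Longrightarrow> x \<oplus> y \<in> V \<Longrightarrow> y \<in> V \<Longrightarrow> x \<in> carrier R \<Longrightarrow> x \<in> V"
  using ksub_add_cancel[of V y x] by (simp add: a_comm ksub_carrier)

lemma ksub_Int: "ksub V \<Longrightarrow> ksub W \<Longrightarrow> ksub (V \<inter> W)"
  by (auto simp: ksub_def)

lemma ksub_Inter: "\<V> \<noteq> {} \<Longrightarrow> (\<And>V. V \<in> \<V> \<Longrightarrow> ksub V) \<Longrightarrow> ksub (\<Inter>\<V>)"
  unfolding ksub_def by blast

lemma ksub_zero_set: "ksub {\<zero>}"
  by (auto simp: ksub_def G_carrier)

lemma ksub_G: "ksub (G n)"
  by (auto simp: ksub_def G_carrier G_add G0_mult)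

lemma ksub_carrier_set: "ksub (carrier R)"
  by (auto simp: ksub_def G_carrier)

lemma ksub_ideal: "ideal I R \<Longrightarrow> ksub I"
  by (rule ksubI)
    (auto simp: G_carrier ideal.I_l_closed additive_subgroup.zero_closed additive_subgroup.a_closed
      ideal.axioms(1) dest: ideal.Icarr)

lemma ksub_set_add: assumes "ksub V" "ksub W" shows "ksub (V <+>\<^bsub>R\<^esub> W)"
proof (rule ksubI)
  show "x \<in> carrier R" if "x \<in> V <+>\<^bsub>R\<^esub> W" for x
    using that assms by (auto simp: mem_set_add ksub_carrier)
  show "\<zero> \<in> V <+>\<^bsub>R\<^esub> W"
    using ksub_zero[OF assms(1)] ksub_zero[OF assms(2)] by (force simp: mem_set_add)
next
  fix x y assume "x \<in> V <+>\<^bsub>R\<^esub> W" "y \<in> V <+>\<^bsub>R\<^esub> W"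
  then obtain a b c d where *: "x = a \<oplus> b" "y = c \<oplus> d" "a \<in> V" "b \<in> W" "c \<in> V" "d \<in> W"
    by (auto simp: mem_set_add)
  then have "x \<oplus> y = (a \<oplus> c) \<oplus> (b \<oplus> d)"
    using assms by (simp add: ksub_carrier a_ac)
  then show "x \<oplus> y \<in> V <+>\<^bsub>R\<^esub> W"
    using * assms by (auto simp: mem_set_add intro: ksub_add)
next
  fix c x assume "c \<in> G 0" "x \<in> V <+>\<^bsub>R\<^esub> W"
  then obtain a b where *: "x = a \<oplus> b" "a \<in> V" "b \<in> W" by (auto simp: mem_set_add)
  then have "c \<otimes> x = c \<otimes> a \<oplus> c \<otimes> b"
    using assms \<open>c \<in> G 0\<close> by (simp add: ksub_carrier r_distr G_carrier)
  then show "c \<otimes> x \<in> V <+>\<^bsub>R\<^esub> W"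
    using * assms \<open>c \<in> G 0\<close> by (auto simp: mem_set_add intro: ksub_smult)
qed

lemma subset_set_add1: "ksub V \<Longrightarrow> ksub W \<Longrightarrow> V \<subseteq> V <+>\<^bsub>R\<^esub> W"
  by (force simp: mem_set_add ksub_carrier intro: ksub_zero)

lemma subset_set_add2: "ksub V \<Longrightarrow> ksub W \<Longrightarrow> W \<subseteq> V <+>\<^bsub>R\<^esub> W"
  by (force simp: mem_set_add ksub_carrier intro: ksub_zero)

lemma set_add_least: "ksub U \<Longrightarrow> V \<subseteq> U \<Longrightarrow> W \<subseteq> U \<Longrightarrow> V <+>\<^bsub>R\<^esub> W \<subseteq> U"
  unfolding subset_iff mem_set_add by (blast intro: ksub_add)

lemma set_add_mono: "V \<subseteq> V' \<Longrightarrow> W \<subseteq> W' \<Longrightarrow> V <+>\<^bsub>R\<^esub> W \<subseteq> V' <+>\<^bsub>R\<^esub> W'"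
  unfolding subset_iff mem_set_add by blast

text \<open>The length of \<open>V\<close> modulo \<open>U\<close>, read off from the intermediate
  subspaces instead of from submodules of a quotient.\<close>

definition len :: "'a set \<Rightarrow> 'a set \<Rightarrow> enat" where
  "len U V = chain_length {W. ksub W \<and> U \<subseteq> W \<and> W \<subseteq> V}"

lemma len_mono: "U \<subseteq> U' \<Longrightarrow> V' \<subseteq> V \<Longrightarrow> len U' V' \<le> len U V"
  unfolding len_def by (rule chain_length_mono) auto

lemma le_len_iff:
  assumes "ksub U" "U \<subseteq> V"
  shows "enat n \<le> len U V \<longleftrightarrow>
    (\<exists>N. (\<forall>i\<le>n. ksub (N i) \<and> U \<subseteq> N i \<and> N i \<subseteq> V) \<and> (\<forall>i<n. N i \<subset> N (Suc i)))"
proof -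
  have "{W. ksub W \<and> U \<subseteq> W \<and> W \<subseteq> V} \<noteq> {}" using assms by blast
  from le_chain_length_iff[OF this] show ?thesis unfolding len_def by simp
qed

section \<open>Additivity of length\<close>

lemma le_len_extend:
  assumes "ksub U" "ksub V'" "U \<subseteq> V" "V \<subset> V'" "enat n \<le> len U V"
  shows "enat (Suc n) \<le> len U V'"
proof -
  obtain N where N: "\<forall>i\<le>n. ksub (N i) \<and> U \<subseteq> N i \<and> N i \<subseteq> V" "\<forall>i<n. N i \<subset> N (Suc i)"
    using assms(5) le_len_iff[OF assms(1,3), of n] by blast
  define N' where "N' = (\<lambda>i. if i \<le> n then N i else V')"
  have "\<forall>i\<le>Suc n. ksub (N' i) \<and> U \<subseteq> N' i \<and> N' i \<subseteq> V'"
    using N(1) assms(2,3,4) unfolding N'_def by (auto; meson subset_iff)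
  moreover have "\<forall>i<Suc n. N' i \<subset> N' (Suc i)"
  proof (intro allI impI)
    fix i assume "i < Suc n"
    show "N' i \<subset> N' (Suc i)"
    proof (cases "i = n")
      case True
      then have "N' i \<subseteq> V" using N(1) by (simp add: N'_def)
      then show ?thesis using assms(4) True by (auto simp: N'_def)
    next
      case False
      then show ?thesis using N(2) \<open>i < Suc n\<close> by (simp add: N'_def)
    qed
  qed
  ultimately show ?thesis using assms le_len_iff[of U V' "Suc n"] by blast
qed

lemma le_len_concat:
  assumes "ksub U" "ksub W" "U \<subseteq> W" "W \<subseteq> V" "enat a \<le> len U W" "enat b \<le> len W V"
  shows "enat (a + b) \<le> len U V"
proof -
  obtain N where N: "\<forall>i\<le>a. ksub (N i) \<and> U \<subseteq> N i \<and> N i \<subseteq> W" "\<forall>i<a. N i \<subset> N (Suc i)"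
    using assms le_len_iff[of U W a] by blast
  obtain M where M: "\<forall>i\<le>b. ksub (M i) \<and> W \<subseteq> M i \<and> M i \<subseteq> V" "\<forall>i<b. M i \<subset> M (Suc i)"
    using assms le_len_iff[of W V b] by blast
  define L where "L = (\<lambda>i. if i < a then N i else M (i - a))"
  have 1: "ksub (L i) \<and> U \<subseteq> L i \<and> L i \<subseteq> V" if "i \<le> a + b" for i
  proof (cases "i < a")
    case True
    then show ?thesis using N(1)[rule_format, of i] assms(4) by (auto simp: L_def)
  next
    case False
    then have "i - a \<le> b" using that by simp
    then show ?thesis using M(1)[rule_format, of "i - a"] assms(3) False by (auto simp: L_def)
  qed
  have 2: "L i \<subset> L (Suc i)" if "i < a + b" for i
  proof -
    consider "Suc i < a" | "Suc i = a" | "a \<le> i" by linarith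
    then show ?thesis
    proof cases
      case 1
      then show ?thesis using N(2) by (simp add: L_def)
    next
      case 2
      then have "N i \<subset> N a" using N(2) by auto
      moreover have "N a \<subseteq> W" "W \<subseteq> M 0" using N(1) M(1) by auto
      ultimately show ?thesis using 2 by (auto simp: L_def)
    next
      case 3
      then show ?thesis using M(2)[rule_format, of "i - a"] that by (simp add: L_def Suc_diff_le)
    qed
  qed
  show ?thesis
    using le_len_iff[of U V "a + b"] assms 1 2 by blast
qed

text \<open>Modular law: a vector of \<open>B\<close> that lies in the sum of \<open>A\<close> and
  \<open>W\<close> differs from one of \<open>A\<close> by an element of \<open>B\<close> and
  \<open>W\<close>, hence of \<open>A\<close>. So a step invisible after intersecting with
  \<open>W\<close> stays visible after adding \<open>W\<close>.\<close>

lemma modular_strict: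
  assumes "ksub A" "ksub B" "ksub W" "A \<subset> B" "A \<inter> W = B \<inter> W"
  shows "A <+>\<^bsub>R\<^esub> W \<subset> B <+>\<^bsub>R\<^esub> W"
proof -
  obtain y where y: "y \<in> B" "y \<notin> A" using assms(4) by blast
  have "y \<notin> A <+>\<^bsub>R\<^esub> W"
  proof
    assume "y \<in> A <+>\<^bsub>R\<^esub> W"
    then obtain a w where aw: "a \<in> A" "w \<in> W" "y = a \<oplus> w" by (auto simp: mem_set_add)
    then have "w \<in> B" using ksub_add_cancel[OF assms(2), of a w] y(1) assms(4) ksub_carrier[OF assms(3)] by auto
    then have "w \<in> A" using aw(2) assms(5) by blast
    then show False using aw y(2) ksub_add[OF assms(1)] by blast
  qed
  moreover have "y \<in> B <+>\<^bsub>R\<^esub> W" using subset_set_add1[OF assms(2,3)] y(1) by blast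
  moreover have "A <+>\<^bsub>R\<^esub> W \<subseteq> B <+>\<^bsub>R\<^esub> W" by (rule set_add_mono) (use assms(4) in auto)
  ultimately show ?thesis by blast
qed

text \<open>By \<open>modular_strict\<close> every step of the chain remains strict in at least one
  of the two derived chains, so their lengths add up to at least \<open>n\<close>. This is the
  harder half of additivity.\<close>

lemma le_len_split:
  assumes "ksub U" "ksub W" "ksub V" "U \<subseteq> W" "W \<subseteq> V"
    and "\<forall>i\<le>n. ksub (N i) \<and> U \<subseteq> N i \<and> N i \<subseteq> V" and "\<forall>i<n. N i \<subset> N (Suc i)"
  shows "\<exists>a b. n \<le> a + b \<and> enat a \<le> len U (N n \<inter> W) \<and> enat b \<le> len W (N n <+>\<^bsub>R\<^esub> W)"
  using assms(6,7)
proof (induction n)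
  case 0
  show ?case by (rule exI[of _ 0], rule exI[of _ 0]) (simp flip: zero_enat_def)
next
  case (Suc n)
  then obtain a b where ab: "n \<le> a + b" "enat a \<le> len U (N n \<inter> W)" "enat b \<le> len W (N n <+>\<^bsub>R\<^esub> W)"
    by auto
  have k: "ksub (N n)" "ksub (N (Suc n))" "U \<subseteq> N n" "N n \<subset> N (Suc n)" using Suc.prems by auto
  show ?case
  proof (cases "N n \<inter> W = N (Suc n) \<inter> W")
    case True
    have "N n <+>\<^bsub>R\<^esub> W \<subset> N (Suc n) <+>\<^bsub>R\<^esub> W" by (rule modular_strict[OF k(1,2) assms(2) k(4) True])
    then have "enat (Suc b) \<le> len W (N (Suc n) <+>\<^bsub>R\<^esub> W)"
      by (rule le_len_extend[OF assms(2) ksub_set_add[OF k(2) assms(2)] subset_set_add2[OF k(1) assms(2)]])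
        (rule ab(3))
    then show ?thesis using ab(1,2) True by (intro exI[of _ a] exI[of _ "Suc b"]) auto
  next
    case False
    then have "N n \<inter> W \<subset> N (Suc n) \<inter> W" using k(4) by blast
    from le_len_extend[OF assms(1) ksub_Int[OF k(2) assms(2)] _ this ab(2)]
    have "enat (Suc a) \<le> len U (N (Suc n) \<inter> W)" using k(3) assms(4) by blast
    moreover have "enat b \<le> len W (N (Suc n) <+>\<^bsub>R\<^esub> W)"
      using ab(3) by (rule order_trans) (rule len_mono[OF subset_refl set_add_mono], use k(4) in auto)
    ultimately show ?thesis using ab(1) by (intro exI[of _ "Suc a"] exI[of _ b]) auto
  qed
qed

lemma enat_le_add_iff: "enat n \<le> x + y \<longleftrightarrow> (\<exists>a b. n \<le> a + b \<and> enat a \<le> x \<and> enat b \<le> y)"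
proof
  assume n: "enat n \<le> x + y"
  show "\<exists>a b. n \<le> a + b \<and> enat a \<le> x \<and> enat b \<le> y"
  proof (cases x)
    case (enat i)
    note x = this
    show ?thesis
    proof (cases y)
      case (enat j)
      then show ?thesis using n x by auto
    next
      case infinity
      then show ?thesis by (intro exI[of _ 0] exI[of _ n]) (simp flip: zero_enat_def)
    qed
  next
    case infinity
    then show ?thesis by (intro exI[of _ n] exI[of _ 0]) (simp flip: zero_enat_def)
  qed
next
  assume "\<exists>a b. n \<le> a + b \<and> enat a \<le> x \<and> enat b \<le> y"
  then obtain a b where ab: "n \<le> a + b" "enat a \<le> x" "enat b \<le> y" by blast
  have "enat n \<le> enat a + enat b" using ab(1) by simp
  also have "\<dots> \<le> x + y" using ab(2,3) by (rule add_mono)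
  finally show "enat n \<le> x + y" .
qed

lemma len_additive:
  assumes "ksub U" "ksub W" "ksub V" "U \<subseteq> W" "W \<subseteq> V"
  shows "len U V = len U W + len W V"
proof (rule enat_eqI_le)
  fix n
  show "enat n \<le> len U V \<longleftrightarrow> enat n \<le> len U W + len W V"
  proof
    assume "enat n \<le> len U V"
    then obtain N where N: "\<forall>i\<le>n. ksub (N i) \<and> U \<subseteq> N i \<and> N i \<subseteq> V" "\<forall>i<n. N i \<subset> N (Suc i)"
      using le_len_iff[OF assms(1), of V n] assms(4,5) by (meson order_trans)
    obtain a b where ab: "n \<le> a + b" "enat a \<le> len U (N n \<inter> W)" "enat b \<le> len W (N n <+>\<^bsub>R\<^esub> W)"
      using le_len_split[OF assms N] by blast
    have "enat a \<le> len U W" using ab(2) by (rule order_trans) (rule len_mono, auto)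
    moreover have "enat b \<le> len W V" using ab(3)
      by (rule order_trans) (rule len_mono[OF subset_refl set_add_least], use assms N in auto)
    ultimately show "enat n \<le> len U W + len W V" using ab(1) enat_le_add_iff by blast
  next
    assume "enat n \<le> len U W + len W V"
    then obtain a b where ab: "n \<le> a + b" "enat a \<le> len U W" "enat b \<le> len W V"
      using enat_le_add_iff by blast
    have "enat (a + b) \<le> len U V" using le_len_concat assms ab by blast
    moreover have "enat n \<le> enat (a + b)" using ab(1) by simp
    ultimately show "enat n \<le> len U V" by (rule order_trans[rotated])
  qed
qed

text \<open>The last clause lets preimages of subspaces correspond to subspaces of the image, although
  \<open>f\<close> may twist the scalars, as the \<open>q\<close>-th power map does.\<close>

definition semilinear :: "'a set \<Rightarrow> ('a \<Rightarrow> 'a) \<Rightarrow> bool" where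
  "semilinear A f \<longleftrightarrow> (\<forall>x\<in>A. f x \<in> carrier R) \<and> (\<forall>x\<in>A. \<forall>y\<in>A. f (x \<oplus> y) = f x \<oplus> f y) \<and>
     (\<forall>c\<in>G 0. \<exists>c'\<in>G 0. \<forall>x\<in>A. f (c \<otimes> x) = c' \<otimes> f x) \<and>
     (\<forall>c\<in>G 0. \<exists>c'\<in>G 0. \<forall>x\<in>A. f (c' \<otimes> x) = c \<otimes> f x)"

lemma semilinear_diff:
  assumes "semilinear A f" "ksub A" "x \<in> A" "y \<in> A"
  shows "f (x \<ominus> y) = f x \<ominus> f y"
proof -
  have d: "x \<ominus> y \<in> A" by (rule ksub_diff[OF assms(2-4)])
  have c: "x \<in> carrier R" "y \<in> carrier R" using assms ksub_carrier by auto
  have "x = (x \<ominus> y) \<oplus> y" using c by algebra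
  then have "f x = f (x \<ominus> y) \<oplus> f y" using d assms by (metis semilinear_def)
  moreover have "f (x \<ominus> y) \<in> carrier R" "f y \<in> carrier R"
    using assms(1,4) d by (auto simp: semilinear_def)
  ultimately show ?thesis by algebra
qed

lemma semilinear_zero:
  assumes "semilinear A f" "ksub A" shows "f \<zero> = \<zero>"
proof -
  have z: "\<zero> \<in> A" by (rule ksub_zero[OF assms(2)])
  then have "f \<zero> \<in> carrier R" using assms(1) by (auto simp: semilinear_def)
  have "f (\<zero> \<ominus> \<zero>) = f \<zero> \<ominus> f \<zero>" by (rule semilinear_diff[OF assms z z])
  then show ?thesis using \<open>f \<zero> \<in> carrier R\<close> by (simp add: minus_eq r_neg)
qed

lemma ksub_image:
  assumes f: "semilinear A f" and A: "ksub A" and W: "ksub W" "W \<subseteq> A"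
  shows "ksub (f ` W)"
proof (rule ksubI)
  show "x \<in> carrier R" if "x \<in> f ` W" for x using that f W by (auto simp: semilinear_def)
  have "f \<zero> \<in> f ` W" using ksub_zero[OF W(1)] by blast
  then show "\<zero> \<in> f ` W" by (simp only: semilinear_zero[OF f A])
next
  fix x y assume "x \<in> f ` W" "y \<in> f ` W"
  then obtain a b where *: "a \<in> W" "b \<in> W" "x = f a" "y = f b" by blast
  then have "x \<oplus> y = f (a \<oplus> b)" using f W(2) unfolding semilinear_def by (metis subset_iff)
  then show "x \<oplus> y \<in> f ` W" using ksub_add[OF W(1) *(1,2)] by blast
next
  fix c x assume c: "c \<in> G 0" and "x \<in> f ` W"
  then obtain a where a: "a \<in> W" "x = f a" by blast
  obtain c' where c': "c' \<in> G 0" "\<forall>x\<in>A. f (c' \<otimes> x) = c \<otimes> f x" using f c unfolding semilinear_def by meson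
  then have "c \<otimes> x = f (c' \<otimes> a)" using a W(2) by auto
  then show "c \<otimes> x \<in> f ` W" using ksub_smult[OF W(1) c'(1) a(1)] by blast
qed

lemma ksub_preimage:
  assumes f: "semilinear A f" and A: "ksub A" and W: "ksub W"
  shows "ksub {x \<in> A. f x \<in> W}"
proof (rule ksubI)
  show "x \<in> carrier R" if "x \<in> {x \<in> A. f x \<in> W}" for x using that ksub_carrier[OF A] by blast
  show "\<zero> \<in> {x \<in> A. f x \<in> W}"
    using semilinear_zero[OF f A] ksub_zero[OF A] ksub_zero[OF W] by simp
next
  fix x y assume "x \<in> {x \<in> A. f x \<in> W}" "y \<in> {x \<in> A. f x \<in> W}"
  then have *: "x \<in> A" "y \<in> A" "f x \<in> W" "f y \<in> W" by auto
  then have "f (x \<oplus> y) = f x \<oplus> f y" using f unfolding semilinear_def by metis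
  then show "x \<oplus> y \<in> {x \<in> A. f x \<in> W}" using * ksub_add[OF A] ksub_add[OF W] by simp
next
  fix c x assume c: "c \<in> G 0" and "x \<in> {x \<in> A. f x \<in> W}"
  then have *: "x \<in> A" "f x \<in> W" by auto
  obtain c' where "c' \<in> G 0" "\<forall>x\<in>A. f (c \<otimes> x) = c' \<otimes> f x" using f c unfolding semilinear_def by meson
  then show "c \<otimes> x \<in> {x \<in> A. f x \<in> W}" using * c ksub_smult[OF A] ksub_smult[OF W] by simp
qed

text \<open>Correspondence theorem for the map that \<open>f\<close> induces from \<open>A\<close>
  to the quotient by \<open>B\<close>: taking preimages and taking images enlarged by
  \<open>B\<close> are mutually inverse, and both preserve subspaces although \<open>f\<close>
  twists the scalars.\<close>

lemma len_semilinear: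
  assumes f: "semilinear A f" and A: "ksub A" and B: "ksub B"
  shows "len {x \<in> A. f x \<in> B} A = len B (B <+>\<^bsub>R\<^esub> f ` A)"
  unfolding len_def
proof (rule chain_length_bij[where f = "\<lambda>W. B <+>\<^bsub>R\<^esub> f ` W" and g = "\<lambda>W. {x \<in> A. f x \<in> W}"])
  fix W assume W: "W \<in> {W. ksub W \<and> {x \<in> A. f x \<in> B} \<subseteq> W \<and> W \<subseteq> A}"
  then have kW: "ksub W" "{x \<in> A. f x \<in> B} \<subseteq> W" "W \<subseteq> A" by auto
  note im = ksub_image[OF f A kW(1,3)]
  show "B <+>\<^bsub>R\<^esub> f ` W \<in> {W. ksub W \<and> B \<subseteq> W \<and> W \<subseteq> B <+>\<^bsub>R\<^esub> f ` A}"
    using ksub_set_add[OF B im] subset_set_add1[OF B im] set_add_mono[of B B "f ` W" "f ` A"] kW(3) by blast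
  show "{x \<in> A. f x \<in> B <+>\<^bsub>R\<^esub> f ` W} = W"
  proof
    show "W \<subseteq> {x \<in> A. f x \<in> B <+>\<^bsub>R\<^esub> f ` W}" using subset_set_add2[OF B im] kW(3) by blast
    show "{x \<in> A. f x \<in> B <+>\<^bsub>R\<^esub> f ` W} \<subseteq> W"
    proof
      fix x assume "x \<in> {x \<in> A. f x \<in> B <+>\<^bsub>R\<^esub> f ` W}"
      then obtain b w where x: "x \<in> A" "b \<in> B" "w \<in> W" "f x = b \<oplus> f w" by (auto simp: mem_set_add)
      have wA: "w \<in> A" using x(3) kW(3) by blast
      have fc: "f w \<in> carrier R" using f wA by (auto simp: semilinear_def)
      have "f (x \<ominus> w) = f x \<ominus> f w" by (rule semilinear_diff[OF f A x(1) wA])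
      also have "\<dots> = b" using x(4) fc ksub_carrier[OF B x(2)] by algebra
      finally have "x \<ominus> w \<in> W" using x(2) ksub_diff[OF A x(1) wA] kW(2) by auto
      moreover have "x = (x \<ominus> w) \<oplus> w" using ksub_carrier[OF A x(1)] ksub_carrier[OF A wA] by algebra
      ultimately show "x \<in> W" using ksub_add[OF kW(1)] x(3) by metis
    qed
  qed
next
  fix W assume W: "W \<in> {W. ksub W \<and> B \<subseteq> W \<and> W \<subseteq> B <+>\<^bsub>R\<^esub> f ` A}"
  then have kW: "ksub W" "B \<subseteq> W" "W \<subseteq> B <+>\<^bsub>R\<^esub> f ` A" by auto
  show "{x \<in> A. f x \<in> W} \<in> {W. ksub W \<and> {x \<in> A. f x \<in> B} \<subseteq> W \<and> W \<subseteq> A}"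
    using ksub_preimage[OF f A kW(1)] kW(2) by auto
  show "B <+>\<^bsub>R\<^esub> f ` {x \<in> A. f x \<in> W} = W"
  proof
    show "B <+>\<^bsub>R\<^esub> f ` {x \<in> A. f x \<in> W} \<subseteq> W" by (rule set_add_least[OF kW(1,2)]) auto
    show "W \<subseteq> B <+>\<^bsub>R\<^esub> f ` {x \<in> A. f x \<in> W}"
    proof
      fix y assume y: "y \<in> W"
      then have "y \<in> B <+>\<^bsub>R\<^esub> f ` A" using kW(3) by blast
      then obtain b x where x: "x \<in> A" "b \<in> B" "y = b \<oplus> f x" by (auto simp: mem_set_add)
      have "f x \<in> W" using ksub_add_cancel[OF kW(1), of b "f x"] y x kW(2) f
        by (auto simp: semilinear_def)
      then show "y \<in> B <+>\<^bsub>R\<^esub> f ` {x \<in> A. f x \<in> W}" using x by (auto simp: mem_set_add)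
    qed
  qed
next
  fix W W' :: "'a set" assume "W \<subseteq> W'"
  then show "B <+>\<^bsub>R\<^esub> f ` W \<subseteq> B <+>\<^bsub>R\<^esub> f ` W'" "{x \<in> A. f x \<in> W} \<subseteq> {x \<in> A. f x \<in> W'}"
    using set_add_mono[of B B "f ` W" "f ` W'"] by auto
qed

lemma len_refl: "len U U = 0"
proof -
  have "N 0 = U \<and> N (Suc 0) = U" if "\<forall>i\<le>n. N i \<in> {W. ksub W \<and> U \<subseteq> W \<and> W \<subseteq> U}" "n > 0" for n and N :: "nat \<Rightarrow> 'a set"
    using that(1)[rule_format, of 0] that(1)[rule_format, of "Suc 0"] that(2) by auto
  then have "n = 0" if "\<forall>i\<le>n. N i \<in> {W. ksub W \<and> U \<subseteq> W \<and> W \<subseteq> U}" "\<forall>i<n. N i \<subset> N (Suc i)" for n and N :: "nat \<Rightarrow> 'a set"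
    using that by (metis not_gr_zero psubset_eq)
  then have *: "{n. \<exists>N. (\<forall>i\<le>n. N i \<in> {W. ksub W \<and> U \<subseteq> W \<and> W \<subseteq> U}) \<and> (\<forall>i<n. N i \<subset> N (Suc i))} \<subseteq> {0}"
    by blast
  have "len U U \<le> (SUP n\<in>{0::nat}. enat n)"
    unfolding len_def chain_length_def by (rule SUP_subset_mono[OF *]) simp
  then show ?thesis by (simp add: enat_0)
qed

lemma len_strict: assumes "ksub U" "ksub V" "U \<subset> V" shows "1 \<le> len U V"
  using le_len_extend[of U V U 0] assms by (simp add: zero_enat_def[symmetric] one_enat_def)

definition finite_len :: "'a set \<Rightarrow> bool" where
  "finite_len V \<longleftrightarrow> ksub V \<and> len {\<zero>} V < \<infinity>"

text \<open>The value is unspecified if the length is infinite.\<close>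

definition rlen :: "'a set \<Rightarrow> 'a set \<Rightarrow> real" where
  "rlen U V = real (the_enat (len U V))"

lemma finite_len_le: "finite_len V \<Longrightarrow> ksub U \<Longrightarrow> U' \<subseteq> V \<Longrightarrow> len U U' < \<infinity>"
  unfolding finite_len_def
  by (rule le_less_trans[OF len_mono[of "{\<zero>}" U U' V]]) (use ksub_zero[of U] in auto)

lemma finite_len_subset: "finite_len V \<Longrightarrow> ksub U \<Longrightarrow> U \<subseteq> V \<Longrightarrow> finite_len U"
  using finite_len_le[of V "{\<zero>}" U] by (simp add: finite_len_def ksub_zero_set)

lemma rlen_additive:
  assumes "finite_len V" "ksub U" "ksub W" "U \<subseteq> W" "W \<subseteq> V"
  shows "rlen U V = rlen U W + rlen W V"
proof -
  have "len U V = len U W + len W V"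
    by (rule len_additive) (use assms in \<open>auto simp: finite_len_def\<close>)
  moreover have "len U W < \<infinity>" "len W V < \<infinity>"
    using finite_len_le[OF assms(1,2,5)] finite_len_le[OF assms(1,3) subset_refl] .
  then obtain a b where "len U W = enat a" "len W V = enat b" by auto
  ultimately show ?thesis unfolding rlen_def by simp
qed

lemma rlen_nonneg [simp]: "rlen U V \<ge> 0" by (simp add: rlen_def)

lemma rlen_refl [simp]: "rlen U U = 0" by (simp add: rlen_def len_refl zero_enat_def)

lemma rlen_mono:
  assumes "finite_len V" "ksub U" "U \<subseteq> U'" "V' \<subseteq> V" shows "rlen U' V' \<le> rlen U V"
proof -
  have "len U V < \<infinity>" by (rule finite_len_le[OF assms(1,2)]) auto
  then obtain b where b: "len U V = enat b" by auto
  then have "len U' V' \<le> enat b" using len_mono[OF assms(3,4)] by simp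
  then obtain a where "len U' V' = enat a" "a \<le> b" by (cases "len U' V'") auto
  then show ?thesis unfolding rlen_def using b by simp
qed

lemma rlen_semilinear:
  "semilinear A f \<Longrightarrow> ksub A \<Longrightarrow> ksub B \<Longrightarrow> rlen {x \<in> A. f x \<in> B} A = rlen B (B <+>\<^bsub>R\<^esub> f ` A)"
  by (simp add: rlen_def len_semilinear)

lemma rlen_ge_1:
  assumes "finite_len V" "ksub U" "U \<subset> V" shows "rlen U V \<ge> 1"
proof -
  have "1 \<le> len U V" by (rule len_strict) (use assms in \<open>auto simp: finite_len_def\<close>)
  moreover have "len U V < \<infinity>" by (rule finite_len_le[OF assms(1,2)]) auto
  then obtain b where "len U V = enat b" by auto
  ultimately show ?thesis unfolding rlen_def by (simp add: one_enat_def)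
qed

lemma rlen_second_iso: assumes "ksub A" "ksub B" shows "rlen (A \<inter> B) A = rlen B (B <+>\<^bsub>R\<^esub> A)"
proof -
  have "semilinear A (\<lambda>x. x)" using assms(1) by (auto simp: semilinear_def ksub_carrier)
  from rlen_semilinear[OF this assms] show ?thesis by (simp add: Int_def)
qed

lemma len_G0: "len {\<zero>} (G 0) \<le> 1"
proof -
  have *: "W = {\<zero>} \<or> W = G 0" if "ksub W" "W \<subseteq> G 0" for W
  proof (rule disjCI)
    assume "W \<noteq> G 0"
    show "W = {\<zero>}"
    proof (rule ccontr)
      assume "W \<noteq> {\<zero>}"
      then obtain c where c: "c \<in> W" "c \<noteq> \<zero>" using ksub_zero[OF \<open>ksub W\<close>] by blast
      have "c \<in> G 0" using c(1) \<open>W \<subseteq> G 0\<close> by (rule rev_subsetD)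
      then obtain d where d: "d \<in> G 0" "c \<otimes> d = \<one>" using G0_inverse c(2) by blast
      have "G 0 \<subseteq> W"
      proof
        fix x assume x: "x \<in> G 0"
        have "x = (x \<otimes> d) \<otimes> c"
          using d x \<open>c \<in> G 0\<close> by (metis G_carrier m_assoc m_comm r_one)
        then show "x \<in> W" using ksub_smult[OF \<open>ksub W\<close> G0_mult[OF x d(1)] c(1)] by simp
      qed
      then show False using \<open>W \<noteq> G 0\<close> \<open>W \<subseteq> G 0\<close> by blast
    qed
  qed
  show ?thesis
  proof (rule ccontr)
    assume "\<not> len {\<zero>} (G 0) \<le> 1"
    then have "enat 2 \<le> len {\<zero>} (G 0)"
      using Suc_ile_eq[of 1 "len {\<zero>} (G 0)"] by (simp add: one_enat_def numeral_2_eq_2 not_le)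
    then obtain N where N: "\<forall>i\<le>2. ksub (N i) \<and> {\<zero>} \<subseteq> N i \<and> N i \<subseteq> G 0" "\<forall>i<2. N i \<subset> N (Suc i)"
      using le_len_iff[OF ksub_zero_set, of "G 0" 2] by auto
    have "N 0 \<subset> N 1" "N 1 \<subset> N 2" using N(2)[rule_format, of 0] N(2)[rule_format, of 1] by (simp_all add: numeral_2_eq_2)
    moreover have "N 0 = {\<zero>} \<or> N 0 = G 0" "N 1 = {\<zero>} \<or> N 1 = G 0" "N 2 = {\<zero>} \<or> N 2 = G 0"
      using * N(1) by auto
    ultimately show False by blast
  qed
qed

end

section \<open>Homogeneous components and homogeneous ideals\<close>

context graded_algebra
begin

definition is_decomp :: "'a \<Rightarrow> (nat \<Rightarrow> 'a) \<Rightarrow> bool" where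
  "is_decomp x a \<longleftrightarrow> (\<forall>n. a n \<in> G n) \<and> finite {n. a n \<noteq> \<zero>} \<and> x = finsum R a {n. a n \<noteq> \<zero>}"

definition component :: "'a \<Rightarrow> nat \<Rightarrow> 'a" where
  "component x = (THE a. is_decomp x a)"

lemma is_decomp_component: assumes "x \<in> carrier R" shows "is_decomp x (component x)"
  and is_decomp_unique: "\<And>a. is_decomp x a \<Longrightarrow> component x = a"
proof -
  have ex: "\<exists>!a. is_decomp x a"
    using graded assms unfolding graded_ring_def is_decomp_def by blast
  from theI'[OF ex] show "is_decomp x (component x)" by (simp add: component_def)
  show "component x = a" if "is_decomp x a" for a
    using ex theI'[OF ex] that unfolding component_def by blast
qed

lemma component_eqI:
  assumes "finite F" "\<And>n. a n \<in> G n" "\<And>n. n \<notin> F \<Longrightarrow> a n = \<zero>" "x = finsum R a F"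
  shows "component x = a"
proof (rule is_decomp_unique)
  show "x \<in> carrier R" using assms(2,4) G_carrier by (auto intro!: finsum_closed)
  have sub: "{n. a n \<noteq> \<zero>} \<subseteq> F" using assms(3) by blast
  have "finsum R a {n. a n \<noteq> \<zero>} = finsum R a F"
    by (rule add.finprod_mono_neutral_cong_left[OF assms(1) sub]) (use assms(2) G_carrier in auto)
  then show "is_decomp x a"
    unfolding is_decomp_def using assms finite_subset[OF sub assms(1)] by simp
qed

lemma component_mem: "x \<in> carrier R \<Longrightarrow> component x n \<in> G n"
  using is_decomp_component by (auto simp: is_decomp_def)

lemma component_carrier: "x \<in> carrier R \<Longrightarrow> component x n \<in> carrier R"
  using component_mem G_carrier by blast

lemma finite_component: "x \<in> carrier R \<Longrightarrow> finite {n. component x n \<noteq> \<zero>}"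
  using is_decomp_component by (auto simp: is_decomp_def)

lemma finsum_component: "x \<in> carrier R \<Longrightarrow> finsum R (component x) {n. component x n \<noteq> \<zero>} = x"
  using is_decomp_component by (auto simp: is_decomp_def)

lemma component_homogeneous: assumes "x \<in> G n" shows "component x = (\<lambda>m. if m = n then x else \<zero>)"
proof (rule component_eqI[of "{n}"])
  show "x = finsum R (\<lambda>m. if m = n then x else \<zero>) {n}"
    using G_carrier[OF assms] by simp
qed (use assms in auto)

lemma component_add: assumes "x \<in> carrier R" "y \<in> carrier R"
  shows "component (x \<oplus> y) = (\<lambda>n. component x n \<oplus> component y n)"
proof -
  let ?F = "{n. component x n \<noteq> \<zero>} \<union> {n. component y n \<noteq> \<zero>}"
  have fin: "finite ?F" using finite_component assms by simp
  have c: "component x \<in> ?F \<rightarrow> carrier R" "component y \<in> ?F \<rightarrow> carrier R"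
    using component_carrier assms by auto
  have "finsum R (component x) {n. component x n \<noteq> \<zero>} = finsum R (component x) ?F"
    by (rule add.finprod_mono_neutral_cong_left[OF fin _ _ _ c(1)]) auto
  then have x: "finsum R (component x) ?F = x" using finsum_component[OF assms(1)] by simp
  have "finsum R (component y) {n. component y n \<noteq> \<zero>} = finsum R (component y) ?F"
    by (rule add.finprod_mono_neutral_cong_left[OF fin _ _ _ c(2)]) auto
  then have y: "finsum R (component y) ?F = y" using finsum_component[OF assms(2)] by simp
  show ?thesis
  proof (rule component_eqI[OF fin])
    show "x \<oplus> y = (\<Oplus>n\<in>?F. component x n \<oplus> component y n)"
      using finsum_addf[OF c] x y by simp
    show "component x n \<oplus> component y n \<in> G n" for n by (intro G_add component_mem assms)
  qed auto
qed

lemma carrier_induct [consumes 1, case_names zero hom add]: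
  assumes x: "x \<in> carrier R" and z: "P \<zero>" and h: "\<And>n a. a \<in> G n \<Longrightarrow> P a"
    and a: "\<And>x y. x \<in> carrier R \<Longrightarrow> y \<in> carrier R \<Longrightarrow> P x \<Longrightarrow> P y \<Longrightarrow> P (x \<oplus> y)"
  shows "P x"
proof -
  have "finite F \<Longrightarrow> P (finsum R (component x) F)" for F
  proof (induction F rule: finite_induct)
    case empty
    then show ?case using z by simp
  next
    case (insert n F)
    have c: "component x \<in> F \<rightarrow> carrier R" using component_carrier[OF x] by auto
    have "P (component x n \<oplus> finsum R (component x) F)"
      by (rule a[OF component_carrier[OF x] finsum_closed[OF c] h[OF component_mem[OF x]] insert.IH])
    then show ?case using insert.hyps c component_carrier[OF x] by simp
  qed
  from this[OF finite_component[OF x]] show ?thesis using finsum_component[OF x] by simp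
qed

lemma component_zero: "component \<zero> n = \<zero>"
  using component_homogeneous[of \<zero> n] by simp

lemma ksub_finsum:
  assumes V: "ksub V" and "finite F" "\<And>i. i \<in> F \<Longrightarrow> f i \<in> V"
  shows "finsum R f F \<in> V"
  using assms(2,3)
proof (induction F rule: finite_induct)
  case (insert i F)
  then have "f i \<oplus> finsum R f F \<in> V" by (intro ksub_add[OF V]) auto
  moreover have "f \<in> F \<rightarrow> carrier R" "f i \<in> carrier R" using insert.prems ksub_carrier[OF V] by auto
  ultimately show ?case using insert.hyps by simp
qed (simp add: ksub_zero[OF V])

text \<open>Both sides are additive in each factor, so homogeneous factors suffice. The inner
  induction runs over \<open>y\<close> for a fixed homogeneous first factor.\<close>

lemma component_mult:
  assumes "x \<in> carrier R" "y \<in> carrier R"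
  shows "component (x \<otimes> y) n = (\<Oplus>k\<in>{..n}. component x k \<otimes> component y (n - k))"
  using assms(1)
proof (induction x arbitrary: n rule: carrier_induct)
  case zero
  show ?case using assms(2) by (simp add: component_zero component_carrier)
next
  case (hom i a)
  note a = G_carrier[OF hom]
  have "component (a \<otimes> y) n = (if i \<le> n then a \<otimes> component y (n - i) else \<zero>)"
    using assms(2)
  proof (induction y arbitrary: n rule: carrier_induct)
    case zero
    show ?case using a by (simp add: component_zero)
  next
    case (hom j b)
    then show ?case using component_homogeneous[OF hom] component_homogeneous[OF G_mult[OF \<open>a \<in> G i\<close> hom]] a by auto
  next
    case (add x y)
    then show ?case using a by (simp add: r_distr component_add component_carrier)
  qed
  also have "\<dots> = (\<Oplus>k\<in>{..n}. if i = k then a \<otimes> component y (n - k) else \<zero>)"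
  proof (cases "i \<le> n")
    case True
    have "(\<Oplus>k\<in>{..n}. if i = k then a \<otimes> component y (n - k) else \<zero>) = a \<otimes> component y (n - i)"
      by (rule add.finprod_singleton) (use True a component_carrier[OF assms(2)] in auto)
    then show ?thesis using True by simp
  next
    case False
    have "(\<Oplus>k\<in>{..n}. if i = k then a \<otimes> component y (n - k) else \<zero>) = (\<Oplus>k\<in>{..n}. \<zero>)"
      by (rule finsum_cong') (use False in auto)
    then show ?thesis using False by simp
  qed
  also have "\<dots> = (\<Oplus>k\<in>{..n}. component a k \<otimes> component y (n - k))"
    by (rule finsum_cong') (use component_homogeneous[OF hom] a component_carrier[OF assms(2)] in auto)
  finally show ?case .
next
  case (add x x')
  have "component ((x \<oplus> x') \<otimes> y) n = component (x \<otimes> y) n \<oplus> component (x' \<otimes> y) n"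
    using add assms(2) by (simp add: l_distr component_add)
  also have "\<dots> = (\<Oplus>k\<in>{..n}. component x k \<otimes> component y (n - k) \<oplus> component x' k \<otimes> component y (n - k))"
    unfolding add(3,4) by (rule finsum_addf[symmetric]) (use add assms(2) component_carrier in auto)
  also have "\<dots> = (\<Oplus>k\<in>{..n}. component (x \<oplus> x') k \<otimes> component y (n - k))"
    by (rule finsum_cong') (use add assms(2) in \<open>auto simp: component_add l_distr component_carrier\<close>)
  finally show ?case .
qed

text \<open>Homogeneous ideals are represented by their families of components.\<close>

definition homog :: "(nat \<Rightarrow> 'a set) \<Rightarrow> bool" where
  "homog A \<longleftrightarrow> (\<forall>m. ksub (A m) \<and> A m \<subseteq> G m) \<and> (\<forall>i j. \<forall>a\<in>G i. \<forall>x\<in>A j. a \<otimes> x \<in> A (i + j))"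

lemma homog_ksub: "homog A \<Longrightarrow> ksub (A m)"
  and homog_sub: "homog A \<Longrightarrow> A m \<subseteq> G m"
  and homog_mem: "homog A \<Longrightarrow> x \<in> A m \<Longrightarrow> x \<in> G m"
  and homog_mult: "homog A \<Longrightarrow> a \<in> G i \<Longrightarrow> x \<in> A j \<Longrightarrow> a \<otimes> x \<in> A (i + j)"
  by (auto simp: homog_def)

lemma homog_mult2: "homog A \<Longrightarrow> a \<in> G i \<Longrightarrow> x \<in> A j \<Longrightarrow> x \<otimes> a \<in> A (j + i)"
  using homog_mult[of A a i x j] m_comm[of a x] G_carrier[of a i] G_carrier[of x j] homog_mem[of A x j]
  by (simp add: add.commute)

lemma homog_carrier: "homog A \<Longrightarrow> x \<in> A m \<Longrightarrow> x \<in> carrier R"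
  using homog_mem G_carrier by blast

lemma homog_zero [simp]: "homog A \<Longrightarrow> \<zero> \<in> A m"
  using homog_ksub ksub_zero by blast

lemma homog_G: "homog G"
  by (auto simp: homog_def ksub_G G_mult)

lemma homog_zero_family: "homog (\<lambda>m. {\<zero>})"
  by (auto simp: homog_def ksub_zero_set G_carrier)

lemma homog_one: assumes "homog A" "\<one> \<in> A 0" shows "A = G"
proof
  fix m show "A m = G m"
    using homog_mult[OF assms(1) _ assms(2), of _ m] homog_sub[OF assms(1)] G_carrier by force
qed

section \<open>Ideals of homogeneous families and Noetherian induction\<close>

definition to_ideal :: "(nat \<Rightarrow> 'a set) \<Rightarrow> 'a set" where
  "to_ideal A = {x \<in> carrier R. \<forall>m. component x m \<in> A m}"

lemma to_ideal_homogeneous: assumes "homog A" shows "x \<in> G m \<Longrightarrow> x \<in> to_ideal A \<longleftrightarrow> x \<in> A m"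
  using component_homogeneous[of x m] G_carrier assms by (auto simp: to_ideal_def)

lemma ideal_to_ideal: assumes "homog A" shows "ideal (to_ideal A) R"
proof (rule idealI[OF ring_axioms])
  show "subgroup (to_ideal A) (add_monoid R)"
  proof (rule add.subgroupI)
    show "to_ideal A \<subseteq> carrier R" by (auto simp: to_ideal_def)
    have "\<zero> \<in> to_ideal A" using assms by (auto simp: to_ideal_def component_zero)
    then show "to_ideal A \<noteq> {}" by blast
    show "x \<oplus> y \<in> to_ideal A" if "x \<in> to_ideal A" "y \<in> to_ideal A" for x y
      using that ksub_add[OF homog_ksub[OF assms]] by (auto simp: to_ideal_def component_add)
    show "\<ominus> x \<in> to_ideal A" if "x \<in> to_ideal A" for x
    proof -
      have x: "x \<in> carrier R" "\<And>m. component x m \<in> A m" using that by (auto simp: to_ideal_def)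
      have "component (x \<oplus> \<ominus> x) m = component x m \<oplus> component (\<ominus> x) m" for m using x(1) by (simp add: component_add)
      then have "component x m \<oplus> component (\<ominus> x) m = \<zero>" for m using x(1) by (simp add: r_neg component_zero)
      then have "component (\<ominus> x) m \<in> A m" for m
        using ksub_add_cancel[OF homog_ksub[OF assms], of "component x m" "component (\<ominus> x) m" m] x assms
        by (simp add: component_carrier)
      then show ?thesis using x(1) by (simp add: to_ideal_def)
    qed
  qed
next
  fix a x assume a: "a \<in> to_ideal A" and x: "x \<in> carrier R"
  then have *: "a \<in> carrier R" "\<And>m. component a m \<in> A m" by (auto simp: to_ideal_def)
  have "component (x \<otimes> a) n \<in> A n" for n
    unfolding component_mult[OF x *(1)]
  proof (rule ksub_finsum[OF homog_ksub[OF assms]])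
    fix k assume "k \<in> {..n}"
    then show "component x k \<otimes> component a (n - k) \<in> A n"
      using homog_mult[OF assms component_mem[OF x, of k] *(2)[of "n - k"]] by simp
  qed simp
  then show "x \<otimes> a \<in> to_ideal A" using x *(1) by (auto simp: to_ideal_def)
  then show "a \<otimes> x \<in> to_ideal A" using x *(1) by (simp add: m_comm)
qed

lemma to_ideal_mono: "A \<le> B \<Longrightarrow> to_ideal A \<subseteq> to_ideal B"
  by (auto simp: to_ideal_def le_fun_def)

lemma to_ideal_strict_mono: assumes "homog A" "homog B" "A < B" shows "to_ideal A \<subset> to_ideal B"
proof -
  have "A \<le> B" using assms(3) by (rule less_imp_le)
  moreover obtain m x where "x \<in> B m" "x \<notin> A m"
    using assms(3) unfolding less_le_not_le[of A B] le_fun_def subset_iff by blast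
  moreover have "x \<in> G m" using \<open>x \<in> B m\<close> homog_mem assms(2) by blast
  ultimately show ?thesis
    using to_ideal_mono[of A B] to_ideal_homogeneous[OF assms(1)] to_ideal_homogeneous[OF assms(2)] by blast
qed

text \<open>The ideals of an increasing sequence of families form an ascending chain, which stops in
  a Noetherian ring. Larger families are smaller in this relation, so \<open>wfE_min\<close> yields
  maximal ones and induction may assume the claim for all larger ones.\<close>

lemma wf_homog: "wf {(B, A). homog A \<and> homog B \<and> A < B}"
proof (rule ccontr)
  assume "\<not> wf {(B, A). homog A \<and> homog B \<and> A < B}"
  then obtain f where f: "\<And>i. (f (Suc i), f i) \<in> {(B, A). homog A \<and> homog B \<and> A < B}"
    unfolding wf_iff_no_infinite_down_chain by blast
  have h: "homog (f i)" and l: "f i < f (Suc i)" for i using f[of i] by auto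
  have ss: "to_ideal (f i) \<subset> to_ideal (f (Suc i))" for i
    by (rule to_ideal_strict_mono[OF h h l])
  then have mono: "i \<le> j \<Longrightarrow> to_ideal (f i) \<subseteq> to_ideal (f j)" for i j
    using lift_Suc_mono_le[of "\<lambda>i. to_ideal (f i)" i j] by blast
  let ?C = "range (\<lambda>i. to_ideal (f i))"
  have "subset.chain {I. ideal I R} ?C"
    unfolding subset_chain_def using ideal_to_ideal[OF h] mono by (auto, meson nat_le_linear subsetD)
  then have "\<Union>?C \<in> ?C" by (intro ideal_chain_is_trivial) auto
  then obtain i where "\<Union>?C = to_ideal (f i)" by blast
  then have "to_ideal (f (Suc i)) \<subseteq> to_ideal (f i)" by blast
  then show False using ss[of i] by blast
qed

lemma finite_len_G: "finite_len (G m)"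
proof -
  \<comment> \<open>Together with the components of higher degree, a subspace \<open>W\<close> of \<open>G m\<close> forms a homogeneous ideal
    \<open>E W\<close>; take a maximal \<open>W\<close> of finite length.\<close>
  define E where "E W i = (if i < m then {\<zero>} else if i = m then W else G i)" for W and i :: nat
  have hE: "homog (E W)" if "ksub W" "W \<subseteq> G m" for W
    unfolding homog_def
  proof (intro conjI allI ballI)
    fix i show "ksub (E W i)" "E W i \<subseteq> G i"
      using that by (auto simp: E_def ksub_zero_set ksub_G)
  next
    fix i j a x assume ax: "a \<in> G i" "x \<in> E W j"
    show "a \<otimes> x \<in> E W (i + j)"
    proof (cases "x = \<zero>")
      case True
      then show ?thesis using that ax G_carrier ksub_zero[OF that(1)] by (auto simp: E_def)
    next
      case False
      then have "m \<le> j" using ax by (auto simp: E_def split: if_splits)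
      have "x \<in> G j" using ax that \<open>m \<le> j\<close> by (auto simp: E_def split: if_splits)
      show ?thesis
      proof (cases "i + j = m")
        case True
        then show ?thesis using \<open>m \<le> j\<close> ax ksub_smult[OF that(1)] by (auto simp: E_def)
      next
        case False
        then show ?thesis using \<open>m \<le> j\<close> G_mult[OF ax(1) \<open>x \<in> G j\<close>] by (auto simp: E_def)
      qed
    qed
  qed
  let ?Q = "{E W | W. ksub W \<and> W \<subseteq> G m \<and> len {\<zero>} W < \<infinity>}"
  have "ksub {\<zero>} \<and> {\<zero>} \<subseteq> G m \<and> len {\<zero>} {\<zero>} < \<infinity>" by (simp add: ksub_zero_set len_refl)
  then have "E {\<zero>} \<in> ?Q" by blast
  from wfE_min[OF wf_homog this] obtain A where A: "A \<in> ?Q"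
    "\<And>B. (B, A) \<in> {(B, A). homog A \<and> homog B \<and> A < B} \<Longrightarrow> B \<notin> ?Q" by blast
  from A(1) obtain W where W: "A = E W" "ksub W" "W \<subseteq> G m" "len {\<zero>} W < \<infinity>" by blast
  have "W = G m"
  proof (rule ccontr)
    assume "W \<noteq> G m"
    then obtain b where b: "b \<in> G m" "b \<notin> W" using W(3) by blast
    have bc: "b \<in> carrier R" using b(1) G_carrier by blast
    have sl: "semilinear (G 0) (\<lambda>c. c \<otimes> b)"
      unfolding semilinear_def using bc by (auto simp: G_carrier l_distr m_assoc)
    let ?W = "W <+>\<^bsub>R\<^esub> (\<lambda>c. c \<otimes> b) ` G 0"
    have im: "ksub ((\<lambda>c. c \<otimes> b) ` G 0)" by (rule ksub_image[OF sl ksub_G ksub_G]) simp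
    have kW: "ksub ?W" by (rule ksub_set_add[OF W(2) im])
    \<comment> \<open>Adjoining the scalar multiples of one vector costs at most the length of
      \<open>G 0\<close>, which is at most 1. So a maximal \<open>W\<close> of finite length can
      still be enlarged unless it is all of \<open>G m\<close>.\<close>
    have "len W ?W = len {x \<in> G 0. x \<otimes> b \<in> W} (G 0)"
      using len_semilinear[OF sl ksub_G W(2)] by simp
    also have "\<dots> \<le> len {\<zero>} (G 0)"
      by (rule len_mono) (use bc ksub_zero[OF W(2)] in auto)
    also have "\<dots> \<le> 1" by (rule len_G0)
    finally have "len W ?W \<le> 1" .
    moreover have "len {\<zero>} ?W = len {\<zero>} W + len W ?W"
      by (rule len_additive[OF ksub_zero_set W(2) kW _ subset_set_add1[OF W(2) im]])
        (use ksub_zero[OF W(2)] in auto)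
    ultimately have "len {\<zero>} ?W < \<infinity>" using W(4) by (cases "len W ?W") auto
    moreover have sub: "?W \<subseteq> G m"
      by (rule set_add_least[OF ksub_G W(3)]) (use b(1) G0_mult in auto)
    ultimately have "E ?W \<in> ?Q" using kW by blast
    moreover have "(E ?W, A) \<in> {(B, A). homog A \<and> homog B \<and> A < B}"
    proof -
      have "W \<subseteq> ?W" by (rule subset_set_add1[OF W(2) im])
      then have "E W \<le> E ?W" by (auto simp: E_def le_fun_def)
      moreover have "b \<in> ?W"
        using subset_set_add2[OF W(2) im] bc one_G0 by (metis imageI l_one subsetD)
      then have "\<not> E ?W \<le> E W" using b(2) by (auto simp: E_def le_fun_def)
      ultimately show ?thesis using W(1) hE[OF W(2,3)] hE[OF kW sub] by (auto simp: less_le_not_le)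
    qed
    ultimately show False using A(2) by blast
  qed
  then show ?thesis using W by (simp add: finite_len_def)
qed

text \<open>The use of standard grading. The family \<open>T\<close>, in which
  \<open>T (Suc m)\<close> is the span of the products of degree 1 by degree \<open>m\<close>, is
  closed under multiplication. Hence the elements with all components in \<open>T\<close> form a
  subring containing the generators, which is everything.\<close>

lemma ksub_span_G1:
  assumes V: "ksub V" and *: "\<And>x y. x \<in> G 1 \<Longrightarrow> y \<in> G m \<Longrightarrow> x \<otimes> y \<in> V"
  shows "G (Suc m) \<subseteq> V"
proof -
  define \<V> where "\<V> m = {V. ksub V \<and> (\<forall>x\<in>G 1. \<forall>y\<in>G m. x \<otimes> y \<in> V)}" for m
  define T where "T n = (case n of 0 \<Rightarrow> G 0 | Suc m \<Rightarrow> \<Inter>(\<V> m))" for n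
  have GV: "G (Suc m) \<in> \<V> m" for m using G_mult[of _ 1 _ m] by (auto simp: \<V>_def ksub_G)
  have kT: "ksub (T n)" for n
  proof (cases n)
    case (Suc m)
    have "ksub (\<Inter>(\<V> m))" by (rule ksub_Inter) (use GV[of m] in \<open>auto simp: \<V>_def\<close>)
    then show ?thesis using Suc by (simp add: T_def)
  qed (simp add: T_def ksub_G)
  have TG: "T n \<subseteq> G n" for n using GV by (cases n) (auto simp: T_def)
  have gen: "x \<otimes> y \<in> T (Suc m)" if "x \<in> G 1" "y \<in> G m" for x y m
    using that by (auto simp: T_def \<V>_def)
  have Tmult: "x \<otimes> y \<in> T (i + j)" if "x \<in> T i" "y \<in> T j" for x y i j
  proof (cases i)
    case 0
    then show ?thesis using that ksub_smult[OF kT] by (simp add: T_def)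
  next
    case (Suc m)
    have yG: "y \<in> G j" using that(2) TG by blast
    have yc: "y \<in> carrier R" using yG G_carrier by blast
    have sl: "semilinear (G i) (\<lambda>x. x \<otimes> y)"
      unfolding semilinear_def using yc by (auto simp: G_carrier l_distr m_assoc)
    have "a \<otimes> b \<in> {x \<in> G i. x \<otimes> y \<in> T (i + j)}" if ab: "a \<in> G 1" "b \<in> G m" for a b
    proof -
      have "a \<otimes> b \<otimes> y = a \<otimes> (b \<otimes> y)" using yc G_carrier[OF ab(1)] G_carrier[OF ab(2)] by (simp add: m_assoc)
      moreover have "a \<otimes> (b \<otimes> y) \<in> T (Suc (m + j))" by (rule gen[OF ab(1) G_mult[OF ab(2) yG]])
      ultimately show ?thesis using Suc G_mult[OF ab] by simp
    qed
    then have "{x \<in> G i. x \<otimes> y \<in> T (i + j)} \<in> \<V> m"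
      using ksub_preimage[OF sl ksub_G kT, of "i + j"] unfolding \<V>_def by blast
    then have "T i \<subseteq> {x \<in> G i. x \<otimes> y \<in> T (i + j)}" using Suc by (auto simp: T_def)
    then show ?thesis using that(1) by blast
  qed
  have "component x n \<in> T n" if "x \<in> generate_ring R (G 0 \<union> G 1)" for x n
    using that
  proof (induction arbitrary: n)
    case one
    then show ?case using component_homogeneous[OF one_G0] ksub_zero[OF kT] by (auto simp: T_def one_G0)
  next
    case (incl h)
    have "G 1 \<subseteq> T 1"
    proof
      fix x assume "x \<in> G 1"
      then have "x \<otimes> \<one> \<in> T 1" using gen[OF _ one_G0] by simp
      then show "x \<in> T 1" using \<open>x \<in> G 1\<close> G_carrier by simp
    qed
    then show ?case using incl ksub_zero[OF kT] component_homogeneous[of h 0] component_homogeneous[of h 1]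
      by (auto simp: T_def)
  next
    case (a_inv h)
    have "h \<in> carrier R" using a_inv(1) generated by simp
    then have "component h n \<oplus> component (\<ominus> h) n = \<zero>"
      using component_add[of h "\<ominus> h"] by (simp add: r_neg component_zero fun_eq_iff)
    then show ?case using ksub_add_cancel[OF kT, of "component h n" "component (\<ominus> h) n" n] a_inv(2) ksub_zero[OF kT]
      \<open>h \<in> carrier R\<close> by (simp add: component_carrier)
  next
    case (eng_add h1 h2)
    then show ?case using component_add[of h1 h2] ksub_add[OF kT] generated by simp
  next
    case (eng_mult h1 h2)
    then have c: "h1 \<in> carrier R" "h2 \<in> carrier R" using generated by auto
    show ?case unfolding component_mult[OF c]
    proof (rule ksub_finsum[OF kT])
      fix k assume "k \<in> {..n}"
      then show "component h1 k \<otimes> component h2 (n - k) \<in> T n"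
        using Tmult[OF eng_mult.IH(1)[of k] eng_mult.IH(2)[of "n - k"]] by simp
    qed simp
  qed
  then have "x \<in> T n" if "x \<in> G n" for x n
    using that generated G_carrier component_homogeneous[OF that] by metis
  moreover have "T (Suc m) \<subseteq> V" using V * by (auto simp: T_def \<V>_def)
  ultimately show ?thesis by blast
qed

section \<open>Homogeneous primes\<close>

definition hprime :: "(nat \<Rightarrow> 'a set) \<Rightarrow> bool" where
  "hprime P \<longleftrightarrow> homog P \<and> \<one> \<notin> P 0 \<and> (\<forall>i j. \<forall>a\<in>G i. \<forall>b\<in>G j. a \<otimes> b \<in> P (i + j) \<longrightarrow> a \<in> P i \<or> b \<in> P j)"

lemma hprime_homog: "hprime P \<Longrightarrow> homog P"
  and hprime_one: "hprime P \<Longrightarrow> \<one> \<notin> P 0"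
  and hprime_mult: "hprime P \<Longrightarrow> a \<in> G i \<Longrightarrow> b \<in> G j \<Longrightarrow> a \<otimes> b \<in> P (i + j) \<Longrightarrow> a \<in> P i \<or> b \<in> P j"
  by (auto simp: hprime_def)

lemma hprime_pow: "hprime P \<Longrightarrow> a \<in> G i \<Longrightarrow> a [^] (n::nat) \<in> P (n * i) \<Longrightarrow> a \<in> P i"
proof (induction n)
  case 0
  then show ?case using hprime_one[of P] by simp
next
  case (Suc n)
  have "a [^] n \<otimes> a \<in> P (n * i + i)" using Suc.prems by (simp add: add.commute)
  then show ?case using hprime_mult[OF Suc.prems(1) G_pow[OF Suc.prems(2)] Suc.prems(2)] Suc by blast
qed

text \<open>If neither factor lies in the ideal, take the top components of each outside
  \<open>P\<close>, of degrees \<open>m\<close> and \<open>n\<close>. In degree \<open>m + n\<close>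
  of the product all other terms lie in \<open>P\<close>, so the product of these two does as well,
  against primality on homogeneous elements.\<close>

lemma primeideal_to_ideal: assumes P: "hprime P" shows "primeideal (to_ideal P) R"
proof (rule primeidealI)
  note h = hprime_homog[OF P]
  show id: "ideal (to_ideal P) R" by (rule ideal_to_ideal[OF h])
  show "cring R" by unfold_locales
  have "\<one> \<notin> to_ideal P" using to_ideal_homogeneous[OF h one_G0] hprime_one[OF P] by simp
  then show "carrier R \<noteq> to_ideal P" by blast
  fix x y assume x: "x \<in> carrier R" and y: "y \<in> carrier R" and xy: "x \<otimes> y \<in> to_ideal P"
  show "x \<in> to_ideal P \<or> y \<in> to_ideal P"
  proof (rule ccontr)
    assume "\<not> (x \<in> to_ideal P \<or> y \<in> to_ideal P)"
    then have ne: "{m. component x m \<notin> P m} \<noteq> {}" "{m. component y m \<notin> P m} \<noteq> {}"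
      using x y by (auto simp: to_ideal_def)
    have fin: "finite {m. component x m \<notin> P m}" "finite {m. component y m \<notin> P m}"
      by (rule finite_subset[OF _ finite_component[OF x]] finite_subset[OF _ finite_component[OF y]], use h in force)+
    define m where "m = Max {m. component x m \<notin> P m}"
    define n where "n = Max {m. component y m \<notin> P m}"
    have m: "component x m \<notin> P m" "\<And>k. k > m \<Longrightarrow> component x k \<in> P k"
      using Max_in[OF fin(1) ne(1)] Max_ge[OF fin(1)] unfolding m_def by (auto, meson not_le)
    have n: "component y n \<notin> P n" "\<And>k. k > n \<Longrightarrow> component y k \<in> P k"
      using Max_in[OF fin(2) ne(2)] Max_ge[OF fin(2)] unfolding n_def by (auto, meson not_le)
    let ?f = "\<lambda>k. component x k \<otimes> component y (m + n - k)"
    have fc: "?f k \<in> carrier R" for k using x y by (simp add: component_carrier)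
    have "component (x \<otimes> y) (m + n) \<in> P (m + n)" using xy by (auto simp: to_ideal_def)
    moreover have s: "component (x \<otimes> y) (m + n) = ?f m \<oplus> (\<Oplus>k\<in>{..m+n} - {m}. ?f k)"
    proof -
      have "{..m+n} = insert m ({..m+n} - {m})" by auto
      then have "(\<Oplus>k\<in>{..m+n}. ?f k) = (\<Oplus>k\<in>insert m ({..m+n} - {m}). ?f k)" by simp
      also have "\<dots> = ?f m \<oplus> (\<Oplus>k\<in>{..m+n} - {m}. ?f k)"
        by (rule finsum_insert) (use fc fc[of m] in auto)
      finally show ?thesis using component_mult[OF x y, of "m + n"] by simp
    qed
    moreover have "(\<Oplus>k\<in>{..m+n} - {m}. ?f k) \<in> P (m + n)"
    proof (rule ksub_finsum[OF homog_ksub[OF h]])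
      fix k assume k: "k \<in> {..m+n} - {m}"
      show "?f k \<in> P (m + n)"
      proof (cases "k > m")
        case True
        then show ?thesis
          using homog_mult2[OF h component_mem[OF y, of "m + n - k"] m(2)[of k]] k by simp
      next
        case False
        then have "m + n - k > n" using k by auto
        then show ?thesis
          using homog_mult[OF h component_mem[OF x, of k] n(2)[of "m + n - k"]] k by simp
      qed
    qed simp
    ultimately have "?f m \<in> P (m + n)"
      unfolding s by (intro ksub_add_cancel2[OF homog_ksub[OF h] _ _ fc])
    then have "component x m \<otimes> component y n \<in> P (m + n)" by simp
    then show False using hprime_mult[OF P component_mem[OF x] component_mem[OF y]] m(1) n(1) by blast
  qed
qed

end

section \<open>Prime filtrations\<close>

context graded_algebra
begin

definition shift :: "nat \<Rightarrow> (nat \<Rightarrow> 'a set) \<Rightarrow> nat \<Rightarrow> 'a set" where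
  "shift a F m = (if a \<le> m then F (m - a) else {\<zero>})"

text \<open>The two properties of the \<open>q\<close>-th power map used below: additivity, and
  surjectivity on the field of scalars. The exponent \<open>q = 1\<close> qualifies too, so ordinary
  filtrations and spans are the case \<open>q = 1\<close> of the twisted ones.\<close>

definition frob :: "nat \<Rightarrow> bool" where
  "frob q \<longleftrightarrow> q > 0 \<and> (\<forall>x\<in>carrier R. \<forall>y\<in>carrier R. (x \<oplus> y) [^] q = x [^] q \<oplus> y [^] q) \<and>
     (\<forall>c\<in>G 0. \<exists>d\<in>G 0. d [^] q = c)"

lemma frob_pos: "frob q \<Longrightarrow> q > 0" by (simp add: frob_def)

lemma frob_1: "frob 1"
  by (auto simp: frob_def G_carrier)

lemma frob_add: "frob q \<Longrightarrow> x \<in> carrier R \<Longrightarrow> y \<in> carrier R \<Longrightarrow> (x \<oplus> y) [^] q = x [^] q \<oplus> y [^] q"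
  by (simp add: frob_def)

lemma pow_zero: "q > 0 \<Longrightarrow> \<zero> [^] (q::nat) = \<zero>"
  by (cases q) auto

text \<open>Here perfectness of the field enters: the last clause of \<open>semilinear\<close> asks
  for a \<open>q\<close>-th root of a given scalar.\<close>

lemma semilinear_frob:
  assumes q: "frob q" and b: "b \<in> carrier R" and A: "A \<subseteq> carrier R"
  shows "semilinear A (\<lambda>c. c [^] q \<otimes> b)"
  unfolding semilinear_def
proof (intro conjI ballI)
  show "x [^] q \<otimes> b \<in> carrier R" if "x \<in> A" for x using that A b by auto
  show "(x \<oplus> y) [^] q \<otimes> b = x [^] q \<otimes> b \<oplus> y [^] q \<otimes> b" if "x \<in> A" "y \<in> A" for x y
  proof -
    have "x \<in> carrier R" "y \<in> carrier R" using that A by auto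
    then show ?thesis using b by (simp add: frob_add[OF q] l_distr)
  qed
next
  fix c assume c: "c \<in> G 0"
  have *: "(d \<otimes> x) [^] q \<otimes> b = d [^] q \<otimes> (x [^] q \<otimes> b)" if "x \<in> A" "d \<in> G 0" for x d
  proof -
    have "x \<in> carrier R" "d \<in> carrier R" using that A G_carrier by auto
    then show ?thesis using b by (simp add: nat_pow_distrib m_assoc)
  qed
  have "c [^] q \<in> G 0" using G_pow[OF c, of q] by simp
  then show "\<exists>c'\<in>G 0. \<forall>x\<in>A. (c \<otimes> x) [^] q \<otimes> b = c' \<otimes> (x [^] q \<otimes> b)" using * c by blast
  obtain d where "d \<in> G 0" "d [^] q = c" using q c by (auto simp: frob_def)
  then show "\<exists>c'\<in>G 0. \<forall>x\<in>A. (c' \<otimes> x) [^] q \<otimes> b = c \<otimes> (x [^] q \<otimes> b)" using * by blast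
qed

lemma shift_ksub: "homog J \<Longrightarrow> ksub (shift a J m)"
  by (simp add: shift_def homog_ksub ksub_zero_set)

lemma shift_mono: "J \<le> J' \<Longrightarrow> shift a J m \<subseteq> shift a J' m"
  by (auto simp: shift_def le_fun_def)

lemma homog_le_G: "homog J \<Longrightarrow> J \<le> G"
  by (auto simp: le_fun_def homog_mem)

lemma shift_sub: "homog J \<Longrightarrow> shift a J m \<subseteq> shift a G m"
  using shift_mono[OF homog_le_G] .

lemma shift_carrier: "homog J \<Longrightarrow> shift a J m \<subseteq> carrier R"
  by (auto simp: shift_def homog_carrier)

lemma shift_finite_len: "finite_len (shift a G m)"
  using finite_len_G[of "m - a"] by (cases "a \<le> m") (auto simp: shift_def finite_len_def ksub_zero_set len_refl zero_enat_def)

lemma shift_frob_mem: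
  assumes "q > 0" "c \<in> shift a G m" "b \<in> G (q * a + r)" shows "c [^] q \<otimes> b \<in> G (q * m + r)"
proof (cases "a \<le> m")
  case True
  then have "c [^] q \<otimes> b \<in> G (q * (m - a) + (q * a + r))"
    using assms by (intro G_mult G_pow) (simp_all add: shift_def)
  then show ?thesis using True by (simp add: algebra_simps diff_mult_distrib2)
next
  case False
  then show ?thesis using assms G_carrier by (simp add: shift_def pow_zero)
qed

lemma shift_mult: "homog J \<Longrightarrow> c \<in> G i \<Longrightarrow> d \<in> shift a J j \<Longrightarrow> c \<otimes> d \<in> shift a J (i + j)"
  using homog_mult[of J c i d "j - a"] G_carrier[of c i] by (auto simp: shift_def split: if_splits)

text \<open>In an entry \<open>(a, b)\<close> the number \<open>a\<close> is the degree of
  \<open>b\<close> in the twisted module whose part of degree \<open>m\<close> is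
  \<open>G (q * m + r)\<close>.\<close>

definition valid :: "nat \<Rightarrow> nat \<Rightarrow> (nat \<times> 'a) list \<Rightarrow> bool" where
  "valid q r Bs \<longleftrightarrow> (\<forall>t\<in>set Bs. snd t \<in> G (q * fst t + r))"

text \<open>In degree \<open>q m + r\<close> this is \<open>A\<close> plus the sum of all \<open>c\<^sup>q b\<close> with \<open>b\<close> in \<open>Bs\<close> and \<open>c\<close> in \<open>J\<close>.\<close>

primrec fspan :: "nat \<Rightarrow> nat \<Rightarrow> (nat \<Rightarrow> 'a set) \<Rightarrow> (nat \<Rightarrow> 'a set) \<Rightarrow> (nat \<times> 'a) list \<Rightarrow> nat \<Rightarrow> 'a set" where
  "fspan q r J A [] m = A (q * m + r)"
| "fspan q r J A (t # Bs) m = fspan q r J A Bs m <+>\<^bsub>R\<^esub> (\<lambda>c. c [^] q \<otimes> snd t) ` shift (fst t) J m"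

lemma valid_simps [simp]: "valid q r []" "valid q r (t # Bs) \<longleftrightarrow> snd t \<in> G (q * fst t + r) \<and> valid q r Bs"
  "valid q r (Bs @ Cs) \<longleftrightarrow> valid q r Bs \<and> valid q r Cs"
  by (auto simp: valid_def)

lemma ksub_frob_image:
  assumes "frob q" "homog J" "b \<in> G n" shows "ksub ((\<lambda>c. c [^] q \<otimes> b) ` shift a J m)"
  by (rule ksub_image[OF semilinear_frob[OF assms(1) G_carrier[OF assms(3)] shift_carrier[OF assms(2)]]
        shift_ksub[OF assms(2)] shift_ksub[OF assms(2)] subset_refl])

context
  fixes q r :: nat and J A :: "nat \<Rightarrow> 'a set"
  assumes q: "frob q" and J: "homog J" and A: "homog A"
begin

lemma fspan_ksub: "valid q r Bs \<Longrightarrow> ksub (fspan q r J A Bs m)"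
  by (induction Bs) (auto intro!: ksub_set_add homog_ksub[OF A] ksub_frob_image[OF q J])

lemma fspan_sub: "valid q r Bs \<Longrightarrow> fspan q r J A Bs m \<subseteq> G (q * m + r)"
proof (induction Bs)
  case Nil
  then show ?case using homog_sub[OF A] by simp
next
  case (Cons t Bs)
  have "snd t \<in> G (q * fst t + r)" using Cons.prems by simp
  then have "(\<lambda>c. c [^] q \<otimes> snd t) ` shift (fst t) J m \<subseteq> G (q * m + r)"
    using shift_frob_mem[OF frob_pos[OF q]] shift_sub[OF J, of "fst t" m] by blast
  then show ?case using Cons by (simp add: set_add_least[OF ksub_G])
qed

lemma fspan_carrier: "valid q r Bs \<Longrightarrow> x \<in> fspan q r J A Bs m \<Longrightarrow> x \<in> carrier R"
  using fspan_sub G_carrier by blast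

lemma fspan_Cons_sub:
  assumes "valid q r (t # Bs)" shows "fspan q r J A Bs m \<subseteq> fspan q r J A (t # Bs) m"
proof -
  have "valid q r Bs" "snd t \<in> G (q * fst t + r)" using assms by auto
  from subset_set_add1[OF fspan_ksub[OF this(1)] ksub_frob_image[OF q J this(2)]] show ?thesis by simp
qed

lemma fspan_base: "valid q r Bs \<Longrightarrow> A (q * m + r) \<subseteq> fspan q r J A Bs m"
proof (induction Bs)
  case (Cons t Bs)
  then show ?case using fspan_Cons_sub[OF Cons.prems, of m] by auto
qed simp

lemma fspan_append_sub: "valid q r (Cs @ Bs) \<Longrightarrow> fspan q r J A Bs m \<subseteq> fspan q r J A (Cs @ Bs) m"
proof (induction Cs)
  case (Cons t Cs)
  have "valid q r (t # (Cs @ Bs))" using Cons.prems by simp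
  from fspan_Cons_sub[OF this, of m] Cons show ?case by auto
qed simp

lemma fspan_mem: "valid q r Bs \<Longrightarrow> t \<in> set Bs \<Longrightarrow> c \<in> shift (fst t) J m \<Longrightarrow> c [^] q \<otimes> snd t \<in> fspan q r J A Bs m"
proof (induction Bs)
  case (Cons s Bs)
  show ?case
  proof (cases "s = t")
    case True
    have "valid q r Bs" "snd s \<in> G (q * fst s + r)" using Cons.prems by auto
    from subset_set_add2[OF fspan_ksub[OF this(1)] ksub_frob_image[OF q J this(2)], of "fst s" m m]
    show ?thesis using True Cons.prems(3) by auto
  next
    case False
    then have "c [^] q \<otimes> snd t \<in> fspan q r J A Bs m" using Cons by auto
    then show ?thesis using fspan_Cons_sub[OF Cons.prems(1), of m] by blast
  qed
qed simp

lemma fspan_mult: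
  "valid q r Bs \<Longrightarrow> c \<in> G i \<Longrightarrow> x \<in> fspan q r J A Bs j \<Longrightarrow> c [^] q \<otimes> x \<in> fspan q r J A Bs (i + j)"
proof (induction Bs arbitrary: x)
  case Nil
  then have "c [^] q \<otimes> x \<in> A (q * i + (q * j + r))" by (intro homog_mult[OF A] G_pow) auto
  then show ?case by (simp add: algebra_simps)
next
  case (Cons t Bs)
  then obtain y d where yd: "y \<in> fspan q r J A Bs j" "d \<in> shift (fst t) J j" "x = y \<oplus> d [^] q \<otimes> snd t"
    by (auto simp: mem_set_add)
  have yc: "y \<in> carrier R" using yd(1) fspan_carrier Cons.prems by auto
  have dc: "d \<in> carrier R" using shift_carrier[OF J] yd(2) by auto
  have tc: "snd t \<in> carrier R" using Cons.prems G_carrier by auto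
  have cc: "c \<in> carrier R" using Cons.prems(2) G_carrier by auto
  have "c [^] q \<otimes> x = c [^] q \<otimes> y \<oplus> (c \<otimes> d) [^] q \<otimes> snd t"
    using yd(3) yc dc tc cc by (simp add: r_distr m_assoc nat_pow_distrib)
  moreover have "c [^] q \<otimes> y \<in> fspan q r J A Bs (i + j)" using Cons.IH Cons.prems yd(1) by simp
  moreover have "c \<otimes> d \<in> shift (fst t) J (i + j)" by (rule shift_mult[OF J Cons.prems(2) yd(2)])
  ultimately show ?case by (auto simp: mem_set_add)
qed

lemma fspan_rlen_Cons:
  assumes "valid q r (t # Bs)"
  shows "rlen (fspan q r J A Bs m) (fspan q r J A (t # Bs) m) =
    rlen {c \<in> shift (fst t) J m. c [^] q \<otimes> snd t \<in> fspan q r J A Bs m} (shift (fst t) J m)"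
  using rlen_semilinear[OF semilinear_frob[OF q _ shift_carrier[OF J]] shift_ksub[OF J] fspan_ksub] assms G_carrier
  by auto

lemma fspan_finite_len: "valid q r Bs \<Longrightarrow> finite_len (fspan q r J A Bs m)"
  by (rule finite_len_subset[OF finite_len_G fspan_ksub fspan_sub])

end

lemma fspan_mono:
  assumes "J \<le> J'" "A \<le> A'" shows "fspan q r J A Bs m \<subseteq> fspan q r J' A' Bs m"
proof (induction Bs)
  case Nil
  then show ?case using assms(2) by (simp add: le_fun_def)
next
  case (Cons t Bs)
  show ?case unfolding fspan.simps by (rule set_add_mono[OF Cons image_mono[OF shift_mono[OF assms(1)]]])
qed

text \<open>For \<open>q = 1\<close> and \<open>r = 0\<close> the span is the ideal generated by
  \<open>A\<close> together with \<open>hs\<close>. Sums with finitely generated ideals are written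
  in this way from here on.\<close>

lemma homog_fspan: assumes "homog A" "valid 1 0 hs" shows "homog (fspan 1 0 G A hs)"
  unfolding homog_def
proof (intro conjI allI ballI)
  show "ksub (fspan 1 0 G A hs m)" for m by (rule fspan_ksub[OF frob_1 homog_G assms])
  show "fspan 1 0 G A hs m \<subseteq> G m" for m using fspan_sub[OF frob_1 homog_G assms, of m] by simp
  show "a \<otimes> x \<in> fspan 1 0 G A hs (i + j)" if "a \<in> G i" "x \<in> fspan 1 0 G A hs j" for a x i j
    using fspan_mult[OF frob_1 homog_G assms that] G_carrier[OF that(1)] by simp
qed

lemma fspan_base1: "homog A \<Longrightarrow> valid 1 0 hs \<Longrightarrow> A \<le> fspan 1 0 G A hs"
  using fspan_base[OF frob_1 homog_G, of A 0 hs] by (auto simp: le_fun_def)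

lemma fspan_mem1:
  assumes "homog A" "valid 1 0 hs" "t \<in> set hs" shows "snd t \<in> fspan 1 0 G A hs (fst t)"
  using fspan_mem[OF frob_1 homog_G assms(1,2,3), of \<one> "fst t"] one_G0 assms(2,3) G_carrier
  by (auto simp: shift_def valid_def)

lemma fspan_least:
  assumes B: "homog B" and "A \<le> B" "\<And>t. t \<in> set hs \<Longrightarrow> snd t \<in> B (fst t)"
  shows "fspan 1 0 G A hs \<le> B"
  using assms(3)
proof (induction hs)
  case Nil
  then show ?case using assms(2) by (auto simp: le_fun_def)
next
  case (Cons t hs)
  have "(\<lambda>c. c [^] (1::nat) \<otimes> snd t) ` shift (fst t) G m \<subseteq> B m" for m
  proof
    fix z assume "z \<in> (\<lambda>c. c [^] (1::nat) \<otimes> snd t) ` shift (fst t) G m"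
    then obtain c where c: "c \<in> shift (fst t) G m" "z = c [^] (1::nat) \<otimes> snd t" by blast
    have t: "snd t \<in> B (fst t)" using Cons.prems by simp
    show "z \<in> B m"
    proof (cases "fst t \<le> m")
      case True
      then have "c \<in> G (m - fst t)" using c(1) by (simp add: shift_def)
      from homog_mult[OF B this t] show ?thesis using True c(2) G_carrier[OF \<open>c \<in> G (m - fst t)\<close>] by simp
    next
      case False
      then show ?thesis using c homog_carrier[OF B t] B by (simp add: shift_def)
    qed
  qed
  moreover have "fspan 1 0 G A hs m \<subseteq> B m" for m using Cons by (simp add: le_fun_def)
  ultimately have "fspan 1 0 G A (t # hs) m \<subseteq> B m" for m
    unfolding fspan.simps by (intro set_add_least[OF homog_ksub[OF B]])
  then show ?case by (rule le_funI)
qed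

lemma homog_colon:
  assumes B: "homog B" and u: "u \<in> G e" shows "homog (\<lambda>i. {c \<in> G i. c \<otimes> u \<in> B (i + e)})"
proof -
  note uc = G_carrier[OF u]
  have sl: "semilinear (G i) (\<lambda>c. c \<otimes> u)" for i
    unfolding semilinear_def using uc by (auto simp: G_carrier l_distr m_assoc)
  show ?thesis unfolding homog_def
  proof (intro conjI allI ballI)
    show "ksub {c \<in> G i. c \<otimes> u \<in> B (i + e)}" for i by (rule ksub_preimage[OF sl ksub_G homog_ksub[OF B]])
    fix i j a x assume a: "a \<in> G i" and x: "x \<in> {c \<in> G j. c \<otimes> u \<in> B (j + e)}"
    have "a \<otimes> (x \<otimes> u) \<in> B (i + (j + e))" using homog_mult[OF B a] x by simp
    then show "a \<otimes> x \<in> {c \<in> G (i + j). c \<otimes> u \<in> B (i + j + e)}"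
      using x a uc G_carrier[OF a] G_carrier[of x j] G_mult[OF a] by (simp add: m_assoc add.assoc)
  qed auto
qed

lemma homog_annihilator:
  assumes q: "frob q" and A: "homog A" and v: "valid q r Bs" and b: "b \<in> G n"
  shows "homog (\<lambda>i. {c \<in> G i. c [^] q \<otimes> b \<in> fspan q r G A Bs (i + a)})"
proof -
  note bc = G_carrier[OF b]
  have sl: "semilinear (G i) (\<lambda>c. c [^] q \<otimes> b)" for i
    by (rule semilinear_frob[OF q bc]) (auto simp: G_carrier)
  show ?thesis unfolding homog_def
  proof (intro conjI allI ballI)
    show "ksub {c \<in> G i. c [^] q \<otimes> b \<in> fspan q r G A Bs (i + a)}" for i
      by (rule ksub_preimage[OF sl ksub_G fspan_ksub[OF q homog_G A v]])
    fix i j c x assume c: "c \<in> G i" and x: "x \<in> {c \<in> G j. c [^] q \<otimes> b \<in> fspan q r G A Bs (j + a)}"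
    have "c [^] q \<otimes> (x [^] q \<otimes> b) \<in> fspan q r G A Bs (i + (j + a))"
      using fspan_mult[OF q homog_G A v c] x by simp
    moreover have "c [^] q \<otimes> (x [^] q \<otimes> b) = (c \<otimes> x) [^] q \<otimes> b"
      using bc G_carrier[OF c] G_carrier[of x j] x by (simp add: m_assoc nat_pow_distrib)
    ultimately show "c \<otimes> x \<in> {c \<in> G (i + j). c [^] q \<otimes> b \<in> fspan q r G A Bs (i + j + a)}"
      using x G_mult[OF c] by (simp add: add.assoc)
  qed auto
qed

text \<open>The entries \<open>(P, a, b)\<close> describe, last entry first, a filtration of \<open>\<Oplus>\<^sub>m R\<^sub>q\<^sub>m / A\<^sub>q\<^sub>m\<close>, on which
  \<open>R\<close> acts through \<open>q\<close>-th powers: each quotient is generated by the class of \<open>b\<close> and its annihilator is \<open>P\<close>.\<close>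

primrec prime_filt :: "nat \<Rightarrow> (nat \<Rightarrow> 'a set) \<Rightarrow> ((nat \<Rightarrow> 'a set) \<times> nat \<times> 'a) list \<Rightarrow> bool" where
  "prime_filt q A [] \<longleftrightarrow> True"
| "prime_filt q A (t # L) \<longleftrightarrow> prime_filt q A L \<and> hprime (fst t) \<and> snd (snd t) \<in> G (q * fst (snd t)) \<and>
     (\<forall>i. \<forall>c\<in>G i. c [^] q \<otimes> snd (snd t) \<in> fspan q 0 G A (map snd L) (i + fst (snd t)) \<longleftrightarrow> c \<in> fst t i)"

lemma prime_filt_valid: "prime_filt q A L \<Longrightarrow> valid q 0 (map snd L)"
  by (induction L) auto

text \<open>Among the annihilators of nonzero homogeneous classes modulo \<open>B\<close>, a maximal
  one is prime: if \<open>b\<close> does not kill the class of \<open>u\<close>, the annihilator of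
  \<open>b u\<close> contains that of \<open>u\<close>, so the two agree.\<close>

lemma exists_prime_colon:
  assumes B: "homog B" and one: "\<one> \<notin> B 0"
  obtains u e where "u \<in> G e" "u \<notin> B e" "hprime (\<lambda>i. {c \<in> G i. c \<otimes> u \<in> B (i + e)})"
proof -
  define M where "M u e = (\<lambda>i. {c \<in> G i. c \<otimes> u \<in> B (i + e)})" for u e
  let ?Q = "{M u e | u e. u \<in> G e \<and> u \<notin> B e}"
  have "M \<one> 0 \<in> ?Q" using one one_G0 by blast
  from wfE_min[OF wf_homog this] obtain Z where Z: "Z \<in> ?Q"
    "\<And>B. (B, Z) \<in> {(B, A). homog A \<and> homog B \<and> A < B} \<Longrightarrow> B \<notin> ?Q" by blast
  from Z(1) obtain u e where u: "u \<in> G e" "u \<notin> B e" "Z = M u e" by blast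
  note uc = G_carrier[OF u(1)]
  have hM: "homog (M v d)" if "v \<in> G d" for v d unfolding M_def by (rule homog_colon[OF B that])
  have "hprime (M u e)" unfolding hprime_def
  proof (intro conjI allI ballI impI)
    show "homog (M u e)" by (rule hM[OF u(1)])
    show "\<one> \<notin> M u e 0" using u uc by (simp add: M_def)
    fix i j a b assume a: "a \<in> G i" and b: "b \<in> G j" and ab: "a \<otimes> b \<in> M u e (i + j)"
    note ac = G_carrier[OF a] and bc = G_carrier[OF b]
    show "a \<in> M u e i \<or> b \<in> M u e j"
    proof (rule disjCI)
      assume nb: "b \<notin> M u e j"
      have bu: "b \<otimes> u \<in> G (j + e)" "b \<otimes> u \<notin> B (j + e)"
        using nb b G_mult[OF b u(1)] by (auto simp: M_def)
      have "M u e \<le> M (b \<otimes> u) (j + e)"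
      proof (rule le_funI, rule subsetI)
        fix k c assume c: "c \<in> M u e k"
        then have cG: "c \<in> G k" "c \<otimes> u \<in> B (k + e)" by (auto simp: M_def)
        have "b \<otimes> (c \<otimes> u) \<in> B (j + (k + e))" by (rule homog_mult[OF B b cG(2)])
        moreover have "b \<otimes> (c \<otimes> u) = c \<otimes> (b \<otimes> u)" using bc uc G_carrier[OF cG(1)] by (simp add: m_ac)
        ultimately show "c \<in> M (b \<otimes> u) (j + e) k" using cG(1) by (simp add: M_def add.left_commute)
      qed
      moreover have "\<not> M u e < M (b \<otimes> u) (j + e)"
        using Z(2)[of "M (b \<otimes> u) (j + e)"] bu hM u(1,3) by blast
      ultimately have "M u e = M (b \<otimes> u) (j + e)" by (simp add: order_less_le)
      moreover have "a \<in> M (b \<otimes> u) (j + e) i"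
        using ab a ac bc uc by (simp add: M_def m_assoc add.assoc)
      ultimately show "a \<in> M u e i" by simp
    qed
  qed
  then show thesis using u(1,2) that unfolding M_def by blast
qed

text \<open>Noetherian induction on the annihilator of \<open>b\<close> modulo the current span. If
  it is proper, some multiple of \<open>b\<close> by a power \<open>u [^] q\<close> has a prime
  annihilator; adjoining this multiple puts \<open>u\<close> into the annihilator of
  \<open>b\<close>, which therefore grows.\<close>

lemma prime_filt_adjoin:
  assumes q: "frob q" and A: "homog A" and L: "prime_filt q A L" and b: "b \<in> G (q * a)"
  shows "\<exists>L'. prime_filt q A (L' @ L) \<and> b \<in> fspan q 0 G A (map snd (L' @ L)) a"
proof -
  define ann where "ann L = (\<lambda>i. {c \<in> G i. c [^] q \<otimes> b \<in> fspan q 0 G A (map snd L) (i + a)})"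
    for L :: "((nat \<Rightarrow> 'a set) \<times> nat \<times> 'a) list"
  have hann: "homog (ann L)" if "prime_filt q A L" for L
    unfolding ann_def by (rule homog_annihilator[OF q A prime_filt_valid[OF that] b])
  note bc = G_carrier[OF b]
  have "\<And>L. B = ann L \<Longrightarrow> prime_filt q A L \<Longrightarrow> \<exists>L'. prime_filt q A (L' @ L) \<and> b \<in> fspan q 0 G A (map snd (L' @ L)) a" for B
  proof (induction B rule: wf_induct_rule[OF wf_homog])
    case (1 B)
    show ?case
    proof (cases "\<one> \<in> B 0")
      case True
      then have "b \<in> fspan q 0 G A (map snd L) a" using bc unfolding 1(2) ann_def by simp
      then show ?thesis using 1(3) by (intro exI[of _ "[]"]) simp
    next
      case False
      have hB: "homog B" using hann[OF 1(3)] 1(2) by simp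
      obtain u e where u: "u \<in> G e" "u \<notin> B e" "hprime (\<lambda>i. {c \<in> G i. c \<otimes> u \<in> B (i + e)})"
        using exists_prime_colon[OF hB False] by blast
      note uc = G_carrier[OF u(1)]
      define t where "t = ((\<lambda>i. {c \<in> G i. c \<otimes> u \<in> B (i + e)}), e + a, u [^] q \<otimes> b)"
      have tG: "u [^] q \<otimes> b \<in> G (q * (e + a))"
        using G_mult[OF G_pow[OF u(1), of q] b] by (simp add: algebra_simps)
      have "c [^] q \<otimes> (u [^] q \<otimes> b) \<in> fspan q 0 G A (map snd L) (i + (e + a)) \<longleftrightarrow> c \<otimes> u \<in> B (i + e)"
        if "c \<in> G i" for c i
      proof -
        have "c [^] q \<otimes> (u [^] q \<otimes> b) = (c \<otimes> u) [^] q \<otimes> b"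
          using bc uc G_carrier[OF that] by (simp add: m_assoc nat_pow_distrib)
        then show ?thesis unfolding 1(2) ann_def using G_mult[OF that u(1)] by (simp add: add.assoc)
      qed
      then have L1: "prime_filt q A (t # L)" using 1(3) u(3) tG by (simp add: t_def)
      have v1: "valid q 0 (map snd (t # L))" by (rule prime_filt_valid[OF L1])
      have "B \<le> ann (t # L)"
        unfolding 1(2) ann_def le_fun_def using fspan_Cons_sub[OF q homog_G A, of 0 "snd t" "map snd L"] v1 by auto
      moreover have "u \<in> ann (t # L) e"
      proof -
        have "\<one> [^] q \<otimes> (u [^] q \<otimes> b) \<in> fspan q 0 G A (map snd (t # L)) (e + a)"
          using fspan_mem[OF q homog_G A v1, of "snd t" \<one> "e + a"] one_G0 by (simp add: t_def shift_def)
        then show ?thesis unfolding ann_def using u(1) uc bc by simp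
      qed
      ultimately have "B < ann (t # L)" using u(2) by (auto simp: less_le_not_le le_fun_def)
      then have "(ann (t # L), B) \<in> {(B, A). homog A \<and> homog B \<and> A < B}" using hB hann[OF L1] by simp
      from 1(1)[OF this refl L1] obtain L' where
        "prime_filt q A (L' @ (t # L))" "b \<in> fspan q 0 G A (map snd (L' @ (t # L))) a" by blast
      then show ?thesis by (intro exI[of _ "L' @ [t]"]) simp
    qed
  qed
  from this[OF refl L] show ?thesis .
qed

lemma prime_filt_exists_1:
  assumes A: "homog A" obtains L where "prime_filt 1 A L" "fspan 1 0 G A (map snd L) = G"
proof -
  obtain L where L: "prime_filt 1 A (L @ [])" "\<one> \<in> fspan 1 0 G A (map snd (L @ [])) 0"
    using prime_filt_adjoin[OF frob_1 A, of "[]" \<one> 0] one_G0 by auto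
  have "fspan 1 0 G A (map snd (L @ [])) = G"
    by (rule homog_one[OF homog_fspan[OF A prime_filt_valid[OF L(1)]] L(2)])
  then show thesis using that[of L] L(1) by simp
qed

text \<open>The Hilbert function of the quotient by \<open>A\<close>, hence decreasing in
  \<open>A\<close>.\<close>

definition hilb :: "(nat \<Rightarrow> 'a set) \<Rightarrow> nat \<Rightarrow> real" where
  "hilb A m = rlen (A m) (G m)"

lemma rlen_shift: "rlen (shift a P m) (shift a G m) = shift_seq a (hilb P) m"
  by (simp add: shift_def shift_seq_def hilb_def)

lemma hilb_nonneg [simp]: "hilb A m \<ge> 0"
  by (simp add: hilb_def)

lemma hilb_antimono: "homog A \<Longrightarrow> A \<le> B \<Longrightarrow> hilb B m \<le> hilb A m"
  unfolding hilb_def by (rule rlen_mono[OF finite_len_G homog_ksub]) (auto simp: le_fun_def)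

lemma hilb_zero_imp: "homog A \<Longrightarrow> hilb A m = 0 \<Longrightarrow> A m = G m"
  using rlen_ge_1[OF finite_len_G homog_ksub, of A m m] homog_sub[of A m] by (force simp: hilb_def)

text \<open>Each step adds a quotient on which \<open>c\<close> going to \<open>c [^] q\<close>
  times the generator has kernel exactly the prime. It is a copy of the ring modulo this prime,
  shifted by the degree of the generator.\<close>

lemma prime_filt_rlen:
  assumes q: "frob q" and A: "homog A" and "prime_filt q A L"
  shows "rlen (A (q * m)) (fspan q 0 G A (map snd L) m) = (\<Sum>t\<leftarrow>L. shift_seq (fst (snd t)) (hilb (fst t)) m)"
  using assms(3)
proof (induction L)
  case Nil
  then show ?case by simp
next
  case (Cons t L)
  have v: "valid q 0 (snd t # map snd L)" using prime_filt_valid[OF Cons.prems] by simp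
  then have v': "valid q 0 (map snd L)" by simp
  have "{c \<in> shift (fst (snd t)) G m. c [^] q \<otimes> snd (snd t) \<in> fspan q 0 G A (map snd L) m} = shift (fst (snd t)) (fst t) m"
  proof (cases "fst (snd t) \<le> m")
    case True
    have iff: "\<forall>i. \<forall>c\<in>G i. c [^] q \<otimes> snd (snd t) \<in> fspan q 0 G A (map snd L) (i + fst (snd t)) \<longleftrightarrow> c \<in> fst t i"
      and P: "hprime (fst t)" using Cons.prems by simp_all
    have "c [^] q \<otimes> snd (snd t) \<in> fspan q 0 G A (map snd L) m \<longleftrightarrow> c \<in> fst t (m - fst (snd t))"
      if "c \<in> G (m - fst (snd t))" for c
      using iff[rule_format, OF that] True by simp
    moreover have "fst t (m - fst (snd t)) \<subseteq> G (m - fst (snd t))" by (rule homog_sub[OF hprime_homog[OF P]])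
    ultimately show ?thesis using True unfolding shift_def by auto
  next
    case False
    have "snd (snd t) \<in> carrier R" using Cons.prems G_carrier[of "snd (snd t)" "q * fst (snd t)"] by simp
    then have "\<zero> [^] q \<otimes> snd (snd t) = \<zero>" by (simp add: pow_zero[OF frob_pos[OF q]])
    then show ?thesis using False ksub_zero[OF fspan_ksub[OF q homog_G A v']] by (auto simp: shift_def)
  qed
  then have "rlen (fspan q 0 G A (map snd L) m) (fspan q 0 G A (map snd (t # L)) m)
      = shift_seq (fst (snd t)) (hilb (fst t)) m"
    using fspan_rlen_Cons[OF q homog_G A v, of m] by (simp add: rlen_shift)
  moreover have "rlen (A (q * m)) (fspan q 0 G A (map snd (t # L)) m) =
      rlen (A (q * m)) (fspan q 0 G A (map snd L) m) +
      rlen (fspan q 0 G A (map snd L) m) (fspan q 0 G A (map snd (t # L)) m)"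
  proof (rule rlen_additive)
    show "finite_len (fspan q 0 G A (map snd (t # L)) m)" using fspan_finite_len[OF q homog_G A v] by simp
    show "ksub (A (q * m))" by (rule homog_ksub[OF A])
    show "ksub (fspan q 0 G A (map snd L) m)" by (rule fspan_ksub[OF q homog_G A v'])
    show "A (q * m) \<subseteq> fspan q 0 G A (map snd L) m" using fspan_base[OF q homog_G A v', of m] by simp
    show "fspan q 0 G A (map snd L) m \<subseteq> fspan q 0 G A (map snd (t # L)) m"
      using fspan_Cons_sub[OF q homog_G A v, of m] by simp
  qed
  ultimately show ?case using Cons by simp
qed

text \<open>For \<open>x\<close> in \<open>A\<close> the power \<open>x [^] q\<close> is again in
  \<open>A\<close>, as \<open>q > 0\<close>, so \<open>x\<close> annihilates every class in the
  twisted quotient.\<close>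

lemma prime_filt_prime_ge:
  assumes q: "frob q" and A: "homog A" and "prime_filt q A L" and "t \<in> set L"
  shows "hprime (fst t) \<and> A \<le> fst t"
  using assms(3,4)
proof (induction L)
  case (Cons s L)
  show ?case
  proof (cases "t = s")
    case True
    have v: "valid q 0 (map snd L)" using prime_filt_valid Cons.prems by auto
    have "x \<in> fst t i" if x: "x \<in> A i" for x i
    proof -
      obtain k where k: "q = Suc k" using frob_pos[OF q] by (cases q) auto
      have xG: "x \<in> G i" using x homog_mem[OF A] by blast
      have "x [^] k \<otimes> x \<in> A (k * i + i)" by (rule homog_mult[OF A G_pow[OF xG] x])
      then have "x [^] q \<in> A (q * i)" using k by (simp add: add.commute)
      then have "x [^] q \<otimes> snd (snd s) \<in> A (q * i + q * fst (snd s))"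
        using homog_mult2[OF A] Cons.prems by simp
      then have "x [^] q \<otimes> snd (snd s) \<in> fspan q 0 G A (map snd L) (i + fst (snd s))"
        using fspan_base[OF q homog_G A v, of "i + fst (snd s)"] by (auto simp: algebra_simps)
      then show ?thesis using Cons.prems xG True by auto
    qed
    then show ?thesis using Cons.prems True by (auto simp: le_fun_def)
  next
    case False
    then show ?thesis using Cons by auto
  qed
qed simp

section \<open>Finite generation over the q-th powers\<close>

lemma hprime_irrelevant: assumes P: "hprime P" and "G 1 \<subseteq> P 1" shows "m \<ge> 1 \<Longrightarrow> hilb P m = 0"
proof -
  assume "m \<ge> 1"
  then obtain k where m: "m = Suc k" by (cases m) auto
  have "G (Suc k) \<subseteq> P (Suc k)"
    by (rule ksub_span_G1[OF homog_ksub[OF hprime_homog[OF P]]])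
      (use homog_mult2[OF hprime_homog[OF P], of _ k _ 1] assms(2) in auto)
  then have "P m = G m" using homog_sub[OF hprime_homog[OF P]] m by blast
  then show ?thesis by (simp add: hilb_def)
qed

text \<open>The part of degree \<open>m\<close> of the ideal generated by the \<open>q\<close>-th
  powers of linear forms.\<close>

definition power_span :: "nat \<Rightarrow> nat \<Rightarrow> 'a set" where
  "power_span q m = \<Inter>{V. ksub V \<and> (\<forall>x\<in>G 1. \<forall>y\<in>shift q G m. x [^] q \<otimes> y \<in> V)}"

lemma power_span_least:
  "ksub V \<Longrightarrow> (\<And>x y. x \<in> G 1 \<Longrightarrow> y \<in> shift q G m \<Longrightarrow> x [^] q \<otimes> y \<in> V) \<Longrightarrow> power_span q m \<subseteq> V"
  unfolding power_span_def by blast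

lemma power_span_mem: "x \<in> G 1 \<Longrightarrow> y \<in> shift q G m \<Longrightarrow> x [^] q \<otimes> y \<in> power_span q m"
  unfolding power_span_def by blast

lemma homog_power_span: "homog (power_span q)"
proof -
  have sub: "power_span q m \<subseteq> G m" for m
  proof (rule power_span_least[OF ksub_G])
    fix x y assume x: "x \<in> G 1" and y: "y \<in> shift q G m"
    show "x [^] q \<otimes> y \<in> G m"
    proof (cases "q \<le> m")
      case True
      then have "y \<in> G (m - q)" using y by (simp add: shift_def)
      from G_mult[OF G_pow[OF x, of q] this] show ?thesis using True by simp
    next
      case False
      then show ?thesis using x y G_carrier by (simp add: shift_def)
    qed
  qed
  have k: "ksub (power_span q m)" for m
  proof -
    have "x [^] q \<otimes> y \<in> carrier R" if "x \<in> G 1" "y \<in> shift q G m" for x y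
      using that G_carrier shift_carrier[OF homog_G] by (meson m_closed nat_pow_closed subsetD)
    then have "carrier R \<in> {V. ksub V \<and> (\<forall>x\<in>G 1. \<forall>y\<in>shift q G m. x [^] q \<otimes> y \<in> V)}"
      using ksub_carrier_set by blast
    then show ?thesis unfolding power_span_def by (intro ksub_Inter) auto
  qed
  show ?thesis unfolding homog_def
  proof (intro conjI allI ballI k sub)
    fix i j a x assume a: "a \<in> G i" and x: "x \<in> power_span q j"
    note ac = G_carrier[OF a]
    have sl: "semilinear (G j) (\<lambda>c. a \<otimes> c)"
      unfolding semilinear_def using ac
      by (auto simp: G_carrier r_distr intro!: bexI m_lcomm)
    have "power_span q j \<subseteq> {c \<in> G j. a \<otimes> c \<in> power_span q (i + j)}"
    proof (rule power_span_least)
      show "ksub {c \<in> G j. a \<otimes> c \<in> power_span q (i + j)}" by (rule ksub_preimage[OF sl ksub_G k])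
      fix x y assume x: "x \<in> G 1" and y: "y \<in> shift q G j"
      have "x [^] q \<otimes> y \<in> G j" using power_span_mem[OF x y] sub by blast
      moreover have "a \<otimes> (x [^] q \<otimes> y) = x [^] q \<otimes> (a \<otimes> y)"
        using ac G_carrier[OF x] shift_carrier[OF homog_G] y by (auto intro!: m_lcomm)
      moreover have "x [^] q \<otimes> (a \<otimes> y) \<in> power_span q (i + j)"
        by (rule power_span_mem[OF x shift_mult[OF homog_G a y]])
      ultimately show "x [^] q \<otimes> y \<in> {c \<in> G j. a \<otimes> c \<in> power_span q (i + j)}" by simp
    qed
    then show "a \<otimes> x \<in> power_span q (i + j)" using x by blast
  qed
qed

text \<open>A prime containing the \<open>q\<close>-th powers of all linear forms contains the
  linear forms, so its Hilbert function vanishes in positive degrees. A filtration modulo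
  \<open>power_span q\<close> involves only such primes and is finite.\<close>

lemma power_span_eventually: obtains m0 where "\<And>m. m \<ge> m0 \<Longrightarrow> power_span q m = G m"
proof -
  obtain L where L: "prime_filt 1 (power_span q) L" "fspan 1 0 G (power_span q) (map snd L) = G"
    using prime_filt_exists_1[OF homog_power_span] by blast
  have eq: "hilb (power_span q) m = (\<Sum>t\<leftarrow>L. shift_seq (fst (snd t)) (hilb (fst t)) m)" for m
    using prime_filt_rlen[OF frob_1 homog_power_span L(1), of m] L(2) by (simp add: hilb_def)
  have "growth 0 (hilb (fst t))" if "t \<in> set L" for t
  proof -
    have P: "hprime (fst t)" "power_span q \<le> fst t" using prime_filt_prime_ge[OF frob_1 homog_power_span L(1) that] by auto
    have "G 1 \<subseteq> fst t 1"
    proof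
      fix x assume x: "x \<in> G 1"
      have "x [^] q \<otimes> \<one> \<in> power_span q q" by (rule power_span_mem[OF x]) (simp add: shift_def one_G0)
      then have "x [^] q \<in> fst t (q * 1)" using P(2) G_carrier[OF x] by (auto simp: le_fun_def)
      then show "x \<in> fst t 1" by (rule hprime_pow[OF P(1) x])
    qed
    then show ?thesis using hprime_irrelevant[OF P(1)] unfolding growth_def by auto
  qed
  then have "growth 0 (hilb (power_span q))" unfolding eq by (intro growth_sum_list growth_shift_seq) auto
  then obtain C where "\<And>m. m \<ge> C \<Longrightarrow> hilb (power_span q) m = 0" by (auto simp: growth_def)
  then show thesis using that hilb_zero_imp[OF homog_power_span] by blast
qed

text \<open>Each round adjoins an element missing in degree \<open>m\<close>, which lowers the
  finite colength there.\<close>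

lemma prime_filt_fill:
  assumes q: "frob q" and A: "homog A"
  shows "prime_filt q A L \<Longrightarrow> \<exists>L'. prime_filt q A (L' @ L) \<and> fspan q 0 G A (map snd (L' @ L)) m = G (q * m)"
proof (induction "the_enat (len (fspan q 0 G A (map snd L) m) (G (q * m)))" arbitrary: L rule: less_induct)
  case less
  let ?N = "\<lambda>L. fspan q 0 G A (map snd L) m"
  show ?case
  proof (cases "?N L = G (q * m)")
    case True
    then show ?thesis using less.prems by (intro exI[of _ "[]"]) simp
  next
    case False
    have v: "valid q 0 (map snd L)" by (rule prime_filt_valid[OF less.prems])
    have "?N L \<subseteq> G (q * m)" using fspan_sub[OF q homog_G A v, of m] by simp
    then obtain b where b: "b \<in> G (q * m)" "b \<notin> ?N L" using False by blast
    obtain L1 where L1: "prime_filt q A (L1 @ L)" "b \<in> ?N (L1 @ L)"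
      using prime_filt_adjoin[OF q A less.prems b(1)] by blast
    have v1: "valid q 0 (map snd L1 @ map snd L)" using prime_filt_valid[OF L1(1)] by simp
    have k1: "ksub (?N (L1 @ L))" "?N (L1 @ L) \<subseteq> G (q * m)"
      using fspan_ksub[OF q homog_G A v1] fspan_sub[OF q homog_G A v1, of m] by simp_all
    have ss: "?N L \<subset> ?N (L1 @ L)"
      using fspan_append_sub[OF q homog_G A v1, of m] b(2) L1(2) by auto
    have "rlen (?N L) (G (q * m)) = rlen (?N L) (?N (L1 @ L)) + rlen (?N (L1 @ L)) (G (q * m))"
      by (rule rlen_additive[OF finite_len_G fspan_ksub[OF q homog_G A v] k1(1) _ k1(2)]) (use ss in auto)
    moreover have "rlen (?N L) (?N (L1 @ L)) \<ge> 1"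
      by (rule rlen_ge_1[OF finite_len_subset[OF finite_len_G k1] fspan_ksub[OF q homog_G A v] ss])
    ultimately have "the_enat (len (?N (L1 @ L)) (G (q * m))) < the_enat (len (?N L) (G (q * m)))"
      unfolding rlen_def by linarith
    from less.hyps[OF this L1(1)] obtain L2 where "prime_filt q A (L2 @ L1 @ L)" "?N (L2 @ L1 @ L) = G (q * m)"
      by blast
    then show ?thesis by (intro exI[of _ "L2 @ L1"]) simp
  qed
qed

text \<open>Only finitely many degrees have to be filled by hand. Beyond \<open>m0\<close> every
  element of \<open>G (q * Suc m)\<close> is a sum of products \<open>x [^] q\<close> times an
  element of \<open>G (q * m)\<close>, and the span is stable under such products.\<close>

lemma prime_filt_exists:
  assumes q: "frob q" and A: "homog A"
  obtains L where "prime_filt q A L" "\<And>m. fspan q 0 G A (map snd L) m = G (q * m)"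
proof -
  obtain m0 where m0: "\<And>m. m \<ge> m0 \<Longrightarrow> power_span q m = G m" using power_span_eventually by blast
  have "\<exists>L. prime_filt q A L \<and> (\<forall>m<k. fspan q 0 G A (map snd L) m = G (q * m))" for k
  proof (induction k)
    case 0
    show ?case by (rule exI[of _ "[]"]) simp
  next
    case (Suc k)
    then obtain L where L: "prime_filt q A L" "\<And>m. m < k \<Longrightarrow> fspan q 0 G A (map snd L) m = G (q * m)" by blast
    obtain L' where L': "prime_filt q A (L' @ L)" "fspan q 0 G A (map snd (L' @ L)) k = G (q * k)"
      using prime_filt_fill[OF q A L(1)] by blast
    have v: "valid q 0 (map snd L' @ map snd L)" using prime_filt_valid[OF L'(1)] by simp
    have "fspan q 0 G A (map snd (L' @ L)) m = G (q * m)" if "m < k" for m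
      using fspan_append_sub[OF q homog_G A v, of m] fspan_sub[OF q homog_G A v, of m] L(2)[OF that] by auto
    then show ?case using L' by (metis less_SucE)
  qed
  then obtain L where L: "prime_filt q A L" "\<And>m. m < Suc m0 \<Longrightarrow> fspan q 0 G A (map snd L) m = G (q * m)" by blast
  have v: "valid q 0 (map snd L)" by (rule prime_filt_valid[OF L(1)])
  have sub: "fspan q 0 G A (map snd L) m \<subseteq> G (q * m)" for m using fspan_sub[OF q homog_G A v, of m] by simp
  have "G (q * m) \<subseteq> fspan q 0 G A (map snd L) m" for m
  proof (induction m)
    case 0
    then show ?case using L(2)[of 0] by simp
  next
    case (Suc m)
    show ?case
    proof (cases "Suc m < Suc m0")
      case True
      then show ?thesis using L(2)[of "Suc m"] by simp
    next
      case False
      have "m0 \<le> q * Suc m" using False frob_pos[OF q] by (cases q) auto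
      then have "G (q * Suc m) = power_span q (q * Suc m)" using m0 by blast
      also have "\<dots> \<subseteq> fspan q 0 G A (map snd L) (Suc m)"
      proof (rule power_span_least[OF fspan_ksub[OF q homog_G A v]])
        fix x y assume x: "x \<in> G 1" and "y \<in> shift q G (q * Suc m)"
        then have "y \<in> fspan q 0 G A (map snd L) m" using Suc by (auto simp: shift_def)
        from fspan_mult[OF q homog_G A v x this] show "x [^] q \<otimes> y \<in> fspan q 0 G A (map snd L) (Suc m)" by simp
      qed
      finally show ?thesis .
    qed
  qed
  then show thesis using that[of L] L(1) sub by blast
qed

end

section \<open>Krull dimension and growth of the Hilbert function\<close>

lemma growth_mono: "d \<le> e \<Longrightarrow> growth d u \<Longrightarrow> growth e u"
  by (induction e rule: dec_induct) (auto dest: growth_Suc)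

lemma eventually_poly_diff_shift_seq:
  assumes "eventually_poly (Suc d) u" shows "eventually_poly d (\<lambda>m. u m - shift_seq a u m)"
proof (rule eventually_poly_unshift[where a = a])
  show "eventually_poly d (\<lambda>m. u (m + a) - shift_seq a u (m + a))"
    using eventually_poly_diff_shift[OF assms, of a] by (simp add: shift_seq_def)
qed

text \<open>Iterating the step \<open>k\<close> times bounds \<open>k * h' m\<close> by
  \<open>h (m + k * c)\<close>. Letting \<open>k\<close> grow with \<open>m\<close> divides the
  order of growth by one power of \<open>m\<close>; a bounded \<open>h\<close> is impossible because
  \<open>h'\<close> is at least 1.\<close>

lemma growth_of_differences:
  fixes h h' :: "nat \<Rightarrow> real"
  assumes g: "growth (Suc s) h" and h: "\<And>m. h m \<ge> 0" and h': "\<And>m. h' m \<ge> 1"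
    and mono: "\<And>m k. h' m \<le> h' (m + k)" and step: "\<And>m. h' (m + c) + h m \<le> h (m + c)"
  shows "s \<noteq> 0 \<and> growth s h'"
proof -
  have k: "real k * h' m \<le> h (m + k * c)" for k m
  proof (induction k)
    case 0
    show ?case using h by simp
  next
    case (Suc k)
    have "real (Suc k) * h' m = h' m + real k * h' m" by (simp add: algebra_simps)
    also have "\<dots> \<le> h' (m + (k * c + c)) + h (m + k * c)" by (intro add_mono mono Suc)
    also have "\<dots> \<le> h (m + k * c + c)" using step[of "m + k * c"] by (simp add: add.assoc)
    finally show ?case by (simp add: algebra_simps)
  qed
  obtain C :: nat where C: "\<And>m. \<bar>h m\<bar> \<le> real C * (real m + 1) ^ s"
    using g unfolding growth_def by auto
  \<comment> \<open>The choice \<open>k = m + 1\<close> keeps the argument \<open>m + k * c\<close>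
    linear in \<open>m\<close>, so the bound on \<open>h\<close> still has degree
    \<open>s\<close>.\<close>
  have main: "(real m + 1) * h' m \<le> real C * (real c + 1) ^ s * (real m + 1) ^ s" for m
  proof -
    have "(real m + 1) * h' m \<le> h (m + Suc m * c)" using k[of "Suc m" m] by (simp add: algebra_simps)
    also have "\<dots> \<le> real C * (real (m + Suc m * c) + 1) ^ s" using C[of "m + Suc m * c"] by simp
    also have "real (m + Suc m * c) + 1 = (real c + 1) * (real m + 1)" by (simp add: algebra_simps)
    finally show ?thesis by (simp add: power_mult_distrib mult.assoc)
  qed
  have "s \<noteq> 0"
  proof
    assume "s = 0"
    then have "(real C + 1) * h' C \<le> real C" using main[of C] by simp
    moreover have "(real C + 1) * 1 \<le> (real C + 1) * h' C" by (intro mult_left_mono h') simp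
    ultimately show False unfolding mult_1_right by linarith
  qed
  moreover have "\<bar>h' m\<bar> \<le> real (C * (c + 1) ^ s) * (real m + 1) ^ (s - 1)" for m
  proof -
    have "(real m + 1) * h' m \<le> (real m + 1) * (real C * (real c + 1) ^ s * (real m + 1) ^ (s - 1))"
      using main[of m] \<open>s \<noteq> 0\<close> by (cases s) (auto simp: mult_ac)
    then have "h' m \<le> real C * (real c + 1) ^ s * (real m + 1) ^ (s - 1)"
      by (rule mult_left_le_imp_le) simp
    moreover have "0 \<le> h' m" using h'[of m] by simp
    ultimately show ?thesis by (simp add: add.commute)
  qed
  ultimately show ?thesis unfolding growth_def by (metis (no_types, lifting))
qed

context graded_algebra
begin

text \<open>Since \<open>x\<close> is a nonzerodivisor modulo the prime, its multiples form a copy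
  of the quotient by \<open>P\<close> shifted by \<open>a\<close>.\<close>

lemma hilb_adjoin:
  assumes P: "hprime P" and x: "x \<in> G a" "x \<notin> P a"
  shows "hilb (fspan 1 0 G P [(a, x)]) m = hilb P m - shift_seq a (hilb P) m"
proof -
  note h = hprime_homog[OF P]
  have v: "valid 1 0 [(a, x)]" using x by simp
  note hB = homog_fspan[OF h v]
  have "{c \<in> shift a G m. c [^] (1::nat) \<otimes> x \<in> P m} = shift a P m"
  proof (cases "a \<le> m")
    case True
    have "c \<otimes> x \<in> P m \<longleftrightarrow> c \<in> P (m - a)" if "c \<in> G (m - a)" for c
      using hprime_mult[OF P that x(1)] homog_mult2[OF h x(1), of c "m - a"] x(2) True by auto
    then show ?thesis using True homog_mem[OF h, of _ "m - a"] G_carrier[of _ "m - a"] by (auto simp: shift_def)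
  next
    case False
    then show ?thesis using h G_carrier[OF x(1)] by (auto simp: shift_def)
  qed
  then have "rlen (P m) (fspan 1 0 G P [(a, x)] m) = shift_seq a (hilb P) m"
    using fspan_rlen_Cons[OF frob_1 homog_G h v, of m] by (simp add: rlen_shift)
  moreover have "rlen (P m) (G m) = rlen (P m) (fspan 1 0 G P [(a, x)] m) + rlen (fspan 1 0 G P [(a, x)] m) (G m)"
    by (rule rlen_additive[OF finite_len_G homog_ksub[OF h] homog_ksub[OF hB] _ homog_sub[OF hB]])
      (use fspan_base1[OF h v] in \<open>auto simp: le_fun_def\<close>)
  ultimately show ?thesis by (simp add: hilb_def)
qed

text \<open>One number \<open>D\<close> bounds the dimension from below, through the chain, and the
  order of the Hilbert function of its first prime from above. Keeping both in one notion makes the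
  two bounds meet.\<close>

definition dim_chain :: "nat \<Rightarrow> (nat \<Rightarrow> nat \<Rightarrow> 'a set) \<Rightarrow> bool" where
  "dim_chain D N \<longleftrightarrow> eventually_poly D (hilb (N 0)) \<and> (\<forall>i\<le>D. hprime (N i)) \<and> (\<forall>i<D. N i < N (Suc i))"

text \<open>A filtration writes \<open>hilb A\<close> as a sum of shifted Hilbert functions of
  primes over \<open>A\<close>. The prime with the largest \<open>D\<close> bounds the order of the
  sum, and its chain starts above \<open>A\<close>. The chains of the primes are an assumption so
  that this can be used within Noetherian induction.\<close>

lemma exists_chain_filtration:
  assumes A: "homog A" and one: "\<one> \<notin> A 0"
    and IH: "\<And>P. hprime P \<Longrightarrow> A \<le> P \<Longrightarrow> \<exists>D N. N 0 = P \<and> dim_chain D N"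
  obtains D N where "A \<le> N 0" "dim_chain D N" "eventually_poly D (hilb A)"
proof -
  obtain L where L: "prime_filt 1 A L" "fspan 1 0 G A (map snd L) = G"
    using prime_filt_exists_1[OF A] by blast
  have eq: "hilb A m = (\<Sum>t\<leftarrow>L. shift_seq (fst (snd t)) (hilb (fst t)) m)" for m
    using prime_filt_rlen[OF frob_1 A L(1), of m] L(2) by (simp add: hilb_def)
  have ne: "set L \<noteq> {}" using fun_cong[OF L(2), of 0] one one_G0 by (cases L) auto
  have "\<forall>t\<in>set L. \<exists>D N. N 0 = fst t \<and> dim_chain D N"
    using IH prime_filt_prime_ge[OF frob_1 A L(1)] by blast
  then obtain D N where DN: "\<And>t. t \<in> set L \<Longrightarrow> N t 0 = fst t" "\<And>t. t \<in> set L \<Longrightarrow> dim_chain (D t) (N t)"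
    by metis
  obtain t where t: "t \<in> set L" "D t = Max (D ` set L)"
    using Max_in[of "D ` set L"] ne by (metis (no_types, lifting) List.finite_set finite_imageI imageE image_is_empty)
  have "eventually_poly (D t) (hilb A)" unfolding eq[abs_def]
  proof (intro eventually_poly_sum_list eventually_poly_shift_seq)
    fix u assume u: "u \<in> set L"
    then have "D u \<le> D t" using t(2) by simp
    moreover have "eventually_poly (D u) (hilb (fst u))"
      using DN[OF u] by (simp add: dim_chain_def)
    ultimately show "eventually_poly (D t) (hilb (fst u))" by (rule eventually_poly_mono)
  qed
  moreover have "A \<le> N t 0" using DN(1) t(1) prime_filt_prime_ge[OF frob_1 A L(1)] by auto
  ultimately show thesis using that DN(2)[OF t(1)] by blast
qed

text \<open>For a linear form \<open>x\<close> outside \<open>P\<close>, the difference of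
  \<open>hilb P\<close> is the Hilbert function of \<open>P\<close> enlarged by \<open>x\<close>. A
  chain above the latter, preceded by \<open>P\<close>, is one longer, and summation raises the
  order by one.\<close>

lemma hprime_dim_chain: "hprime P \<Longrightarrow> \<exists>D N. N 0 = P \<and> dim_chain D N"
proof (induction P rule: wf_induct_rule[OF wf_homog])
  case (1 P)
  note h = hprime_homog[OF 1(2)]
  show ?case
  proof (cases "G 1 \<subseteq> P 1")
    case True
    have "eventually_poly 0 (hilb P)" using hprime_irrelevant[OF 1(2) True] by auto
    then show ?thesis using 1(2) by (intro exI[of _ 0] exI[of _ "\<lambda>i. P"]) (simp add: dim_chain_def)
  next
    case False
    then obtain x where x: "x \<in> G 1" "x \<notin> P 1" by blast
    let ?A = "fspan 1 0 G P [(1, x)]"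
    have v: "valid 1 0 [(1, x)]" using x by simp
    have hA: "homog ?A" by (rule homog_fspan[OF h v])
    have PA: "P \<le> ?A" by (rule fspan_base1[OF h v])
    have xA: "x \<in> ?A 1" using fspan_mem1[OF h v, of "(1, x)"] by simp
    \<comment> \<open>A generator of degree 1 contributes nothing in degree 0, so the enlarged ideal
      is still proper.\<close>
    have "?A 0 = P 0"
      using homog_zero[OF h, of 0] homog_carrier[OF h, of _ 0] G_carrier[OF x(1)]
      by (auto simp: shift_def mem_set_add pow_zero)
    then have one: "\<one> \<notin> ?A 0" using hprime_one[OF 1(2)] by simp
    have IH: "\<exists>D N. N 0 = Q \<and> dim_chain D N" if Q: "hprime Q" "?A \<le> Q" for Q
    proof -
      have "P \<le> Q" using PA Q(2) by (rule order_trans)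
      moreover have "x \<in> Q 1" using xA Q(2) by (auto simp: le_fun_def)
      ultimately have "P < Q" using x(2) by (auto simp: less_le_not_le le_fun_def)
      then show ?thesis using 1(1)[of Q] Q(1) h hprime_homog[OF Q(1)] by blast
    qed
    obtain D N where DN: "?A \<le> N 0" "dim_chain D N" "eventually_poly D (hilb ?A)"
      using exists_chain_filtration[OF hA one IH] by blast
    have "hilb ?A (Suc m) = hilb P (Suc m) - hilb P m" for m
      using hilb_adjoin[OF 1(2) x, of "Suc m"] by (simp add: shift_seq_def)
    then have ep: "eventually_poly (Suc D) (hilb P)" using eventually_poly_shift[OF DN(3), of 1] by simp
    have "P \<le> N 0" using PA DN(1) by (rule order_trans)
    moreover have "x \<in> N 0 1" using xA DN(1) by (auto simp: le_fun_def)
    ultimately have PN: "P < N 0" using x(2) by (auto simp: less_le_not_le le_fun_def)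
    define N' where "N' i = (case i of 0 \<Rightarrow> P | Suc j \<Rightarrow> N j)" for i
    have "dim_chain (Suc D) N'"
      unfolding dim_chain_def
    proof (intro conjI allI impI)
      show "eventually_poly (Suc D) (hilb (N' 0))" using ep by (simp only: N'_def nat.case)
      show "hprime (N' i)" if "i \<le> Suc D" for i
        using that 1(2) DN(2) by (cases i) (auto simp: N'_def dim_chain_def)
      show "N' i < N' (Suc i)" if "i < Suc D" for i
        using that PN DN(2) by (cases i) (auto simp: N'_def dim_chain_def)
    qed
    moreover have "N' 0 = P" by (simp add: N'_def)
    ultimately show ?thesis by blast
  qed
qed

abbreviation Z :: "nat \<Rightarrow> 'a set" where "Z \<equiv> \<lambda>m. {\<zero>}"

lemma homog_Z: "homog Z" by (rule homog_zero_family)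

lemma Z_le: "homog A \<Longrightarrow> Z \<le> A"
  by (auto simp: le_fun_def)

lemma krull_dim_ge:
  assumes "dim_chain D N" shows "enat D \<le> krull_dim R"
proof -
  have "enat D \<le> chain_length {I. primeideal I R}"
  proof (rule chain_length_geI)
    show "\<forall>i\<le>D. to_ideal (N i) \<in> {I. primeideal I R}"
      using assms primeideal_to_ideal by (auto simp: dim_chain_def)
    show "\<forall>i<D. to_ideal (N i) \<subset> to_ideal (N (Suc i))"
      using assms to_ideal_strict_mono[OF hprime_homog hprime_homog] by (auto simp: dim_chain_def)
  qed
  then show ?thesis by (simp add: krull_dim_def chain_length_def)
qed

section \<open>Filtration by degree and chains of arbitrary primes\<close>

definition deg_le :: "nat \<Rightarrow> 'a set" where
  "deg_le m = {x \<in> carrier R. \<forall>k>m. component x k = \<zero>}"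

lemma component_smult: assumes "c \<in> G 0" "x \<in> carrier R" shows "component (c \<otimes> x) n = c \<otimes> component x n"
proof -
  have "component (c \<otimes> x) n = (\<Oplus>k\<in>{..n}. if 0 = k then c \<otimes> component x (n - k) else \<zero>)"
    unfolding component_mult[OF G_carrier[OF assms(1)] assms(2)]
    by (rule finsum_cong') (use component_homogeneous[OF assms(1)] component_carrier[OF assms(2)] G_carrier[OF assms(1)] in auto)
  also have "\<dots> = c \<otimes> component x (n - 0)"
    by (rule add.finprod_singleton) (use component_carrier[OF assms(2)] G_carrier[OF assms(1)] in auto)
  finally show ?thesis by simp
qed

lemma ksub_deg_le: "ksub (deg_le m)"
  by (rule ksubI) (auto simp: deg_le_def component_zero component_add component_smult G_carrier)

lemma deg_le_mono: "m \<le> n \<Longrightarrow> deg_le m \<subseteq> deg_le n"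
  by (auto simp: deg_le_def)

lemma deg_le_mult:
  assumes "x \<in> deg_le m" "y \<in> deg_le n" shows "x \<otimes> y \<in> deg_le (m + n)"
proof -
  have c: "x \<in> carrier R" "y \<in> carrier R" using assms by (auto simp: deg_le_def)
  have "component (x \<otimes> y) k = \<zero>" if "k > m + n" for k
  proof -
    have "component x i \<otimes> component y (k - i) = \<zero>" if "i \<le> k" for i
    proof (cases "i > m")
      case True
      then show ?thesis using assms c by (simp add: deg_le_def component_carrier)
    next
      case False
      then have "k - i > n" using \<open>k > m + n\<close> by simp
      then show ?thesis using assms c by (simp add: deg_le_def component_carrier)
    qed
    then show ?thesis unfolding component_mult[OF c] by (intro add.finprod_one_eqI) auto
  qed
  then show ?thesis using c by (simp add: deg_le_def)
qed

lemma deg_le_exists: assumes "x \<in> carrier R" obtains c where "x \<in> deg_le c"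
proof -
  obtain c where "\<forall>k\<in>{n. component x n \<noteq> \<zero>}. k \<le> c"
    using finite_component[OF assms] finite_nat_set_iff_bounded_le by blast
  then have "x \<in> deg_le c" using assms by (force simp: deg_le_def)
  then show thesis by (rule that)
qed

lemma one_deg_le: "\<one> \<in> deg_le m"
  using component_homogeneous[OF one_G0] by (auto simp: deg_le_def)

text \<open>Taking the component of degree \<open>Suc m\<close> has kernel \<open>deg_le m\<close>,
  so each degree adds at most the length of one component.\<close>

lemma deg_le_len: "finite_len (deg_le m) \<and> rlen {\<zero>} (deg_le m) \<le> (\<Sum>k<Suc m. hilb Z k)"
proof (induction m)
  case 0
  have "deg_le 0 \<subseteq> G 0"
  proof
    fix x assume x: "x \<in> deg_le 0"
    then have c: "x \<in> carrier R" by (simp add: deg_le_def)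
    have "{n. component x n \<noteq> \<zero>} \<subseteq> {0}" using x by (auto simp: deg_le_def)
    then have "finsum R (component x) {n. component x n \<noteq> \<zero>} = finsum R (component x) {0}"
      by (intro add.finprod_mono_neutral_cong_left) (auto simp: component_carrier c)
    then have "x = component x 0" using finsum_component[OF c] component_carrier[OF c] by simp
    then show "x \<in> G 0" using component_mem[OF c, of 0] by simp
  qed
  then have "finite_len (deg_le 0)" "rlen {\<zero>} (deg_le 0) \<le> rlen {\<zero>} (G 0)"
    using finite_len_subset[OF finite_len_G ksub_deg_le] rlen_mono[OF finite_len_G ksub_zero_set] by auto
  then show ?case by (simp add: hilb_def)
next
  case (Suc m)
  have sl: "semilinear (deg_le (Suc m)) (\<lambda>x. component x (Suc m))"
    unfolding semilinear_def by (auto simp: deg_le_def component_carrier component_add component_smult G_carrier)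
  have eq: "{x \<in> deg_le (Suc m). component x (Suc m) \<in> {\<zero>}} = deg_le m"
    by (auto simp: deg_le_def) (metis Suc_lessI)
  have im: "{\<zero>} <+>\<^bsub>R\<^esub> (\<lambda>x. component x (Suc m)) ` deg_le (Suc m) \<subseteq> G (Suc m)"
    by (rule set_add_least[OF ksub_G]) (auto simp: deg_le_def component_mem)
  have l: "len (deg_le m) (deg_le (Suc m)) \<le> len {\<zero>} (G (Suc m))"
    using len_semilinear[OF sl ksub_deg_le ksub_zero_set] len_mono[OF subset_refl im] unfolding eq by simp
  have add: "len {\<zero>} (deg_le (Suc m)) = len {\<zero>} (deg_le m) + len (deg_le m) (deg_le (Suc m))"
    by (rule len_additive[OF ksub_zero_set ksub_deg_le ksub_deg_le]) (use ksub_zero[OF ksub_deg_le] deg_le_mono[of m "Suc m"] in auto)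
  have "len {\<zero>} (deg_le m) < \<infinity>" using Suc by (simp add: finite_len_def)
  moreover have "len (deg_le m) (deg_le (Suc m)) < \<infinity>"
    using l finite_len_G[of "Suc m"] le_less_trans by (simp only: finite_len_def) blast
  ultimately have fin: "finite_len (deg_le (Suc m))" using add ksub_deg_le by (auto simp: finite_len_def)
  have "rlen {\<zero>} (deg_le (Suc m)) = rlen {\<zero>} (deg_le m) + rlen (deg_le m) (deg_le (Suc m))"
    by (rule rlen_additive[OF fin ksub_zero_set ksub_deg_le]) (use ksub_zero[OF ksub_deg_le] deg_le_mono[of m "Suc m"] in auto)
  also have "rlen (deg_le m) (deg_le (Suc m)) \<le> rlen {\<zero>} (G (Suc m))"
    using rlen_semilinear[OF sl ksub_deg_le ksub_zero_set] rlen_mono[OF finite_len_G ksub_zero_set subset_refl im]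
    unfolding eq by simp
  finally show ?case using Suc fin by (simp add: hilb_def)
qed

text \<open>The affine Hilbert function, which makes sense for every ideal. Accumulating over
  degrees, it may exceed the graded one by one order of growth.\<close>

definition filtered_hilb :: "'a set \<Rightarrow> nat \<Rightarrow> real" where
  "filtered_hilb P m = rlen (P \<inter> deg_le m) (deg_le m)"

lemma filtered_hilb_mono:
  assumes "ideal P R" shows "filtered_hilb P m \<le> filtered_hilb P (m + k)"
proof -
  have sub: "deg_le m \<subseteq> deg_le (m + k)" by (rule deg_le_mono) simp
  have kk: "ksub (P \<inter> deg_le (m + k))" by (rule ksub_Int[OF ksub_ideal[OF assms] ksub_deg_le])
  have "rlen (P \<inter> deg_le m) (deg_le m) = rlen (deg_le m \<inter> (P \<inter> deg_le (m + k))) (deg_le m)"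
    using sub by (intro arg_cong2[of _ _ _ _ rlen]) auto
  also have "\<dots> = rlen (P \<inter> deg_le (m + k)) ((P \<inter> deg_le (m + k)) <+>\<^bsub>R\<^esub> deg_le m)"
    by (rule rlen_second_iso[OF ksub_deg_le kk])
  also have "\<dots> \<le> rlen (P \<inter> deg_le (m + k)) (deg_le (m + k))"
    by (rule rlen_mono[OF _ kk subset_refl set_add_least[OF ksub_deg_le]]) (use deg_le_len sub in auto)
  finally show ?thesis unfolding filtered_hilb_def .
qed

lemma filtered_hilb_ge_1: assumes "ideal P R" "\<one> \<notin> P" shows "1 \<le> filtered_hilb P m"
  unfolding filtered_hilb_def
  by (rule rlen_ge_1) (use deg_le_len ksub_Int[OF ksub_ideal[OF assms(1)] ksub_deg_le] one_deg_le[of m] assms(2) in auto)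

text \<open>Multiplication by \<open>x\<close> embeds \<open>R/P\<close> into \<open>P'/P\<close>, so each step of a chain of primes lowers the
  order of growth. Filtering by degree covers primes that are not homogeneous.\<close>

lemma filtered_hilb_step:
  assumes P: "primeideal P R" and P': "ideal P' R" and x: "x \<in> P'" "x \<notin> P" "x \<in> deg_le c" and sub: "P \<subseteq> P'"
  shows "filtered_hilb P' (m + c) + filtered_hilb P m \<le> filtered_hilb P (m + c)"
proof -
  let ?V = "deg_le (m + c)"
  interpret P: primeideal P R by (rule P)
  have xc: "x \<in> carrier R" using x(3) by (simp add: deg_le_def)
  have k: "ksub (P \<inter> ?V)" "ksub (P' \<inter> ?V)"
    by (intro ksub_Int ksub_ideal P' P.is_ideal ksub_deg_le)+
  have fin: "finite_len ?V" using deg_le_len by blast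
  have "filtered_hilb P (m + c) = rlen (P \<inter> ?V) (P' \<inter> ?V) + rlen (P' \<inter> ?V) ?V"
    unfolding filtered_hilb_def by (rule rlen_additive[OF fin k]) (use sub in auto)
  moreover have "filtered_hilb P m \<le> rlen (P \<inter> ?V) (P' \<inter> ?V)"
  proof -
    have sl: "semilinear (deg_le m) (\<lambda>y. y \<otimes> x)"
      unfolding semilinear_def using xc ksub_carrier[OF ksub_deg_le] by (auto simp: G_carrier l_distr m_assoc)
    have "{y \<in> deg_le m. y \<otimes> x \<in> P \<inter> ?V} = P \<inter> deg_le m"
    proof (intro equalityI subsetI)
      fix y assume y: "y \<in> {y \<in> deg_le m. y \<otimes> x \<in> P \<inter> ?V}"
      then have "y \<in> carrier R" using ksub_carrier[OF ksub_deg_le] by blast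
      then show "y \<in> P \<inter> deg_le m" using y P.I_prime[of y x] x(2) xc by auto
    next
      fix y assume y: "y \<in> P \<inter> deg_le m"
      then show "y \<in> {y \<in> deg_le m. y \<otimes> x \<in> P \<inter> ?V}"
        using P.I_r_closed[of y x] xc deg_le_mult[OF _ x(3), of y m] by auto
    qed
    then have "filtered_hilb P m = rlen (P \<inter> ?V) ((P \<inter> ?V) <+>\<^bsub>R\<^esub> (\<lambda>y. y \<otimes> x) ` deg_le m)"
      using rlen_semilinear[OF sl ksub_deg_le k(1)] by (simp add: filtered_hilb_def)
    also have "\<dots> \<le> rlen (P \<inter> ?V) (P' \<inter> ?V)"
    proof (rule rlen_mono[OF finite_len_subset[OF fin k(2)] k(1) subset_refl set_add_least[OF k(2)]])
      show "(\<lambda>y. y \<otimes> x) ` deg_le m \<subseteq> P' \<inter> ?V"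
        using deg_le_mult[OF _ x(3)] ideal.I_l_closed[OF P' x(1)] ksub_carrier[OF ksub_deg_le] by blast
    qed (use sub in auto)
    finally show ?thesis .
  qed
  ultimately show ?thesis by (simp add: filtered_hilb_def)
qed

text \<open>The affine Hilbert function of the first prime has order at most \<open>Suc s\<close>,
  being bounded by partial sums of \<open>hilb Z\<close>. Each inclusion lowers the order by one,
  and as the functions stay at least 1 this can happen at most \<open>s\<close> times.\<close>

lemma prime_chain_bound:
  assumes g: "growth s (hilb Z)" and N: "\<forall>i\<le>n. primeideal (N i) R" "\<forall>i<n. N i \<subset> N (Suc i)"
  shows "n \<le> s"
proof -
  have id: "ideal (N i) R" and one: "\<one> \<notin> N i" if "i \<le> n" for i
  proof -
    interpret primeideal "N i" R using N(1) that by simp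
    show "ideal (N i) R" by (rule is_ideal)
    show "\<one> \<notin> N i" using I_notcarr one_imp_carrier by blast
  qed
  have "i \<le> n \<Longrightarrow> i \<le> s \<and> growth (Suc (s - i)) (filtered_hilb (N i))" for i
  proof (induction i)
    case 0
    have "growth (Suc s) (\<lambda>m. \<Sum>k<Suc m. hilb Z k)"
      using growth_affine[OF growth_partial_sums[OF g], of 1 1] by simp
    then have "growth (Suc s) (filtered_hilb (N 0))"
    proof (rule growth_le)
      fix m
      have "filtered_hilb (N 0) m \<le> rlen {\<zero>} (deg_le m)" unfolding filtered_hilb_def
        using deg_le_len[of m] ksub_zero[OF ksub_Int[OF ksub_ideal[OF id[of 0]] ksub_deg_le], of m]
        by (intro rlen_mono ksub_zero_set) auto
      also have "\<dots> \<le> (\<Sum>k<Suc m. hilb Z k)" using deg_le_len by blast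
      finally show "\<bar>filtered_hilb (N 0) m\<bar> \<le> \<bar>\<Sum>k<Suc m. hilb Z k\<bar>" by (simp add: filtered_hilb_def)
    qed
    then show ?case by simp
  next
    case (Suc i)
    then have i: "i \<le> s" "growth (Suc (s - i)) (filtered_hilb (N i))" by auto
    have ss: "N i \<subset> N (Suc i)" using N(2) Suc.prems by simp
    then obtain x where x: "x \<in> N (Suc i)" "x \<notin> N i" by blast
    then have "x \<in> carrier R" using ksub_carrier[OF ksub_ideal[OF id[OF Suc.prems]]] by blast
    then obtain c where c: "x \<in> deg_le c" using deg_le_exists by blast
    have pi: "primeideal (N i) R" using N(1) Suc.prems by simp
    have "s - i \<noteq> 0 \<and> growth (s - i) (filtered_hilb (N (Suc i)))"
    proof (rule growth_of_differences[OF i(2)])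
      show "0 \<le> filtered_hilb (N i) m" for m by (simp add: filtered_hilb_def)
      show "1 \<le> filtered_hilb (N (Suc i)) m" for m by (rule filtered_hilb_ge_1[OF id[OF Suc.prems] one[OF Suc.prems]])
      show "filtered_hilb (N (Suc i)) m \<le> filtered_hilb (N (Suc i)) (m + k)" for m k
        by (rule filtered_hilb_mono[OF id[OF Suc.prems]])
      show "filtered_hilb (N (Suc i)) (m + c) + filtered_hilb (N i) m \<le> filtered_hilb (N i) (m + c)" for m
        by (rule filtered_hilb_step[OF pi id[OF Suc.prems] x c]) (use ss in auto)
    qed
    then show ?case using i(1) by (auto simp: Suc_diff_Suc)
  qed
  then show ?thesis by blast
qed

text \<open>The chain found over the zero ideal bounds the dimension from below, and the growth of
  \<open>hilb Z\<close> bounds it from above by the same number. For a further prime the order is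
  the length of a chain of primes, hence at most the dimension.\<close>

theorem krull_dim_hilb:
  obtains d where "krull_dim R = enat d" "eventually_poly d (hilb Z)"
    "\<And>P. hprime P \<Longrightarrow> eventually_poly d (hilb P)"
proof -
  have one: "\<one> \<notin> Z 0" using one_neq_zero by simp
  obtain D N where DN: "dim_chain D N" "eventually_poly D (hilb Z)"
    using exists_chain_filtration[OF homog_Z one hprime_dim_chain] by blast
  have g: "growth D (hilb Z)" by (rule eventually_poly_growth[OF DN(2)])
  have "krull_dim R \<le> enat D"
    unfolding krull_dim_def using prime_chain_bound[OF g] by (intro SUP_least) auto
  then have kd: "krull_dim R = enat D" using krull_dim_ge[OF DN(1)] by (rule antisym)
  have "eventually_poly D (hilb P)" if P: "hprime P" for P
  proof -
    obtain D' N' where N': "N' 0 = P" "dim_chain D' N'" using hprime_dim_chain[OF P] by blast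
    have "D' \<le> D" using krull_dim_ge[OF N'(2)] kd by simp
    then show ?thesis using eventually_poly_mono N' by (auto simp: dim_chain_def)
  qed
  then show thesis using that kd DN(2) by blast
qed

end

section \<open>Frobenius frames and the comparison estimate\<close>

context graded_algebra
begin

lemma set_add_assoc_ksub:
  assumes "ksub A" "ksub B" "ksub C"
  shows "A <+>\<^bsub>R\<^esub> (B <+>\<^bsub>R\<^esub> C) = (A <+>\<^bsub>R\<^esub> B) <+>\<^bsub>R\<^esub> C"
proof -
  have "x \<oplus> (y \<oplus> z) = (x \<oplus> y) \<oplus> z" if "x \<in> A" "y \<in> B" "z \<in> C" for x y z
    using that assms by (simp add: a_assoc ksub_carrier)
  then show ?thesis by (auto simp: set_add_def')
qed

lemma set_add_zero_right: "ksub A \<Longrightarrow> A <+>\<^bsub>R\<^esub> {\<zero>} = A"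
  by (auto simp: set_add_def' ksub_carrier)

text \<open>A frame presents a submodule of \<open>\<Oplus>\<^sub>m R\<^sub>q\<^sub>m\<^sub>+\<^sub>r\<close>, viewed modulo \<open>A\<close> over \<open>R\<close> via the \<open>q\<close>-th power map,
  as a direct sum of shifted copies of the rings \<open>R/P\<close>.\<close>

primrec frame :: "nat \<Rightarrow> nat \<Rightarrow> (nat \<Rightarrow> 'a set) \<Rightarrow> ((nat \<Rightarrow> 'a set) \<times> nat \<times> 'a) list \<Rightarrow> bool" where
  "frame q r A [] \<longleftrightarrow> True"
| "frame q r A (t # Bs) \<longleftrightarrow> frame q r A Bs \<and> homog (fst t) \<and> snd (snd t) \<in> G (q * fst (snd t) + r) \<and>
     (\<forall>i. \<forall>c\<in>fst t i. c [^] q \<otimes> snd (snd t) \<in> A (q * (i + fst (snd t)) + r)) \<and>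
     (\<forall>i. \<forall>c\<in>G i. c [^] q \<otimes> snd (snd t) \<in> fspan q r G A (map snd Bs) (i + fst (snd t)) \<longrightarrow> c \<in> fst t i)"

lemma frame_valid: "frame q r A Bs \<Longrightarrow> valid q r (map snd Bs)"
  by (induction Bs) auto

lemma fspan_split:
  assumes P: "homog P" and v: "valid 1 0 hs"
  shows "fspan 1 0 G P hs m = P m <+>\<^bsub>R\<^esub> fspan 1 0 G Z hs m"
  using v
proof (induction hs)
  case Nil
  then show ?case using set_add_zero_right[OF homog_ksub[OF P]] by simp
next
  case (Cons t hs)
  then have v: "valid 1 0 hs" and t: "snd t \<in> G (fst t)" by auto
  show ?case unfolding fspan.simps Cons.IH[OF v]
    by (rule set_add_assoc_ksub[symmetric, OF homog_ksub[OF P] homog_ksub[OF homog_fspan[OF homog_Z v]]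
        ksub_frob_image[OF frob_1 homog_G t]])
qed

lemma shift_fspan_split:
  assumes P: "homog P" and v: "valid 1 0 hs"
  shows "shift a (fspan 1 0 G P hs) m = shift a P m <+>\<^bsub>R\<^esub> shift a (fspan 1 0 G Z hs) m"
  using fspan_split[OF P v] set_add_zero_right[OF ksub_zero_set] by (auto simp: shift_def)

text \<open>Reducing a direct sum of copies of the ring modulo \<open>P\<close> by the ideal
  \<open>J\<close> generated by \<open>hs\<close> gives copies of the ring modulo
  \<open>P + J\<close>. In each induction step the full span grows by the ring modulo
  \<open>P\<close>, and the span with coefficients in \<open>J\<close> by \<open>P + J\<close>
  modulo \<open>P\<close>; the difference is the Hilbert function on the right.\<close>

lemma frame_rlen:
  assumes q: "frob q" and A: "homog A" and v: "valid 1 0 hs" and "frame q r A Bs"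
  shows "rlen (fspan q r (fspan 1 0 G Z hs) A (map snd Bs) m) (fspan q r G A (map snd Bs) m)
    = (\<Sum>t\<leftarrow>Bs. shift_seq (fst (snd t)) (hilb (fspan 1 0 G (fst t) hs)) m)"
  using assms(4)
proof (induction Bs)
  case Nil
  then show ?case by simp
next
  case (Cons t Bs)
  define J where "J = fspan 1 0 G Z hs"
  have hJ: "homog J" unfolding J_def by (rule homog_fspan[OF homog_Z v])
  define a where "a = fst (snd t)"
  define b where "b = snd (snd t)"
  define P where "P = fst t"
  have t: "snd t = (a, b)" by (simp add: a_def b_def)
  have fr: "frame q r A Bs" "homog P" "b \<in> G (q * a + r)"
    "\<And>i c. c \<in> P i \<Longrightarrow> c [^] q \<otimes> b \<in> A (q * (i + a) + r)"
    "\<And>i c. c \<in> G i \<Longrightarrow> c [^] q \<otimes> b \<in> fspan q r G A (map snd Bs) (i + a) \<Longrightarrow> c \<in> P i"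
    using Cons.prems by (auto simp: a_def b_def P_def)
  have vB: "valid q r (map snd Bs)" by (rule frame_valid[OF fr(1)])
  have vt: "valid q r ((a, b) # map snd Bs)" using vB fr(3) by simp
  define N where "N = fspan q r G A (map snd Bs) m"
  define M where "M = fspan q r J A (map snd Bs) m"
  define N' where "N' = fspan q r G A ((a, b) # map snd Bs) m"
  define M' where "M' = fspan q r J A ((a, b) # map snd Bs) m"
  have k: "ksub N" "ksub M" "ksub N'" "ksub M'" "finite_len N'" "finite_len N" "finite_len M'"
    unfolding N_def M_def N'_def M'_def
    using fspan_ksub[OF q homog_G A] fspan_ksub[OF q hJ A] fspan_finite_len[OF q homog_G A] fspan_finite_len[OF q hJ A] vB vt
    by blast+
  have sub: "M \<subseteq> N" "M' \<subseteq> N'" "N \<subseteq> N'" "M \<subseteq> M'"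
    unfolding N_def M_def N'_def M'_def
    using fspan_mono[OF homog_le_G[OF hJ] order_refl] fspan_Cons_sub[OF q homog_G A vt] fspan_Cons_sub[OF q hJ A vt] by blast+
  have bc: "b \<in> carrier R" by (rule G_carrier[OF fr(3)])
  \<comment> \<open>The element \<open>b\<close> has the same annihilator \<open>P\<close> modulo
    \<open>N\<close> and modulo the smaller \<open>M\<close>, because \<open>P\<close> already sends
    \<open>b\<close> into \<open>A\<close>. This expresses that the sum is direct.\<close>
  have key: "c [^] q \<otimes> b \<in> M \<and> c [^] q \<otimes> b \<in> N \<longleftrightarrow> c \<in> shift a P m"
    "c [^] q \<otimes> b \<in> N \<longleftrightarrow> c \<in> shift a P m" if "c \<in> shift a G m" for c
  proof -
    have "c [^] q \<otimes> b \<in> M" if c: "c \<in> shift a P m"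
    proof (cases "a \<le> m")
      case True
      then have "c \<in> P (m - a)" using c by (simp add: shift_def)
      from fr(4)[OF this] have "c [^] q \<otimes> b \<in> A (q * m + r)" using True by simp
      then show ?thesis using fspan_base[OF q hJ A vB, of m] by (auto simp: M_def)
    next
      case False
      then show ?thesis using c bc ksub_zero[OF k(2)] pow_zero[OF frob_pos[OF q]] by (simp add: shift_def)
    qed
    moreover have "c \<in> shift a P m" if c: "c [^] q \<otimes> b \<in> N"
    proof (cases "a \<le> m")
      case True
      then have "c \<in> G (m - a)" using \<open>c \<in> shift a G m\<close> by (simp add: shift_def)
      from fr(5)[OF this] show ?thesis using c True by (simp add: shift_def N_def)
    next
      case False
      then show ?thesis using \<open>c \<in> shift a G m\<close> by (simp add: shift_def)
    qed
    ultimately show "c [^] q \<otimes> b \<in> M \<and> c [^] q \<otimes> b \<in> N \<longleftrightarrow> c \<in> shift a P m"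
      "c [^] q \<otimes> b \<in> N \<longleftrightarrow> c \<in> shift a P m" using sub(1) by blast+
  qed
  have "{c \<in> shift a G m. c [^] q \<otimes> b \<in> N} = shift a P m" using key(2) shift_sub[OF fr(2)] by blast
  then have 1: "rlen N N' = rlen (shift a P m) (shift a G m)"
    using fspan_rlen_Cons[OF q homog_G A vt, of m] by (simp add: N_def N'_def)
  have "{c \<in> shift a J m. c [^] q \<otimes> b \<in> M} = shift a J m \<inter> shift a P m"
    using key sub(1) shift_sub[OF fr(2), of a m] shift_sub[OF hJ, of a m] by blast
  then have "rlen M M' = rlen (shift a J m \<inter> shift a P m) (shift a J m)"
    using fspan_rlen_Cons[OF q hJ A vt, of m] by (simp add: M_def M'_def)
  then have 2: "rlen M M' = rlen (shift a P m) (shift a P m <+>\<^bsub>R\<^esub> shift a J m)"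
    by (simp add: rlen_second_iso[OF shift_ksub[OF hJ] shift_ksub[OF fr(2)]])
  have hQ: "homog (fspan 1 0 G P hs)" by (rule homog_fspan[OF fr(2) v])
  have s: "shift a P m <+>\<^bsub>R\<^esub> shift a J m = shift a (fspan 1 0 G P hs) m"
    unfolding J_def by (rule shift_fspan_split[OF fr(2) v, symmetric])
  have "rlen (shift a P m) (shift a G m) = rlen (shift a P m) (shift a (fspan 1 0 G P hs) m)
      + rlen (shift a (fspan 1 0 G P hs) m) (shift a G m)"
    by (rule rlen_additive[OF shift_finite_len shift_ksub[OF fr(2)] shift_ksub[OF hQ] shift_mono[OF fspan_base1[OF fr(2) v]]
          shift_sub[OF hQ]])
  then have 3: "rlen N N' = rlen M M' + shift_seq a (hilb (fspan 1 0 G P hs)) m"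
    unfolding 1 2 s by (simp add: rlen_shift)
  have "rlen M N' = rlen M N + rlen N N'"
    by (rule rlen_additive[OF k(5) k(2) k(1) sub(1) sub(3)])
  moreover have "rlen M N' = rlen M M' + rlen M' N'"
    by (rule rlen_additive[OF k(5) k(2) k(4) sub(4) sub(2)])
  moreover have "rlen M N = (\<Sum>t\<leftarrow>Bs. shift_seq (fst (snd t)) (hilb (fspan 1 0 G (fst t) hs)) m)"
    using Cons.IH[OF fr(1)] by (simp add: M_def N_def J_def)
  ultimately have "rlen M' N' = (\<Sum>t\<leftarrow>t # Bs. shift_seq (fst (snd t)) (hilb (fspan 1 0 G (fst t) hs)) m)"
    using 3 by (simp add: a_def P_def)
  then show ?case by (simp add: M'_def N'_def J_def t)
qed

text \<open>Generators of the \<open>q\<close>-th Frobenius power of the ideal generated by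
  \<open>hs\<close>, with their degrees.\<close>

definition pow_gens :: "nat \<Rightarrow> (nat \<times> 'a) list \<Rightarrow> (nat \<times> 'a) list" where
  "pow_gens q hs = map (\<lambda>t. (q * fst t, snd t [^] q)) hs"

lemma valid_pow_gens: "valid 1 0 hs \<Longrightarrow> valid 1 0 (pow_gens q hs)"
  using G_pow[of _ _ q] by (auto simp: valid_def pow_gens_def)

lemma frob_image_fspan:
  assumes q: "frob q"
  shows "valid 1 0 hs \<Longrightarrow> c \<in> fspan 1 0 G Z hs i \<Longrightarrow> c [^] q \<in> fspan 1 0 G Z (pow_gens q hs) (q * i)"
proof (induction hs arbitrary: c)
  case Nil
  then show ?case using pow_zero[OF frob_pos[OF q]] by (simp add: pow_gens_def)
next
  case (Cons t hs)
  then have v: "valid 1 0 hs" and t: "snd t \<in> G (fst t)" by auto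
  from Cons.prems(2) obtain y e where ye: "y \<in> fspan 1 0 G Z hs i" "e \<in> shift (fst t) G i" "c = y \<oplus> e [^] (1::nat) \<otimes> snd t"
    by (auto simp: mem_set_add)
  have c: "y \<in> carrier R" "e \<in> carrier R" "snd t \<in> carrier R"
    using fspan_carrier[OF frob_1 homog_G homog_Z v ye(1)] shift_carrier[OF homog_G] ye(2) G_carrier[OF t] by auto
  have "c [^] q = y [^] q \<oplus> (e [^] q) [^] (1::nat) \<otimes> (snd t) [^] q"
    using ye(3) c by (simp add: frob_add[OF q] nat_pow_distrib)
  moreover have "e [^] q \<in> shift (q * fst t) G (q * i)"
  proof (cases "fst t \<le> i")
    case True
    then have "e [^] q \<in> G (q * (i - fst t))" using ye(2) by (auto simp: shift_def intro: G_pow)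
    then show ?thesis using True by (simp add: shift_def diff_mult_distrib2)
  next
    case False
    then show ?thesis using ye(2) frob_pos[OF q] by (auto simp: shift_def pow_zero)
  qed
  ultimately show ?case using Cons.IH[OF v ye(1)] by (auto simp: pow_gens_def mem_set_add)
qed

text \<open>Multiplication by \<open>h [^] q\<close> is the twisted action of \<open>h\<close>, so
  it turns arbitrary coefficients into coefficients in \<open>J\<close>.\<close>

lemma fspan_scale:
  assumes q: "frob q" and A: "homog A" and J: "homog J" and h: "h \<in> J d" and v: "valid q r Bs"
    and y: "y \<in> fspan q r G A Bs j"
  shows "h [^] q \<otimes> y \<in> fspan q r J A Bs (d + j)"
  using v y
proof (induction Bs arbitrary: y)
  case Nil
  have hG: "h \<in> G d" using homog_mem[OF J h] .
  have "h [^] q \<otimes> y \<in> A (q * d + (q * j + r))" using Nil homog_mult[OF A G_pow[OF hG]] by simp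
  then show ?case by (simp add: algebra_simps)
next
  case (Cons t Bs)
  then obtain z e where ze: "z \<in> fspan q r G A Bs j" "e \<in> shift (fst t) G j" "y = z \<oplus> e [^] q \<otimes> snd t"
    by (auto simp: mem_set_add)
  have v: "valid q r Bs" and t: "snd t \<in> carrier R" using Cons.prems G_carrier by auto
  have c: "z \<in> carrier R" "e \<in> carrier R" "h \<in> carrier R"
    using fspan_carrier[OF q homog_G A v ze(1)] shift_carrier[OF homog_G] ze(2) homog_carrier[OF J h] by auto
  have "h [^] q \<otimes> y = h [^] q \<otimes> z \<oplus> (h \<otimes> e) [^] q \<otimes> snd t"
    using ze(3) c t by (simp add: r_distr m_assoc nat_pow_distrib)
  moreover have "h \<otimes> e \<in> shift (fst t) J (d + j)"
  proof (cases "fst t \<le> j")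
    case True
    then show ?thesis using ze(2) homog_mult2[OF J _ h, of e "j - fst t"] by (simp add: shift_def)
  next
    case False
    then show ?thesis using ze(2) c homog_zero[OF J] by (simp add: shift_def)
  qed
  ultimately show ?case using Cons.IH[OF v ze(1)] by (auto simp: mem_set_add)
qed

text \<open>The generators \<open>h [^] q\<close> of the Frobenius power are added to the span one
  at a time. By \<open>fspan_scale\<close> multiplication by \<open>h [^] q\<close> maps the full
  span into the one with coefficients in \<open>J\<close>, so a generator adds at most the colength
  of the full span in the degree lowered by that of \<open>h\<close>.\<close>

lemma comparison_upper:
  assumes q: "frob q" and r: "r < q" and A: "homog A" and v: "valid q r Bs" and J: "homog J"
    and gens: "valid 1 0 hs" "\<And>t. t \<in> set hs \<Longrightarrow> snd t \<in> J (fst t)"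
  shows "rlen (fspan q r J A Bs m) (fspan q r J A Bs m <+>\<^bsub>R\<^esub> fspan 1 0 G Z (pow_gens q hs) (q * m + r))
    \<le> (\<Sum>t\<leftarrow>hs. shift_seq (fst t) (\<lambda>m. rlen (fspan q r G A Bs m) (G (q * m + r))) m)"
  using gens
proof (induction hs)
  case Nil
  then show ?case using set_add_zero_right[OF fspan_ksub[OF q J A v]] by (simp add: pow_gens_def)
next
  case (Cons t hs)
  define M where "M = fspan q r J A Bs m"
  define E where "E = fspan 1 0 G Z (pow_gens q hs) (q * m + r)"
  define S where "S = shift (q * fst t) G (q * m + r)"
  define h where "h = snd t [^] q"
  have vh: "valid 1 0 hs" and t: "snd t \<in> G (fst t)" "snd t \<in> J (fst t)" using Cons.prems by auto
  have hG: "h \<in> G (q * fst t)" unfolding h_def by (rule G_pow[OF t(1)])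
  have hc: "h \<in> carrier R" by (rule G_carrier[OF hG])
  have kM: "ksub M" "M \<subseteq> G (q * m + r)" unfolding M_def using fspan_ksub[OF q J A v] fspan_sub[OF q J A v] by blast+
  have kE: "ksub E" "E \<subseteq> G (q * m + r)"
    unfolding E_def using fspan_ksub[OF frob_1 homog_G homog_Z valid_pow_gens[OF vh]]
      fspan_sub[OF frob_1 homog_G homog_Z valid_pow_gens[OF vh], of q "q * m + r"] by auto
  have kS: "ksub ((\<lambda>c. c [^] (1::nat) \<otimes> h) ` S)" unfolding S_def by (rule ksub_frob_image[OF frob_1 homog_G hG])
  have ME: "ksub (M <+>\<^bsub>R\<^esub> E)" by (rule ksub_set_add[OF kM(1) kE(1)])
  have sG: "(\<lambda>c. c [^] (1::nat) \<otimes> h) ` S \<subseteq> G (q * m + r)"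
    using shift_frob_mem[of 1 _ "q * fst t" "q * m + r" h 0] hG by (auto simp: S_def)
  have full: "ksub ((M <+>\<^bsub>R\<^esub> E) <+>\<^bsub>R\<^esub> (\<lambda>c. c [^] (1::nat) \<otimes> h) ` S)"
    "(M <+>\<^bsub>R\<^esub> E) <+>\<^bsub>R\<^esub> (\<lambda>c. c [^] (1::nat) \<otimes> h) ` S \<subseteq> G (q * m + r)"
    by (rule ksub_set_add[OF ME kS], intro set_add_least ksub_G kM(2) kE(2) sG)
  have eq: "fspan 1 0 G Z (pow_gens q (t # hs)) (q * m + r) = E <+>\<^bsub>R\<^esub> (\<lambda>c. c [^] (1::nat) \<otimes> h) ` S"
    by (simp add: pow_gens_def E_def S_def h_def)
  have "rlen M (M <+>\<^bsub>R\<^esub> (E <+>\<^bsub>R\<^esub> (\<lambda>c. c [^] (1::nat) \<otimes> h) ` S))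
      = rlen M (M <+>\<^bsub>R\<^esub> E) + rlen (M <+>\<^bsub>R\<^esub> E) ((M <+>\<^bsub>R\<^esub> E) <+>\<^bsub>R\<^esub> (\<lambda>c. c [^] (1::nat) \<otimes> h) ` S)"
    unfolding set_add_assoc_ksub[OF kM(1) kE(1) kS]
    by (rule rlen_additive[OF finite_len_subset[OF finite_len_G full] kM(1) ME subset_set_add1[OF kM(1) kE(1)]
          subset_set_add1[OF ME kS]])
  also have "rlen (M <+>\<^bsub>R\<^esub> E) ((M <+>\<^bsub>R\<^esub> E) <+>\<^bsub>R\<^esub> (\<lambda>c. c [^] (1::nat) \<otimes> h) ` S)
      = rlen {c \<in> S. c [^] (1::nat) \<otimes> h \<in> M <+>\<^bsub>R\<^esub> E} S"
    unfolding S_def by (rule rlen_semilinear[OF semilinear_frob[OF frob_1 hc shift_carrier[OF homog_G]]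
          shift_ksub[OF homog_G] ME, symmetric])
  also have "\<dots> \<le> shift_seq (fst t) (\<lambda>m. rlen (fspan q r G A Bs m) (G (q * m + r))) m"
  proof (cases "fst t \<le> m")
    case True
    have deg: "q * m + r - q * fst t = q * (m - fst t) + r" and le: "q * fst t \<le> q * m + r"
      using True by (auto simp: diff_mult_distrib2 trans_le_add1)
    have S: "S = G (q * (m - fst t) + r)" unfolding S_def shift_def deg using le by simp
    show ?thesis unfolding shift_seq_def if_P[OF True] S
    proof (rule rlen_mono[OF finite_len_G fspan_ksub[OF q homog_G A v] _ subset_refl])
      show "fspan q r G A Bs (m - fst t) \<subseteq> {c \<in> G (q * (m - fst t) + r). c [^] (1::nat) \<otimes> h \<in> M <+>\<^bsub>R\<^esub> E}"
      proof
        fix y assume y: "y \<in> fspan q r G A Bs (m - fst t)"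
        have yG: "y \<in> G (q * (m - fst t) + r)" using y fspan_sub[OF q homog_G A v] by blast
        have "h \<otimes> y \<in> M"
          using fspan_scale[OF q A J t(2) v y] True unfolding h_def M_def by simp
        then have "y \<otimes> h \<in> M <+>\<^bsub>R\<^esub> E"
          using subset_set_add1[OF kM(1) kE(1)] hc G_carrier[OF yG] by (auto simp: m_comm)
        then show "y \<in> {c \<in> G (q * (m - fst t) + r). c [^] (1::nat) \<otimes> h \<in> M <+>\<^bsub>R\<^esub> E}"
          using yG G_carrier[OF yG] by simp
      qed
    qed
  next
    case False
    \<comment> \<open>Because \<open>r < q\<close>, a generator of degree above \<open>m\<close> has
      a \<open>q\<close>-th power of degree above \<open>q * m + r\<close> and contributes
      nothing.\<close>
    then have "q * Suc m \<le> q * fst t" by (intro mult_le_mono2) simp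
    then have "\<not> q * fst t \<le> q * m + r" using r by simp
    then have S: "S = {\<zero>}" by (simp add: S_def shift_def)
    then have "{c \<in> S. c [^] (1::nat) \<otimes> h \<in> M <+>\<^bsub>R\<^esub> E} = S"
      using ksub_zero[OF ME] hc by auto
    then show ?thesis using False by (simp add: shift_seq_def)
  qed
  also have "rlen M (M <+>\<^bsub>R\<^esub> E) \<le> (\<Sum>t\<leftarrow>hs. shift_seq (fst t) (\<lambda>m. rlen (fspan q r G A Bs m) (G (q * m + r))) m)"
    using Cons unfolding M_def E_def by simp
  finally show ?case unfolding eq by (simp add: M_def)
qed

text \<open>Both \<open>N\<close>, the span of the frame, and \<open>JM\<close>, the part of degree
  \<open>q * m + r\<close> of \<open>A\<close> plus the Frobenius power, lie between
  \<open>M\<close> and the whole component. The length of \<open>N\<close> over \<open>M\<close> is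
  the sum over the frame, so the quantity to be bounded is exactly \<open>C m - rlen M JM\<close>,
  and \<open>comparison_upper\<close> bounds the second term.\<close>

theorem comparison:
  assumes q: "frob q" and r: "r < q" and A: "homog A" and fr: "frame q r A Bs" and v: "valid 1 0 hs"
  defines "C \<equiv> \<lambda>m. rlen (fspan q r G A (map snd Bs) m) (G (q * m + r))"
  shows "\<bar>hilb (fspan 1 0 G A (pow_gens q hs)) (q * m + r)
      - (\<Sum>t\<leftarrow>Bs. shift_seq (fst (snd t)) (hilb (fspan 1 0 G (fst t) hs)) m)\<bar>
    \<le> C m + (\<Sum>t\<leftarrow>hs. shift_seq (fst t) C m)"
proof -
  define J where "J = fspan 1 0 G Z hs"
  have hJ: "homog J" unfolding J_def by (rule homog_fspan[OF homog_Z v])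
  note vB = frame_valid[OF fr]
  note vq = valid_pow_gens[OF v, of q]
  define N where "N = fspan q r G A (map snd Bs) m"
  define M where "M = fspan q r J A (map snd Bs) m"
  define E where "E = fspan 1 0 G Z (pow_gens q hs) (q * m + r)"
  define JM where "JM = fspan 1 0 G A (pow_gens q hs) (q * m + r)"
  have kN: "ksub N" "N \<subseteq> G (q * m + r)" unfolding N_def using fspan_ksub[OF q homog_G A vB] fspan_sub[OF q homog_G A vB] by blast+
  have kM: "ksub M" "M \<subseteq> G (q * m + r)" unfolding M_def using fspan_ksub[OF q hJ A vB] fspan_sub[OF q hJ A vB] by blast+
  have hE: "homog (fspan 1 0 G Z (pow_gens q hs))" by (rule homog_fspan[OF homog_Z vq])
  have kE: "ksub E" unfolding E_def by (rule homog_ksub[OF hE])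
  have hJM: "homog (fspan 1 0 G A (pow_gens q hs))" by (rule homog_fspan[OF A vq])
  have kJM: "ksub JM" "JM \<subseteq> G (q * m + r)" unfolding JM_def using homog_ksub[OF hJM] homog_sub[OF hJM] by auto
  have JM: "JM = A (q * m + r) <+>\<^bsub>R\<^esub> E" unfolding JM_def E_def by (rule fspan_split[OF A vq])
  have MN: "M \<subseteq> N" unfolding M_def N_def by (rule fspan_mono[OF homog_le_G[OF hJ] order_refl])
  \<comment> \<open>A coefficient in \<open>J\<close> acts through its \<open>q\<close>-th power,
    which lies in the Frobenius power.\<close>
  have Msub: "M \<subseteq> JM"
  proof -
    have "valid q r bs \<Longrightarrow> fspan q r J A bs m \<subseteq> JM" for bs
    proof (induction bs)
      case Nil
      then show ?case using subset_set_add1[OF homog_ksub[OF A] kE] by (simp add: JM)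
    next
      case (Cons t bs)
      have "(\<lambda>c. c [^] q \<otimes> snd t) ` shift (fst t) J m \<subseteq> JM"
      proof (rule image_subsetI)
        fix c assume c: "c \<in> shift (fst t) J m"
        have tG: "snd t \<in> G (q * fst t + r)" using Cons.prems by simp
        show "c [^] q \<otimes> snd t \<in> JM"
        proof (cases "fst t \<le> m")
          case True
          then have "c \<in> fspan 1 0 G Z hs (m - fst t)" using c by (simp add: shift_def J_def)
          from homog_mult2[OF hE tG frob_image_fspan[OF q v this]]
          have "c [^] q \<otimes> snd t \<in> fspan 1 0 G Z (pow_gens q hs) (q * (m - fst t) + (q * fst t + r))" .
          also have "q * (m - fst t) + (q * fst t + r) = q * m + r"
            using True by (simp add: diff_mult_distrib2)
          finally have "c [^] q \<otimes> snd t \<in> E" by (simp add: E_def)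
          then show ?thesis using subset_set_add2[OF homog_ksub[OF A] kE] by (auto simp: JM)
        next
          case False
          then show ?thesis using c G_carrier[OF tG] ksub_zero[OF kJM(1)] by (simp add: shift_def pow_zero frob_pos[OF q])
        qed
      qed
      then show ?case using Cons by (simp add: set_add_least[OF kJM(1)])
    qed
    then show ?thesis using vB by (simp add: M_def)
  qed
  have AM: "A (q * m + r) \<subseteq> M" unfolding M_def by (rule fspan_base[OF q hJ A vB])
  have "JM \<subseteq> M <+>\<^bsub>R\<^esub> E" unfolding JM by (rule set_add_mono[OF AM subset_refl])
  moreover have "M <+>\<^bsub>R\<^esub> E \<subseteq> JM"
    by (rule set_add_least[OF kJM(1) Msub]) (use subset_set_add2[OF homog_ksub[OF A] kE] JM in blast)
  ultimately have JM2: "JM = M <+>\<^bsub>R\<^esub> E" by blast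
  have gens: "snd t \<in> J (fst t)" if "t \<in> set hs" for t
    unfolding J_def by (rule fspan_mem1[OF homog_Z v that])
  have up: "rlen M JM \<le> (\<Sum>t\<leftarrow>hs. shift_seq (fst t) C m)"
    using comparison_upper[OF q r A vB hJ v gens] unfolding JM2 M_def E_def C_def by blast
  have "rlen M (G (q * m + r)) = rlen M N + rlen N (G (q * m + r))"
    by (rule rlen_additive[OF finite_len_G kM(1) kN(1) MN kN(2)])
  moreover have "rlen M (G (q * m + r)) = rlen M JM + rlen JM (G (q * m + r))"
    by (rule rlen_additive[OF finite_len_G kM(1) kJM(1) Msub kJM(2)])
  moreover have "rlen M N = (\<Sum>t\<leftarrow>Bs. shift_seq (fst (snd t)) (hilb (fspan 1 0 G (fst t) hs)) m)"
    unfolding M_def N_def J_def by (rule frame_rlen[OF q A v fr])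
  moreover have "rlen N (G (q * m + r)) = C m" by (simp add: N_def C_def)
  moreover have "rlen JM (G (q * m + r)) = hilb (fspan 1 0 G A (pow_gens q hs)) (q * m + r)"
    by (simp add: JM_def hilb_def)
  ultimately have "hilb (fspan 1 0 G A (pow_gens q hs)) (q * m + r)
      - (\<Sum>t\<leftarrow>Bs. shift_seq (fst (snd t)) (hilb (fspan 1 0 G (fst t) hs)) m) = C m - rlen M JM" by linarith
  moreover have "\<bar>C m - rlen M JM\<bar> \<le> C m + rlen M JM" unfolding C_def using rlen_nonneg by (simp add: abs_le_iff)
  ultimately show ?thesis using up by linarith
qed

end

section \<open>Decomposition along the primes of maximal dimension\<close>

context graded_algebra
begin

text \<open>Multiply together one element of each \<open>Q\<close> that lies outside
  \<open>P\<close>; primality keeps the product outside \<open>P\<close>.\<close>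

lemma exists_separating_element:
  assumes P: "hprime P" and "\<And>Q. Q \<in> set Ls \<Longrightarrow> homog Q \<and> (Q \<noteq> P \<longrightarrow> \<not> Q \<le> P)"
  shows "\<exists>s e. s \<in> G e \<and> s \<notin> P e \<and> (\<forall>Q\<in>set Ls. Q \<noteq> P \<longrightarrow> s \<in> Q e)"
  using assms(2)
proof (induction Ls)
  case Nil
  then show ?case using one_G0 hprime_one[OF P] by auto
next
  case (Cons Q Ls)
  then obtain s e where s: "s \<in> G e" "s \<notin> P e" "\<forall>Q\<in>set Ls. Q \<noteq> P \<longrightarrow> s \<in> Q e" by auto
  show ?case
  proof (cases "Q = P")
    case True
    then show ?thesis using s by auto
  next
    case False
    then obtain i y where y: "y \<in> Q i" "y \<notin> P i" using Cons.prems[of Q] by (auto simp: le_fun_def)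
    have hQ: "homog Q" using Cons.prems by simp
    have yG: "y \<in> G i" using y(1) homog_mem[OF hQ] by blast
    have "y \<otimes> s \<notin> P (i + e)" using hprime_mult[OF P yG s(1)] y(2) s(2) by blast
    moreover have "\<forall>Q'\<in>set (Q # Ls). Q' \<noteq> P \<longrightarrow> y \<otimes> s \<in> Q' (i + e)"
      using homog_mult2[OF hQ s(1) y(1)] homog_mult[OF _ yG] s(3) Cons.prems by auto
    ultimately show ?thesis using G_mult[OF yG s(1)] by blast
  qed
qed

text \<open>The product of \<open>c\<close> in \<open>P\<close> and \<open>s\<close> in all other
  primes lies in every prime of the filtration, so each multiplication by it moves one step down the
  filtration.\<close>

lemma prime_filt_nilpotent_step:
  assumes A: "homog A" and P: "homog P" and s: "s \<in> G e" and c: "c \<in> P i" and "prime_filt 1 A L"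
    and "\<And>t. t \<in> set L \<Longrightarrow> fst t \<noteq> P \<Longrightarrow> s \<in> fst t e"
    and "z \<in> fspan 1 0 G A (map snd L) j"
  shows "(c \<otimes> s) [^] length L \<otimes> z \<in> A (length L * (i + e) + j)"
  using assms(5-)
proof (induction L arbitrary: z j)
  case Nil
  then show ?case using homog_carrier[OF A, of z j] by simp
next
  case (Cons t L)
  have cG: "c \<in> G i" using homog_mem[OF P c] .
  have cs: "c \<otimes> s \<in> G (i + e)" by (rule G_mult[OF cG s])
  have v: "valid 1 0 (map snd L)" using Cons.prems(1) prime_filt_valid by auto
  have tP: "hprime (fst t)" "snd (snd t) \<in> G (fst (snd t))" using Cons.prems(1) by auto
  obtain y d where yd: "y \<in> fspan 1 0 G A (map snd L) j" "d \<in> shift (fst (snd t)) G j"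
    "z = y \<oplus> d [^] (1::nat) \<otimes> snd (snd t)"
    using Cons.prems(3) by (auto simp: mem_set_add)
  have dc: "d \<in> carrier R" using yd(2) shift_carrier[OF homog_G] by blast
  have bc: "snd (snd t) \<in> carrier R" by (rule G_carrier[OF tP(2)])
  have yc: "y \<in> carrier R" by (rule fspan_carrier[OF frob_1 homog_G A v yd(1)])
  have csc: "c \<otimes> s \<in> carrier R" by (rule G_carrier[OF cs])
  have hN: "homog (fspan 1 0 G A (map snd L))" by (rule homog_fspan[OF A v])
  have 1: "(c \<otimes> s) \<otimes> y \<in> fspan 1 0 G A (map snd L) (i + e + j)" by (rule homog_mult[OF hN cs yd(1)])
  have 2: "((c \<otimes> s) \<otimes> d) [^] (1::nat) \<otimes> snd (snd t) \<in> fspan 1 0 G A (map snd L) (i + e + j)"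
  proof (cases "fst (snd t) \<le> j")
    case True
    then have dG: "d \<in> G (j - fst (snd t))" using yd(2) by (simp add: shift_def)
    have "c \<otimes> s \<in> fst t (i + e)"
      using homog_mult2[OF hprime_homog[OF tP(1)] s, of c i] homog_mult[OF hprime_homog[OF tP(1)] cG, of s e]
        Cons.prems(2)[of t] c by auto
    then have "(c \<otimes> s) \<otimes> d \<in> fst t (i + e + (j - fst (snd t)))"
      by (rule homog_mult2[OF hprime_homog[OF tP(1)] dG])
    moreover have "(c \<otimes> s) \<otimes> d \<in> G (i + e + (j - fst (snd t)))" by (rule G_mult[OF cs dG])
    ultimately have "((c \<otimes> s) \<otimes> d) [^] (1::nat) \<otimes> snd (snd t)
        \<in> fspan 1 0 G A (map snd L) (i + e + (j - fst (snd t)) + fst (snd t))"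
      using Cons.prems(1) by auto
    then show ?thesis using True by simp
  next
    case False
    then have "d = \<zero>" using yd(2) by (simp add: shift_def)
    then show ?thesis using csc bc homog_zero[OF hN] by simp
  qed
  have "(c \<otimes> s) \<otimes> z = (c \<otimes> s) \<otimes> y \<oplus> ((c \<otimes> s) \<otimes> d) [^] (1::nat) \<otimes> snd (snd t)"
    using yd(3) yc dc bc csc by (simp add: r_distr m_assoc)
  then have "(c \<otimes> s) \<otimes> z \<in> fspan 1 0 G A (map snd L) (i + e + j)"
    using ksub_add[OF homog_ksub[OF hN] 1 2] by simp
  then have "(c \<otimes> s) [^] length L \<otimes> ((c \<otimes> s) \<otimes> z) \<in> A (length L * (i + e) + (i + e + j))"
    using Cons.IH Cons.prems by auto
  moreover have "z \<in> carrier R" using yd(3) yc dc bc by simp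
  ultimately show ?case using csc by (simp add: m_assoc algebra_simps)
qed

lemma prime_filt_nilpotent:
  assumes A: "homog A" and P: "homog P" and s: "s \<in> G e" and c: "c \<in> P i" and L: "prime_filt 1 A L"
    and full: "fspan 1 0 G A (map snd L) = G"
    and sep: "\<And>t. t \<in> set L \<Longrightarrow> fst t \<noteq> P \<Longrightarrow> s \<in> fst t e" and n: "length L \<le> n"
  shows "(c \<otimes> s) [^] n \<in> A (n * (i + e))"
proof -
  have cs: "c \<otimes> s \<in> G (i + e)" by (rule G_mult[OF homog_mem[OF P c] s])
  have "(c \<otimes> s) [^] length L \<otimes> \<one> \<in> A (length L * (i + e) + 0)"
    by (rule prime_filt_nilpotent_step[OF A P s c L sep]) (use one_G0 full in auto)
  then have "(c \<otimes> s) [^] length L \<in> A (length L * (i + e))" using G_carrier[OF cs] by simp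
  from homog_mult2[OF A G_pow[OF cs, of "n - length L"] this]
  have "(c \<otimes> s) [^] length L \<otimes> (c \<otimes> s) [^] (n - length L) \<in> A (length L * (i + e) + (n - length L) * (i + e))" .
  also have "(c \<otimes> s) [^] length L \<otimes> (c \<otimes> s) [^] (n - length L) = (c \<otimes> s) [^] n"
    using n G_carrier[OF cs] by (simp add: nat_pow_mult)
  also have "length L * (i + e) + (n - length L) * (i + e) = n * (i + e)"
    using n by (simp flip: distrib_right)
  finally show ?thesis .
qed

text \<open>If the dimension is \<open>Suc \<delta>\<close>, these are the homogeneous primes of
  maximal dimension; all others contribute only lower order terms.\<close>

definition big :: "nat \<Rightarrow> (nat \<Rightarrow> 'a set) \<Rightarrow> bool" where
  "big \<delta> P \<longleftrightarrow> hprime P \<and> \<not> growth \<delta> (hilb P)"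

text \<open>If \<open>Q\<close> were strictly smaller, \<open>P\<close> would contain
  \<open>Q\<close> and some \<open>x\<close> outside \<open>Q\<close>. Adjoining \<open>x\<close> to
  \<open>Q\<close> turns the Hilbert function into a difference of itself and its shift, which costs
  one order of growth.\<close>

lemma big_minimal:
  assumes bound: "\<And>P. hprime P \<Longrightarrow> eventually_poly (Suc \<delta>) (hilb P)"
    and P: "big \<delta> P" and Q: "hprime Q" "Q \<le> P"
  shows "Q = P"
proof (rule ccontr)
  assume "Q \<noteq> P"
  then have "\<not> P \<le> Q" using Q(2) by (auto dest: antisym)
  then obtain a x where x: "x \<in> P a" "x \<notin> Q a" by (auto simp: le_fun_def)
  have hP: "homog P" using P hprime_homog by (auto simp: big_def)
  have xG: "x \<in> G a" using homog_mem[OF hP x(1)] .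
  have v: "valid 1 0 [(a, x)]" using xG by simp
  have "fspan 1 0 G Q [(a, x)] \<le> P" by (rule fspan_least[OF hP Q(2)]) (use x in auto)
  then have "hilb P m \<le> hilb Q m - shift_seq a (hilb Q) m" for m
    using hilb_antimono[OF homog_fspan[OF hprime_homog[OF Q(1)] v]] hilb_adjoin[OF Q(1) xG x(2)] by metis
  moreover have "growth \<delta> (\<lambda>m. hilb Q m - shift_seq a (hilb Q) m)"
    by (rule eventually_poly_growth[OF eventually_poly_diff_shift_seq[OF bound[OF Q(1)]]])
  ultimately have "growth \<delta> (hilb P)"
    by (elim growth_le) (smt (verit) hilb_nonneg)
  then show False using P by (simp add: big_def)
qed

lemma big_linear_form: assumes "big \<delta> P" obtains x where "x \<in> G 1" "x \<notin> P 1"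
proof (rule ccontr)
  assume "\<not> thesis"
  then have "G 1 \<subseteq> P 1" using that by blast
  then have "growth 0 (hilb P)" using hprime_irrelevant assms unfolding growth_def big_def by auto
  then have "growth \<delta> (hilb P)" by (rule growth_mono[rotated]) simp
  then show False using assms by (simp add: big_def)
qed

theorem exists_frames:
  assumes bound: "\<And>P. hprime P \<Longrightarrow> eventually_poly (Suc \<delta>) (hilb P)"
    and A: "homog A" and hA: "eventually_poly (Suc \<delta>) (hilb A)"
    and L1: "prime_filt 1 A L1" "fspan 1 0 G A (map snd L1) = G" and q: "frob q" "length L1 \<le> q"
  obtains Ps where "\<And>P. P \<in> set Ps \<Longrightarrow> big \<delta> P \<and> A \<le> P"
    "\<And>r. r < q \<Longrightarrow> \<exists>Bs. frame q r A Bs \<and> map fst Bs = Ps \<and>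
        growth \<delta> (\<lambda>m. rlen (fspan q r G A (map snd Bs) m) (G (q * m + r)))"
proof -
  \<comment> \<open>A filtration becomes a direct sum when each generator \<open>b\<close> with big \<open>P\<close> is replaced by
    \<open>s\<^sup>q x\<^sup>r b\<close>, where \<open>s\<close> lies outside \<open>P\<close> and in all other primes involved, and \<open>x\<close> is a linear
    form outside \<open>P\<close>. This changes only lower order terms.\<close>
  obtain Lq where Lq: "prime_filt q A Lq" "\<And>m. fspan q 0 G A (map snd Lq) m = G (q * m)"
    using prime_filt_exists[OF q(1) A] by blast
  have "\<exists>s e x. s \<in> G e \<and> s \<notin> P e \<and> x \<in> G 1 \<and> x \<notin> P 1 \<and>
      (\<forall>Q\<in>set (map fst L1 @ map fst Lq). Q \<noteq> P \<longrightarrow> s \<in> Q e)" if P: "big \<delta> P" for P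
  proof -
    have hP: "hprime P" using P by (simp add: big_def)
    have "homog Q \<and> (Q \<noteq> P \<longrightarrow> \<not> Q \<le> P)" if "Q \<in> set (map fst L1 @ map fst Lq)" for Q
    proof -
      have "hprime Q" using that prime_filt_prime_ge[OF frob_1 A L1(1)] prime_filt_prime_ge[OF q(1) A Lq(1)] by auto
      then show ?thesis using big_minimal[OF bound P] hprime_homog by blast
    qed
    from exists_separating_element[OF hP this] big_linear_form[OF P] show ?thesis by metis
  qed
  then have "\<forall>P. \<exists>u. big \<delta> P \<longrightarrow> fst u \<in> G (fst (snd u)) \<and> fst u \<notin> P (fst (snd u)) \<and>
      snd (snd u) \<in> G 1 \<and> snd (snd u) \<notin> P 1 \<and>
      (\<forall>Q\<in>set (map fst L1 @ map fst Lq). Q \<noteq> P \<longrightarrow> fst u \<in> Q (fst (snd u)))"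
    by (metis fst_conv snd_conv)
  from choice[OF this] obtain u where u: "\<And>P. big \<delta> P \<Longrightarrow> fst (u P) \<in> G (fst (snd (u P))) \<and>
      fst (u P) \<notin> P (fst (snd (u P))) \<and> snd (snd (u P)) \<in> G 1 \<and> snd (snd (u P)) \<notin> P 1 \<and>
      (\<forall>Q\<in>set (map fst L1 @ map fst Lq). Q \<noteq> P \<longrightarrow> fst (u P) \<in> Q (fst (snd (u P))))"
    by blast
  define s where "s P = fst (u P)" for P
  define e where "e P = fst (snd (u P))" for P
  define x where "x P = snd (snd (u P))" for P
  have s: "\<And>P. big \<delta> P \<Longrightarrow> s P \<in> G (e P)" "\<And>P. big \<delta> P \<Longrightarrow> s P \<notin> P (e P)"
    and x: "\<And>P. big \<delta> P \<Longrightarrow> x P \<in> G 1" "\<And>P. big \<delta> P \<Longrightarrow> x P \<notin> P 1"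
    and sep: "\<And>P Q. big \<delta> P \<Longrightarrow> Q \<in> set (map fst L1 @ map fst Lq) \<Longrightarrow> Q \<noteq> P \<Longrightarrow> s P \<in> Q (e P)"
    using u unfolding s_def e_def x_def by blast+
  \<comment> \<open>This is where \<open>q\<close> must be at least the length of \<open>L1\<close>:
    it makes \<open>P\<close> annihilate the modified generators modulo \<open>A\<close>
    itself.\<close>
  have nilp: "(c \<otimes> s P) [^] q \<in> A (q * (i + e P))" if P: "big \<delta> P" and c: "c \<in> P i" for P c i
  proof (rule prime_filt_nilpotent[where P = P and L = L1])
    show "homog P" using P hprime_homog by (auto simp: big_def)
    show "s P \<in> G (e P)" by (rule s(1)[OF P])
    show "s P \<in> fst t (e P)" if "t \<in> set L1" "fst t \<noteq> P" for t using sep[OF P _ that(2)] that(1) by simp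
  qed (use A c L1 q in auto)
  \<comment> \<open>The factor with exponent \<open>r\<close> moves a generator from residue 0 to
    residue \<open>r\<close>, so the single filtration \<open>Lq\<close> serves all residues. The
    factor with exponent \<open>q\<close> raises the degree in the twisted module by
    \<open>e\<close>.\<close>
  define F where "F r t = (fst t, fst (snd t) + e (fst t), s (fst t) [^] q \<otimes> (x (fst t) [^] r \<otimes> snd (snd t)))"
    for r :: nat and t :: "(nat \<Rightarrow> 'a set) \<times> nat \<times> 'a"
  define Bs where "Bs r L = map (F r) (filter (\<lambda>t. big \<delta> (fst t)) L)" for r L
  have FG: "s (fst t) [^] q \<otimes> (x (fst t) [^] r \<otimes> snd (snd t)) \<in> G (q * (fst (snd t) + e (fst t)) + r)"
    if t: "big \<delta> (fst t)" "snd (snd t) \<in> G (q * fst (snd t))" for r t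
    using G_mult[OF G_pow[OF s(1)[OF t(1)], of q] G_mult[OF G_pow[OF x(1)[OF t(1)], of r] t(2)]]
    by (simp add: algebra_simps)
  have vF: "valid q r (map snd (Bs r L))" if "prime_filt q A L" for r L
    using that by (induction L) (auto simp: Bs_def F_def FG)
  \<comment> \<open>Multiplication by the \<open>q\<close>-th power of \<open>s P\<close> and by
    \<open>x P [^] (q - r)\<close> brings the modified span of residue \<open>r\<close> back into
    the filtration of residue 0. In terms belonging to \<open>P\<close> the exponents of
    \<open>x P\<close> add up to \<open>q\<close>. Terms belonging to another \<open>Q\<close> fall
    into \<open>A\<close>, because \<open>s P\<close> lies in \<open>Q\<close> and
    \<open>nilp\<close> applies to \<open>Q\<close>.\<close>
  have key: "s P [^] q \<otimes> (x P [^] (q - r) \<otimes> y) \<in> fspan q 0 G A (map snd L) (m + e P + 1)"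
    if "prime_filt q A L" "set L \<subseteq> set Lq" and P: "big \<delta> P" and "y \<in> fspan q r G A (map snd (Bs r L)) m" and r: "r < q"
    for P L y m r
    using that(1,2,4)
  proof (induction L arbitrary: y)
    case Nil
    then have "y \<in> A (q * m + r)" by (simp add: Bs_def)
    from homog_mult[OF A G_pow[OF s(1)[OF P], of q] homog_mult[OF A G_pow[OF x(1)[OF P], of "q - r"] this]]
    show ?case using r by (simp add: algebra_simps)
  next
    case (Cons t L)
    define a where "a = fst (snd t)"
    define b where "b = snd (snd t)"
    have pL: "prime_filt q A L" "set L \<subseteq> set Lq" using Cons.prems by auto
    have bG: "b \<in> G (q * a)" using Cons.prems(1) by (simp add: a_def b_def)
    have v: "valid q 0 (snd t # map snd L)" using prime_filt_valid[OF Cons.prems(1)] by simp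
    have grow: "fspan q 0 G A (map snd L) m' \<subseteq> fspan q 0 G A (map snd (t # L)) m'" for m'
      using fspan_Cons_sub[OF q(1) homog_G A v, of m'] by simp
    show ?case
    proof (cases "big \<delta> (fst t)")
      case False
      then have "y \<in> fspan q r G A (map snd (Bs r L)) m" using Cons.prems(3) by (simp add: Bs_def)
      then show ?thesis using Cons.IH[OF pL] grow by blast
    next
      case True
      define Q where "Q = fst t"
      have bQ: "big \<delta> Q" using True by (simp add: Q_def)
      have "map snd (Bs r (t # L)) = (a + e Q, s Q [^] q \<otimes> (x Q [^] r \<otimes> b)) # map snd (Bs r L)"
        using True by (simp add: Bs_def F_def a_def b_def Q_def)
      then obtain z d where z: "z \<in> fspan q r G A (map snd (Bs r L)) m" and d: "d \<in> shift (a + e Q) G m"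
        and y: "y = z \<oplus> d [^] q \<otimes> (s Q [^] q \<otimes> (x Q [^] r \<otimes> b))"
        using Cons.prems(3) by (auto simp: mem_set_add)
      have zc: "z \<in> carrier R" by (rule fspan_carrier[OF q(1) homog_G A vF[OF pL(1)] z])
      have dc: "d \<in> carrier R" using d shift_carrier[OF homog_G] by blast
      have c: "s P \<in> carrier R" "x P \<in> carrier R" "s Q \<in> carrier R" "x Q \<in> carrier R" "b \<in> carrier R"
        using G_carrier s(1) x(1) P bQ bG by blast+
      let ?w = "s P [^] q \<otimes> (x P [^] (q - r) \<otimes> (d [^] q \<otimes> (s Q [^] q \<otimes> (x Q [^] r \<otimes> b))))"
      have split: "s P [^] q \<otimes> (x P [^] (q - r) \<otimes> y) = s P [^] q \<otimes> (x P [^] (q - r) \<otimes> z) \<oplus> ?w"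
        using y zc dc c by (simp add: r_distr)
      have kN: "ksub (fspan q 0 G A (map snd (t # L)) (m + e P + 1))" using fspan_ksub[OF q(1) homog_G A v] by simp
      have "?w \<in> fspan q 0 G A (map snd (t # L)) (m + e P + 1)"
      proof (cases "a + e Q \<le> m")
        case False
        then have "d = \<zero>" using d by (simp add: shift_def)
        then show ?thesis using c ksub_zero[OF kN] by (simp add: pow_zero[OF frob_pos[OF q(1)]])
      next
        case le: True
        then have dG: "d \<in> G (m - (a + e Q))" using d by (simp add: shift_def)
        show ?thesis
        proof (cases "Q = P")
          case True
          have "x P [^] q = x P [^] (q - r) \<otimes> x P [^] r" using r c by (simp add: nat_pow_mult)
          then have "?w = (d \<otimes> (s P \<otimes> (s P \<otimes> x P))) [^] q \<otimes> b"
            using True c dc by (simp add: nat_pow_distrib m_ac)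
          moreover have "d \<otimes> (s P \<otimes> (s P \<otimes> x P)) \<in> G (m - (a + e P) + (e P + (e P + 1)))"
            using dG s(1)[OF P] x(1)[OF P] True by (intro G_mult) auto
          moreover have "m - (a + e P) + (e P + (e P + 1)) = m + e P + 1 - a" "a \<le> m + e P + 1"
            using le True by auto
          ultimately have "d \<otimes> (s P \<otimes> (s P \<otimes> x P)) \<in> shift a G (m + e P + 1)"
            by (simp only: shift_def if_True)
          moreover have "?w = (d \<otimes> (s P \<otimes> (s P \<otimes> x P))) [^] q \<otimes> b" by fact
          ultimately show ?thesis using fspan_mem[OF q(1) homog_G A v, of "snd t"] by (simp add: a_def b_def)
        next
          case False
          have "Q \<in> set (map fst L1 @ map fst Lq)" using Cons.prems(2) by (auto simp: Q_def)
          then have "s P \<in> Q (e P)" using sep[OF P] False by blast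
          from nilp[OF bQ this] have n: "(s P \<otimes> s Q) [^] q \<in> A (q * (e P + e Q))" .
          have "?w = (x P [^] (q - r) \<otimes> (d [^] q \<otimes> (x Q [^] r \<otimes> b))) \<otimes> (s P \<otimes> s Q) [^] q"
            using c dc by (simp add: nat_pow_distrib m_ac)
          moreover have "x P [^] (q - r) \<otimes> (d [^] q \<otimes> (x Q [^] r \<otimes> b))
              \<in> G ((q - r) * 1 + (q * (m - (a + e Q)) + (r * 1 + q * a)))"
            using x(1)[OF P] x(1)[OF bQ] dG bG by (intro G_mult G_pow)
          ultimately have "?w \<in> A ((q - r) * 1 + (q * (m - (a + e Q)) + (r * 1 + q * a)) + q * (e P + e Q))"
            using homog_mult[OF A _ n] by metis
          also have "(q - r) * 1 + (q * (m - (a + e Q)) + (r * 1 + q * a)) + q * (e P + e Q) = q * (m + e P + 1)"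
          proof -
            obtain k where "m = a + e Q + k" using le by (metis le_Suc_ex)
            then show ?thesis using r by (simp add: algebra_simps)
          qed
          finally show ?thesis using fspan_base[OF q(1) homog_G A v, of "m + e P + 1"] by auto
        qed
      qed
      moreover have "s P [^] q \<otimes> (x P [^] (q - r) \<otimes> z) \<in> fspan q 0 G A (map snd (t # L)) (m + e P + 1)"
        using Cons.IH[OF pL z] grow by blast
      ultimately show ?thesis unfolding split by (intro ksub_add[OF kN])
    qed
  qed
  have fr: "frame q r A (Bs r L)" if "prime_filt q A L" "set L \<subseteq> set Lq" and r: "r < q" for r L
    using that(1,2)
  proof (induction L)
    case Nil
    show ?case by (simp add: Bs_def)
  next
    case (Cons t L)
    define a where "a = fst (snd t)"
    define b where "b = snd (snd t)"
    define P where "P = fst t"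
    have pL: "prime_filt q A L" "set L \<subseteq> set Lq" using Cons.prems by auto
    have bG: "b \<in> G (q * a)" using Cons.prems(1) by (simp add: a_def b_def)
    have iff: "\<And>i c. c \<in> G i \<Longrightarrow> c [^] q \<otimes> b \<in> fspan q 0 G A (map snd L) (i + a) \<longleftrightarrow> c \<in> P i"
      and hp: "hprime P" using Cons.prems(1) by (auto simp: a_def b_def P_def)
    show ?case
    proof (cases "big \<delta> P")
      case False
      then show ?thesis using Cons.IH[OF pL] by (simp add: Bs_def P_def)
    next
      case P: True
      have Bt: "Bs r (t # L) = (P, a + e P, s P [^] q \<otimes> (x P [^] r \<otimes> b)) # Bs r L"
        using P by (simp add: Bs_def F_def a_def b_def P_def)
      note hP = hprime_homog[OF hp]
      have cc: "s P \<in> carrier R" "x P \<in> carrier R" "b \<in> carrier R"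
        using G_carrier s(1)[OF P] x(1)[OF P] bG by blast+
      \<comment> \<open>The annihilation holds modulo \<open>A\<close> and not only modulo the
        earlier generators; this is what turns the filtration into a direct sum.\<close>
      have 1: "c [^] q \<otimes> (s P [^] q \<otimes> (x P [^] r \<otimes> b)) \<in> A (q * (i + (a + e P)) + r)" if c: "c \<in> P i" for c i
      proof -
        have "(c \<otimes> s P) [^] q \<otimes> (x P [^] r \<otimes> b) \<in> A (q * (i + e P) + (r * 1 + q * a))"
          by (rule homog_mult2[OF A G_mult[OF G_pow[OF x(1)[OF P]] bG] nilp[OF P c]])
        also have "(c \<otimes> s P) [^] q \<otimes> (x P [^] r \<otimes> b) = c [^] q \<otimes> (s P [^] q \<otimes> (x P [^] r \<otimes> b))"
          using cc homog_carrier[OF hP c] by (simp add: nat_pow_distrib m_assoc)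
        finally show ?thesis by (simp add: algebra_simps)
      qed
      \<comment> \<open>By \<open>key\<close> the relation becomes one for \<open>b\<close> in the
        original filtration, where the annihilator is \<open>P\<close>. Primality then removes the
        factors \<open>s P\<close>, \<open>s P\<close> and \<open>x P\<close>, all outside
        \<open>P\<close>.\<close>
      have 2: "c \<in> P i" if c: "c \<in> G i"
        and m: "c [^] q \<otimes> (s P [^] q \<otimes> (x P [^] r \<otimes> b)) \<in> fspan q r G A (map snd (Bs r L)) (i + (a + e P))" for c i
      proof -
        note ccar = G_carrier[OF c]
        have "x P [^] q = x P [^] (q - r) \<otimes> x P [^] r" using r cc by (simp add: nat_pow_mult)
        then have "s P [^] q \<otimes> (x P [^] (q - r) \<otimes> (c [^] q \<otimes> (s P [^] q \<otimes> (x P [^] r \<otimes> b))))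
            = (c \<otimes> (s P \<otimes> (s P \<otimes> x P))) [^] q \<otimes> b"
          using cc ccar by (simp add: nat_pow_distrib m_ac)
        then have "(c \<otimes> (s P \<otimes> (s P \<otimes> x P))) [^] q \<otimes> b \<in> fspan q 0 G A (map snd L) (i + (a + e P) + e P + 1)"
          using key[OF pL P m r] by simp
        also have "i + (a + e P) + e P + 1 = (i + (e P + (e P + 1))) + a" by simp
        finally have "c \<otimes> (s P \<otimes> (s P \<otimes> x P)) \<in> P (i + (e P + (e P + 1)))"
          using iff[of "c \<otimes> (s P \<otimes> (s P \<otimes> x P))"] c s(1)[OF P] x(1)[OF P] G_mult by blast
        then show ?thesis
          using hprime_mult[OF hp c, of "s P \<otimes> (s P \<otimes> x P)" "e P + (e P + 1)"]
            hprime_mult[OF hp s(1)[OF P], of "s P \<otimes> x P" "e P + 1"] hprime_mult[OF hp s(1)[OF P] x(1)[OF P]]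
            s[OF P] x[OF P] G_mult by blast
      qed
      show ?thesis unfolding Bt using Cons.IH[OF pL] hP FG[of t r] P bG 1 2
        by (simp add: P_def a_def b_def)
    qed
  qed
  define Ps where "Ps = map fst (filter (\<lambda>t. big \<delta> (fst t)) Lq)"
  have Ps: "big \<delta> P \<and> A \<le> P" if "P \<in> set Ps" for P
    using that prime_filt_prime_ge[OF q(1) A Lq(1)] by (auto simp: Ps_def)
  have main: "frame q r A (Bs r Lq) \<and> map fst (Bs r Lq) = Ps \<and>
      growth \<delta> (\<lambda>m. rlen (fspan q r G A (map snd (Bs r Lq)) m) (G (q * m + r)))" if r: "r < q" for r
  proof (intro conjI)
    show f: "frame q r A (Bs r Lq)" by (rule fr[OF Lq(1) subset_refl r])
    show "map fst (Bs r Lq) = Ps" by (simp add: Bs_def Ps_def F_def)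
    note vB = frame_valid[OF f]
    define N where "N m = fspan q r G A (map snd (Bs r Lq)) m" for m
    \<comment> \<open>The colength is compared with the exact count that \<open>Lq\<close> gives in
      residue 0. What remains are differences of Hilbert functions and their shifts, together with
      the terms of the primes that are not big.\<close>
    have "rlen (N m) (G (q * m + r)) =
        (hilb A (q * m + r) - hilb A (q * m)) +
        (\<Sum>t\<leftarrow>Lq. if big \<delta> (fst t) then shift_seq (fst (snd t)) (hilb (fst t)) m - shift_seq (fst (snd t) + e (fst t)) (hilb (fst t)) m
          else shift_seq (fst (snd t)) (hilb (fst t)) m)" for m
    proof -
      \<comment> \<open>With zero coefficients the span is \<open>A\<close> alone, so
        \<open>frame_rlen\<close> for the empty list of generators measures \<open>N\<close> over
        \<open>A\<close>.\<close>
      have z: "fspan q r Z A bs m = A (q * m + r)" if "valid q r bs" for bs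
        using that
      proof (induction bs)
        case (Cons t bs)
        then have "snd t \<in> carrier R" using G_carrier by auto
        then have "(\<lambda>c. c [^] q \<otimes> snd t) ` shift (fst t) Z m = {\<zero>}"
          by (simp add: shift_def pow_zero[OF frob_pos[OF q(1)]])
        then show ?case using Cons set_add_zero_right[OF homog_ksub[OF A]] by simp
      qed simp
      have "rlen (fspan q r (fspan 1 0 G Z []) A (map snd (Bs r Lq)) m) (N m)
          = (\<Sum>t\<leftarrow>Bs r Lq. shift_seq (fst (snd t)) (hilb (fspan 1 0 G (fst t) [])) m)"
        unfolding N_def by (rule frame_rlen[OF q(1) A _ f]) simp
      moreover have "fspan 1 0 G P [] = P" for P by (rule ext) simp
      ultimately have "rlen (A (q * m + r)) (N m) = (\<Sum>t\<leftarrow>Bs r Lq. shift_seq (fst (snd t)) (hilb (fst t)) m)"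
        using z[OF vB] by simp
      moreover have "(\<Sum>t\<leftarrow>Bs r L. shift_seq (fst (snd t)) (hilb (fst t)) m)
          = (\<Sum>t\<leftarrow>L. if big \<delta> (fst t) then shift_seq (fst (snd t) + e (fst t)) (hilb (fst t)) m else 0)" for L
        by (induction L) (auto simp: Bs_def F_def)
      moreover have "hilb A (q * m) = (\<Sum>t\<leftarrow>Lq. shift_seq (fst (snd t)) (hilb (fst t)) m)"
        using prime_filt_rlen[OF q(1) A Lq(1), of m] Lq(2) by (simp add: hilb_def)
      moreover have "hilb A (q * m + r) = rlen (A (q * m + r)) (N m) + rlen (N m) (G (q * m + r))"
        unfolding hilb_def N_def
        by (rule rlen_additive[OF finite_len_G homog_ksub[OF A] fspan_ksub[OF q(1) homog_G A vB]
              fspan_base[OF q(1) homog_G A vB] fspan_sub[OF q(1) homog_G A vB]])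
      moreover have "(\<Sum>t\<leftarrow>L. if big \<delta> (fst t) then u t - v t else u t) =
          (\<Sum>t\<leftarrow>L. u t) - (\<Sum>t\<leftarrow>L. if big \<delta> (fst t) then v t else 0)"
        for L and u v :: "(nat \<Rightarrow> 'a set) \<times> nat \<times> 'a \<Rightarrow> real"
        by (induction L) auto
      ultimately show ?thesis by simp
    qed
    moreover have "growth \<delta> (\<lambda>m. hilb A (q * m + r) - hilb A (q * m))"
      using growth_affine[OF eventually_poly_growth[OF eventually_poly_diff_shift[OF hA, of r]] frob_pos[OF q(1)], of 0]
      by simp
    moreover have "growth \<delta> (\<lambda>m. if big \<delta> (fst t)
        then shift_seq (fst (snd t)) (hilb (fst t)) m - shift_seq (fst (snd t) + e (fst t)) (hilb (fst t)) m
        else shift_seq (fst (snd t)) (hilb (fst t)) m)" if t: "t \<in> set Lq" for t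
    proof (cases "big \<delta> (fst t)")
      case True
      have ep: "eventually_poly (Suc \<delta>) (hilb (fst t))" using bound True by (simp add: big_def)
      have "growth \<delta> (\<lambda>m. (hilb (fst t) m - shift_seq (fst (snd t) + e (fst t)) (hilb (fst t)) m)
          - (hilb (fst t) m - shift_seq (fst (snd t)) (hilb (fst t)) m))"
        by (intro growth_diff eventually_poly_growth eventually_poly_diff_shift_seq ep)
      then show ?thesis using True by simp
    next
      case False
      have "hprime (fst t)" using prime_filt_prime_ge[OF q(1) A Lq(1) t] by blast
      then show ?thesis using False by (simp add: big_def growth_shift_seq)
    qed
    ultimately show "growth \<delta> (\<lambda>m. rlen (fspan q r G A (map snd (Bs r Lq)) m) (G (q * m + r)))"
      unfolding N_def by (simp only:) (intro growth_add growth_sum_list)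
  qed
  show thesis using that[of Ps] Ps main by blast
qed

end

section \<open>Convergence of the normalized lengths\<close>

text \<open>Refining the sampling by a factor \<open>q\<close> keeps the sample in the block of
  degrees \<open>q * m + r\<close> over the old degree \<open>m\<close>, which is the form
  \<open>comparison\<close> handles.\<close>

lemma nat_floor_mult:
  assumes "y \<ge> 0" "q > 0" obtains r where "r < q" "nat \<lfloor>y * real q\<rfloor> = q * nat \<lfloor>y\<rfloor> + r"
proof -
  define k where "k = nat \<lfloor>y\<rfloor>"
  have k: "real k \<le> y" "y < real k + 1" using assms(1) by (auto simp: k_def)
  have "real k * real q \<le> y * real q" "y * real q < (real k + 1) * real q"
    using k assms(2) by (auto intro: mult_right_mono mult_strict_right_mono)
  then have "real (k * q) \<le> y * real q" "y * real q < real (k * q + q)" by (auto simp: algebra_simps)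
  then have "int (k * q) \<le> \<lfloor>y * real q\<rfloor>" "\<lfloor>y * real q\<rfloor> < int (k * q + q)"
    by (simp_all add: le_floor_iff floor_less_iff)
  then have "k * q \<le> nat \<lfloor>y * real q\<rfloor>" "nat \<lfloor>y * real q\<rfloor> < k * q + q" by linarith+
  then show thesis using that[of "nat \<lfloor>y * real q\<rfloor> - k * q"] by (simp add: k_def mult.commute)
qed

lemma shift_seq_add: "shift_seq a (\<lambda>m. u m + v m) m = shift_seq a u m + shift_seq a v m"
  by (simp add: shift_seq_def)

lemma shift_seq_mono: "(\<And>m. u m \<le> v m) \<Longrightarrow> shift_seq a u m \<le> shift_seq a v m"
  by (simp add: shift_seq_def)

text \<open>The right-hand side of \<open>comparison\<close>. It sees the generators only through
  their degrees.\<close>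

definition err :: "(nat \<Rightarrow> real) \<Rightarrow> (nat \<times> 'b) list \<Rightarrow> nat \<Rightarrow> real" where
  "err u hs m = u m + (\<Sum>t\<leftarrow>hs. shift_seq (fst t) u m)"

lemma err_add: "err (\<lambda>m. u m + v m) hs m = err u hs m + err v hs m"
  by (simp add: err_def shift_seq_add sum_list_addf)

lemma err_mono: "(\<And>m. u m \<le> v m) \<Longrightarrow> err u hs m \<le> err v hs m"
  unfolding err_def by (intro add_mono sum_list_mono shift_seq_mono) auto

lemma err_zero: "err (\<lambda>m. 0) hs m = 0"
  by (simp add: err_def shift_seq_def)

lemma err_sum_list: "err (\<lambda>m. \<Sum>t\<leftarrow>ts. f t m) hs m = (\<Sum>t\<leftarrow>ts. err (f t) hs m)"
  by (induction ts) (auto simp: err_zero err_add)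

text \<open>For \<open>\<delta> = 0\<close> the sequence is nonzero only at bounded indices, hence only for bounded \<open>q n\<close>, as \<open>x > 0\<close>.
  The same reason excludes the degrees of the generators in \<open>err_sampled_bound\<close>.\<close>

lemma growth_sampled_bound:
  assumes g: "growth \<delta> u" and u: "\<And>m. u m \<ge> 0" and x: "x > 0" and q: "\<And>n. q n \<ge> (1::nat)"
  shows "\<exists>K\<ge>0. \<forall>n. u (nat \<lfloor>x * real (q n)\<rfloor>) * real (q n) \<le> K * real (q n) ^ \<delta>"
proof (cases \<delta>)
  case 0
  then obtain C where C: "\<And>m. m \<ge> C \<Longrightarrow> u m = 0" using g unfolding growth_def by auto
  define B where "B = (\<Sum>m<C. u m)"
  have B0: "B \<ge> 0" unfolding B_def by (intro sum_nonneg) (use u in auto)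
  have "u (nat \<lfloor>x * real (q n)\<rfloor>) * real (q n) \<le> B * (real C / x)" for n
  proof (cases "nat \<lfloor>x * real (q n)\<rfloor> < C")
    case True
    then have "x * real (q n) < real C" by linarith
    then have "real (q n) \<le> real C / x" using x by (simp add: field_simps)
    moreover have "u (nat \<lfloor>x * real (q n)\<rfloor>) \<le> B" unfolding B_def
      by (rule member_le_sum) (use True u in auto)
    ultimately show ?thesis using u by (intro mult_mono) (auto simp: B0)
  next
    case False
    then show ?thesis using C[of "nat \<lfloor>x * real (q n)\<rfloor>"] B0 x by simp
  qed
  then show ?thesis using 0 B0 x by (intro exI[of _ "B * (real C / x)"]) auto
next
  case (Suc k)
  then obtain C :: nat where C: "\<And>m. u m \<le> real C * (real m + 1) ^ k"
    using g u unfolding growth_def by auto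
  have "u (nat \<lfloor>x * real (q n)\<rfloor>) * real (q n) \<le> (real C * (x + 1) ^ k) * real (q n) ^ \<delta>" for n
  proof -
    have "real (nat \<lfloor>x * real (q n)\<rfloor>) + 1 \<le> (x + 1) * real (q n)"
    proof -
      have "real (nat \<lfloor>x * real (q n)\<rfloor>) \<le> x * real (q n)" using x by (intro of_nat_floor) simp
      moreover have "1 \<le> real (q n)" using q[of n] by simp
      ultimately show ?thesis by (simp add: algebra_simps)
    qed
    then have "(real (nat \<lfloor>x * real (q n)\<rfloor>) + 1) ^ k \<le> ((x + 1) * real (q n)) ^ k"
      by (intro power_mono) auto
    then have "u (nat \<lfloor>x * real (q n)\<rfloor>) \<le> real C * ((x + 1) * real (q n)) ^ k"
      using C[of "nat \<lfloor>x * real (q n)\<rfloor>"] by (smt (verit) mult_left_mono of_nat_0_le_iff)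
    then have "u (nat \<lfloor>x * real (q n)\<rfloor>) * real (q n) \<le> real C * ((x + 1) * real (q n)) ^ k * real (q n)"
      by (intro mult_right_mono) auto
    then show ?thesis using Suc by (simp add: power_mult_distrib mult_ac)
  qed
  then show ?thesis using x by (intro exI[of _ "real C * (x + 1) ^ k"]) auto
qed

text \<open>Subtracting a generator degree \<open>q n * a\<close> from the sample at
  \<open>x * q n\<close> gives exactly the sample at \<open>(x - a) * q n\<close>. For
  \<open>x > a\<close> the bound for \<open>u\<close> applies at \<open>x - a\<close>, and for
  \<open>x < a\<close> the term vanishes. The bound says that the error is smaller than the main
  term by a factor of order \<open>q n\<close>.\<close>

lemma err_sampled_bound:
  assumes g: "growth \<delta> u" and u: "\<And>m. u m \<ge> 0" and x: "x > 0" and q: "\<And>n. q n \<ge> (1::nat)"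
    and "\<And>t. t \<in> set hs \<Longrightarrow> x \<noteq> real (fst t)"
  shows "\<exists>K\<ge>0. \<forall>n. err u (map (\<lambda>t. (q n * fst t, f n t)) hs) (nat \<lfloor>x * real (q n)\<rfloor>) * real (q n) \<le> K * real (q n) ^ \<delta>"
  using assms(5)
proof (induction hs)
  case Nil
  show ?case using growth_sampled_bound[OF g u x, of q] q by (simp add: err_def)
next
  case (Cons t hs)
  then obtain K where K: "K \<ge> 0" "\<And>n. err u (map (\<lambda>t. (q n * fst t, f n t)) hs) (nat \<lfloor>x * real (q n)\<rfloor>) * real (q n) \<le> K * real (q n) ^ \<delta>"
    by auto
  have "\<exists>L\<ge>0. \<forall>n. shift_seq (q n * fst t) u (nat \<lfloor>x * real (q n)\<rfloor>) * real (q n) \<le> L * real (q n) ^ \<delta>"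
  proof (cases "x < real (fst t)")
    case True
    have "\<not> q n * fst t \<le> nat \<lfloor>x * real (q n)\<rfloor>" for n
    proof
      assume "q n * fst t \<le> nat \<lfloor>x * real (q n)\<rfloor>"
      then have "real (q n * fst t) \<le> real (nat \<lfloor>x * real (q n)\<rfloor>)" by (rule of_nat_mono)
      also have "\<dots> \<le> x * real (q n)" using x by (intro of_nat_floor) simp
      finally have "real (fst t) * real (q n) \<le> x * real (q n)" by (simp add: mult.commute)
      then show False using True q[of n] by (simp add: mult_le_cancel_right)
    qed
    then show ?thesis by (intro exI[of _ 0]) (simp add: shift_seq_def)
  next
    case False
    then have pos: "x - real (fst t) > 0" using Cons.prems[of t] by simp
    obtain L where L: "L \<ge> 0" "\<And>n. u (nat \<lfloor>(x - real (fst t)) * real (q n)\<rfloor>) * real (q n) \<le> L * real (q n) ^ \<delta>"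
      using growth_sampled_bound[OF g u pos, of q] q by auto
    have "shift_seq (q n * fst t) u (nat \<lfloor>x * real (q n)\<rfloor>) = u (nat \<lfloor>(x - real (fst t)) * real (q n)\<rfloor>)" for n
    proof -
      have eq: "(x - real (fst t)) * real (q n) = x * real (q n) - real_of_int (int (q n * fst t))" by (simp add: algebra_simps)
      have "\<lfloor>(x - real (fst t)) * real (q n)\<rfloor> = \<lfloor>x * real (q n)\<rfloor> - int (q n * fst t)" unfolding eq by (rule floor_diff_of_int)
      moreover have "0 \<le> \<lfloor>(x - real (fst t)) * real (q n)\<rfloor>" using pos by simp
      ultimately have "nat \<lfloor>(x - real (fst t)) * real (q n)\<rfloor> = nat \<lfloor>x * real (q n)\<rfloor> - q n * fst t"
        "q n * fst t \<le> nat \<lfloor>x * real (q n)\<rfloor>" by linarith+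
      then show ?thesis by (simp add: shift_seq_def)
    qed
    then show ?thesis using L by auto
  qed
  then obtain L where L: "L \<ge> 0" "\<And>n. shift_seq (q n * fst t) u (nat \<lfloor>x * real (q n)\<rfloor>) * real (q n) \<le> L * real (q n) ^ \<delta>"
    by blast
  have "err u (map (\<lambda>t. (q n * fst t, f n t)) (t # hs)) (nat \<lfloor>x * real (q n)\<rfloor>) * real (q n) \<le> (K + L) * real (q n) ^ \<delta>" for n
    using add_mono[OF K(2)[of n] L(2)[of n]] by (simp add: err_def algebra_simps)
  then show ?case using K(1) L(1) by (intro exI[of _ "K + L"]) auto
qed

lemma geometric_Cauchy:
  fixes g :: "nat \<Rightarrow> real"
  assumes p: "p \<ge> (2::nat)" and step: "\<And>n. \<bar>g (Suc n) - g n\<bar> \<le> K / real p ^ n"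
  shows "convergent g"
proof -
  have "summable (\<lambda>n. K * (1 / real p) ^ n)"
    using p by (intro summable_mult summable_geometric) auto
  then have "summable (\<lambda>n. g (Suc n) - g n)"
    by (rule summable_comparison_test'[where N = 0]) (use step in \<open>simp add: power_one_over\<close>)
  then have "convergent (\<lambda>n. \<Sum>i<n. g (Suc i) - g i)" by (simp add: summable_iff_convergent)
  then have "convergent (\<lambda>n. (\<Sum>i<n. g (Suc i) - g i) + g 0)" by (intro convergent_add convergent_const)
  then show ?thesis by (simp add: sum_lessThan_telescope)
qed

context graded_algebra
begin

lemma frob_mult: assumes a: "frob a" and b: "frob b" shows "frob (a * b)"
  unfolding frob_def
proof (intro conjI ballI)
  show "a * b > 0" using a b frob_pos by simp
  show "(x \<oplus> y) [^] (a * b) = x [^] (a * b) \<oplus> y [^] (a * b)" if "x \<in> carrier R" "y \<in> carrier R" for x y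
    using that by (simp add: nat_pow_pow[symmetric] frob_add[OF a] frob_add[OF b])
  fix c assume "c \<in> G 0"
  then obtain d where d: "d \<in> G 0" "d [^] b = c" using b by (auto simp: frob_def)
  then obtain f where f: "f \<in> G 0" "f [^] a = d" using a by (auto simp: frob_def)
  show "\<exists>d\<in>G 0. d [^] (a * b) = c"
    using f d G_carrier[OF f(1)] by (intro bexI[of _ f]) (simp_all add: nat_pow_pow[symmetric])
qed

lemma frob_power: "frob p \<Longrightarrow> frob (p ^ n)"
  by (induction n) (use frob_1 in \<open>auto intro: frob_mult\<close>)

lemma pow_gens_pow_gens: "valid 1 0 hs \<Longrightarrow> pow_gens a (pow_gens b hs) = pow_gens (b * a) hs"
  using G_carrier by (auto simp: pow_gens_def valid_def nat_pow_pow)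

lemma pow_gens_1: "valid 1 0 hs \<Longrightarrow> pow_gens 1 hs = hs"
  using G_carrier by (auto simp: pow_gens_def valid_def intro!: map_idI)

text \<open>This is \<open>comparison\<close> with \<open>q = 1\<close> for the frame consisting of
  one power \<open>y\<close> of a linear form outside \<open>P\<close>: modulo \<open>P\<close>,
  multiplication by \<open>y\<close> is injective and its cokernel has lower order. It serves to
  drop the shifts by which the copies in a frame differ.\<close>

lemma prime_shift:
  assumes bound: "\<And>P. hprime P \<Longrightarrow> eventually_poly (Suc \<delta>) (hilb P)" and P: "big \<delta> P"
  shows "\<exists>u. growth \<delta> u \<and> (\<forall>m. u m \<ge> 0) \<and> (\<forall>hs m. valid 1 0 hs \<longrightarrow>
    \<bar>hilb (fspan 1 0 G P hs) m - shift_seq a (hilb (fspan 1 0 G P hs)) m\<bar> \<le> err u hs m)"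
proof -
  have hp: "hprime P" using P by (simp add: big_def)
  note h = hprime_homog[OF hp]
  obtain x where x: "x \<in> G 1" "x \<notin> P 1" using big_linear_form[OF P] by blast
  define y where "y = x [^] a"
  have yG: "y \<in> G a" using G_pow[OF x(1), of a] by (simp add: y_def)
  have yP: "y \<notin> P a" using hprime_pow[OF hp x(1), of a] x(2) by (auto simp: y_def)
  have fr: "frame 1 0 P [(P, a, y)]"
    using h yG homog_mult2[OF h yG] homog_carrier[OF h] hprime_mult[OF hp _ yG] yP G_carrier by auto
  define C where "C m = rlen (fspan 1 0 G P [(a, y)] m) (G (1 * m + 0))" for m
  have "C m = hilb P m - shift_seq a (hilb P) m" for m
    using hilb_adjoin[OF hp yG yP, of m] by (simp add: C_def hilb_def)
  then have "growth \<delta> C"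
    using eventually_poly_growth[OF eventually_poly_diff_shift_seq[OF bound[OF hp]]] by presburger
  moreover have "\<bar>hilb (fspan 1 0 G P hs) m - shift_seq a (hilb (fspan 1 0 G P hs)) m\<bar> \<le> err C hs m"
    if v: "valid 1 0 hs" for hs m
    using comparison[OF frob_1 zero_less_one h fr v, of m] unfolding err_def C_def pow_gens_1[OF v] by simp
  moreover have "C m \<ge> 0" for m by (simp add: C_def)
  ultimately show ?thesis by blast
qed

text \<open>For each residue \<open>comparison\<close> applies to a frame, and
  \<open>prime_shift\<close> removes the degrees of its entries at the cost of further errors.
  Because the frames have the same primes \<open>Ps\<close> for all residues, the main term is
  independent of \<open>r\<close>.\<close>

theorem frobenius_step:
  assumes bound: "\<And>P. hprime P \<Longrightarrow> eventually_poly (Suc \<delta>) (hilb P)"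
    and A: "homog A" and hA: "eventually_poly (Suc \<delta>) (hilb A)"
    and L1: "prime_filt 1 A L1" "fspan 1 0 G A (map snd L1) = G" and q: "frob q" "length L1 \<le> q"
  obtains Ps u where "\<And>P. P \<in> set Ps \<Longrightarrow> big \<delta> P \<and> A \<le> P" "growth \<delta> u" "\<And>m. u m \<ge> 0"
    "\<And>hs r m. valid 1 0 hs \<Longrightarrow> r < q \<Longrightarrow>
      \<bar>hilb (fspan 1 0 G A (pow_gens q hs)) (q * m + r) - (\<Sum>P\<leftarrow>Ps. hilb (fspan 1 0 G P hs) m)\<bar> \<le> err u hs m"
proof -
  obtain Ps where Ps: "\<And>P. P \<in> set Ps \<Longrightarrow> big \<delta> P \<and> A \<le> P"
    and fr: "\<And>r. r < q \<Longrightarrow> \<exists>Bs. frame q r A Bs \<and> map fst Bs = Ps \<and>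
        growth \<delta> (\<lambda>m. rlen (fspan q r G A (map snd Bs) m) (G (q * m + r)))"
    using exists_frames[OF bound A hA L1 q] by blast
  have "\<forall>r. \<exists>u. r < q \<longrightarrow> growth \<delta> u \<and> (\<forall>m. u m \<ge> 0) \<and> (\<forall>hs m. valid 1 0 hs \<longrightarrow>
      \<bar>hilb (fspan 1 0 G A (pow_gens q hs)) (q * m + r) - (\<Sum>P\<leftarrow>Ps. hilb (fspan 1 0 G P hs) m)\<bar> \<le> err u hs m)"
  proof
    fix r
    show "\<exists>u. r < q \<longrightarrow> growth \<delta> u \<and> (\<forall>m. u m \<ge> 0) \<and> (\<forall>hs m. valid 1 0 hs \<longrightarrow>
      \<bar>hilb (fspan 1 0 G A (pow_gens q hs)) (q * m + r) - (\<Sum>P\<leftarrow>Ps. hilb (fspan 1 0 G P hs) m)\<bar> \<le> err u hs m)"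
    proof (cases "r < q")
      case r: True
      obtain Bs where Bs: "frame q r A Bs" "map fst Bs = Ps"
        "growth \<delta> (\<lambda>m. rlen (fspan q r G A (map snd Bs) m) (G (q * m + r)))"
        using fr[OF r] by blast
      define C where "C m = rlen (fspan q r G A (map snd Bs) m) (G (q * m + r))" for m
      have "\<forall>t. \<exists>v. t \<in> set Bs \<longrightarrow> growth \<delta> v \<and> (\<forall>m. v m \<ge> 0) \<and> (\<forall>hs m. valid 1 0 hs \<longrightarrow>
        \<bar>hilb (fspan 1 0 G (fst t) hs) m - shift_seq (fst (snd t)) (hilb (fspan 1 0 G (fst t) hs)) m\<bar> \<le> err v hs m)"
      proof
        fix t
        have "big \<delta> (fst t)" if "t \<in> set Bs" using Ps[of "fst t"] Bs(2) that by auto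
        then show "\<exists>v. t \<in> set Bs \<longrightarrow> growth \<delta> v \<and> (\<forall>m. v m \<ge> 0) \<and> (\<forall>hs m. valid 1 0 hs \<longrightarrow>
          \<bar>hilb (fspan 1 0 G (fst t) hs) m - shift_seq (fst (snd t)) (hilb (fspan 1 0 G (fst t) hs)) m\<bar> \<le> err v hs m)"
          using prime_shift[OF bound, of "fst t" "fst (snd t)"] by metis
      qed
      from choice[OF this] obtain v where v: "\<And>t. t \<in> set Bs \<Longrightarrow> growth \<delta> (v t)" "\<And>t m. t \<in> set Bs \<Longrightarrow> v t m \<ge> 0"
        "\<And>t hs m. t \<in> set Bs \<Longrightarrow> valid 1 0 hs \<Longrightarrow>
        \<bar>hilb (fspan 1 0 G (fst t) hs) m - shift_seq (fst (snd t)) (hilb (fspan 1 0 G (fst t) hs)) m\<bar> \<le> err (v t) hs m"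
        by metis
      define u where "u m = C m + (\<Sum>t\<leftarrow>Bs. v t m)" for m
      have "growth \<delta> u" unfolding u_def[abs_def]
        by (intro growth_add growth_sum_list v(1)) (use Bs(3) in \<open>auto simp: C_def[abs_def]\<close>)
      moreover have "u m \<ge> 0" for m unfolding u_def C_def
        by (intro add_nonneg_nonneg rlen_nonneg sum_list_nonneg) (use v(2) in auto)
      moreover have "\<bar>hilb (fspan 1 0 G A (pow_gens q hs)) (q * m + r) - (\<Sum>P\<leftarrow>Ps. hilb (fspan 1 0 G P hs) m)\<bar> \<le> err u hs m"
        if hs: "valid 1 0 hs" for hs m
      proof -
        let ?h = "\<lambda>t. hilb (fspan 1 0 G (fst t) hs) m"
        let ?s = "\<lambda>t. shift_seq (fst (snd t)) (hilb (fspan 1 0 G (fst t) hs)) m"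
        have 1: "\<bar>hilb (fspan 1 0 G A (pow_gens q hs)) (q * m + r) - (\<Sum>t\<leftarrow>Bs. ?s t)\<bar> \<le> err C hs m"
          using comparison[OF q(1) r A Bs(1) hs, of m] unfolding err_def C_def .
        have 2: "\<bar>(\<Sum>t\<leftarrow>bs. ?h t) - (\<Sum>t\<leftarrow>bs. ?s t)\<bar> \<le> (\<Sum>t\<leftarrow>bs. err (v t) hs m)" if "set bs \<subseteq> set Bs" for bs
          using that
        proof (induction bs)
          case (Cons t bs)
          then show ?case using v(3)[of t hs m] hs by (auto simp: abs_le_iff)
        qed simp
        have "err u hs m = err C hs m + (\<Sum>t\<leftarrow>Bs. err (v t) hs m)"
          unfolding u_def[abs_def] err_add err_sum_list ..
        moreover have "(\<Sum>P\<leftarrow>Ps. hilb (fspan 1 0 G P hs) m) = (\<Sum>t\<leftarrow>Bs. ?h t)"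
          using Bs(2)[symmetric] by (simp add: comp_def)
        ultimately show ?thesis using 1 2[of Bs] by simp
      qed
      ultimately show ?thesis by blast
    qed simp
  qed
  from choice[OF this] obtain u where u: "\<And>r. r < q \<Longrightarrow> growth \<delta> (u r)" "\<And>r m. r < q \<Longrightarrow> u r m \<ge> 0"
    "\<And>r hs m. r < q \<Longrightarrow> valid 1 0 hs \<Longrightarrow>
      \<bar>hilb (fspan 1 0 G A (pow_gens q hs)) (q * m + r) - (\<Sum>P\<leftarrow>Ps. hilb (fspan 1 0 G P hs) m)\<bar> \<le> err (u r) hs m"
    by metis
  \<comment> \<open>There are only finitely many residues, so the sum of their errors is one error
    for all.\<close>
  define U where "U m = (\<Sum>r\<leftarrow>[0..<q]. u r m)" for m
  have le: "u r m \<le> U m" if "r < q" for r m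
    unfolding U_def using that u(2) by (intro member_le_sum_list) auto
  show thesis
  proof (rule that)
    show "growth \<delta> U" unfolding U_def[abs_def] by (rule growth_sum_list) (use u(1) in auto)
    show "U m \<ge> 0" for m unfolding U_def by (rule sum_list_nonneg) (use u(2) in auto)
    show "\<bar>hilb (fspan 1 0 G A (pow_gens q hs)) (q * m + r) - (\<Sum>P\<leftarrow>Ps. hilb (fspan 1 0 G P hs) m)\<bar> \<le> err U hs m"
      if "valid 1 0 hs" "r < q" for hs r m
      using u(3)[OF that(2,1), of m] by (rule order_trans) (rule err_mono[OF le[OF that(2)]])
  qed (use Ps in auto)
qed

text \<open>The ring modulo \<open>P\<close> has a filtration of length 1, so every \<open>q\<close>
  is admissible, and \<open>big_minimal\<close> forces all of \<open>Ps\<close> to equal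
  \<open>P\<close>. The number of copies is determined by the empty list of generators, where the
  estimate compares \<open>hilb P (q * m)\<close> with a multiple of \<open>hilb P m\<close> and
  \<open>growth_ratio\<close> applies.\<close>

theorem frobenius_step_prime:
  assumes bound: "\<And>P. hprime P \<Longrightarrow> eventually_poly (Suc \<delta>) (hilb P)" and P: "big \<delta> P" and q: "frob q"
  obtains u where "growth \<delta> u" "\<And>m. u m \<ge> 0"
    "\<And>hs r m. valid 1 0 hs \<Longrightarrow> r < q \<Longrightarrow>
      \<bar>hilb (fspan 1 0 G P (pow_gens q hs)) (q * m + r) - real q ^ \<delta> * hilb (fspan 1 0 G P hs) m\<bar> \<le> err u hs m"
proof -
  have hp: "hprime P" using P by (simp add: big_def)
  note h = hprime_homog[OF hp]
  let ?L = "[(P, 0, \<one>)]"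
  have L: "prime_filt 1 P ?L" using hp one_G0 G_carrier by auto
  have full: "fspan 1 0 G P (map snd ?L) = G"
    by (rule homog_one[OF homog_fspan[OF h prime_filt_valid[OF L]]]) (use fspan_mem1[OF h prime_filt_valid[OF L], of "(0, \<one>)"] in simp)
  have len: "length ?L \<le> q" using frob_pos[OF q] by simp
  obtain Ps u where Ps: "\<And>Q. Q \<in> set Ps \<Longrightarrow> big \<delta> Q \<and> P \<le> Q" and u: "growth \<delta> u" "\<And>m. u m \<ge> 0"
    and step: "\<And>hs r m. valid 1 0 hs \<Longrightarrow> r < q \<Longrightarrow>
      \<bar>hilb (fspan 1 0 G P (pow_gens q hs)) (q * m + r) - (\<Sum>P\<leftarrow>Ps. hilb (fspan 1 0 G P hs) m)\<bar> \<le> err u hs m"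
    using frobenius_step[OF bound h bound[OF hp] L full q len] by metis
  have "Q = P" if "Q \<in> set Ps" for Q using big_minimal[OF bound _ hp, of Q] Ps[OF that] by simp
  then have sum: "(\<Sum>P\<leftarrow>Ps. hilb (fspan 1 0 G P hs) m) = real (length Ps) * hilb (fspan 1 0 G P hs) m" for hs m
    by (induction Ps) (auto simp: algebra_simps)
  have nil: "fspan 1 0 G P [] = P" by (rule ext) simp
  have "growth \<delta> (\<lambda>m. hilb P (q * m) - real (length Ps) * hilb P m)"
  proof (rule growth_le[OF u(1)])
    show "\<bar>hilb P (q * m) - real (length Ps) * hilb P m\<bar> \<le> \<bar>u m\<bar>" for m
      using step[of "[]" 0 m] frob_pos[OF q] u(2)[of m] unfolding sum pow_gens_def list.map nil
      by (simp add: err_def)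
  qed
  then have "real (length Ps) = real q ^ \<delta>"
    using growth_ratio[OF bound[OF hp] _ frob_pos[OF q]] P by (simp add: big_def)
  then show thesis using that[OF u] step sum by metis
qed

text \<open>The main term of a step multiplies by \<open>p ^ \<delta>\<close>, exactly as the
  normalization does. The sampled error is one order smaller, so successive terms differ by a
  geometric sequence.\<close>

lemma prime_limit:
  assumes bound: "\<And>P. hprime P \<Longrightarrow> eventually_poly (Suc \<delta>) (hilb P)" and P: "big \<delta> P"
    and p: "frob p" "p \<ge> 2" and hs: "valid 1 0 hs" and x: "x > 0" "\<And>t. t \<in> set hs \<Longrightarrow> x \<noteq> real (fst t)"
  shows "convergent (\<lambda>n. hilb (fspan 1 0 G P (pow_gens (p ^ n) hs)) (nat \<lfloor>x * real (p ^ n)\<rfloor>) / real (p ^ n) ^ \<delta>)"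
    (is "convergent ?g")
proof -
  obtain u where u: "growth \<delta> u" "\<And>m. u m \<ge> 0"
    and step: "\<And>hs r m. valid 1 0 hs \<Longrightarrow> r < p \<Longrightarrow>
      \<bar>hilb (fspan 1 0 G P (pow_gens p hs)) (p * m + r) - real p ^ \<delta> * hilb (fspan 1 0 G P hs) m\<bar> \<le> err u hs m"
    using frobenius_step_prime[OF bound P p(1)] by metis
  have "\<exists>K\<ge>0. \<forall>n. err u (map (\<lambda>t. (p ^ n * fst t, snd t [^] (p ^ n))) hs) (nat \<lfloor>x * real (p ^ n)\<rfloor>) * real (p ^ n) \<le> K * real (p ^ n) ^ \<delta>"
    by (rule err_sampled_bound[OF u x(1) _ x(2)]) (use p in auto)
  then obtain K where K: "K \<ge> 0"
    "\<And>n. err u (pow_gens (p ^ n) hs) (nat \<lfloor>x * real (p ^ n)\<rfloor>) * real (p ^ n) \<le> K * real (p ^ n) ^ \<delta>"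
    unfolding pow_gens_def by blast
  show ?thesis
  proof (rule geometric_Cauchy[OF p(2), where K = K])
    fix n
    define q where "q = real (p ^ n)"
    have q: "q > 0" using p(2) by (simp add: q_def)
    define m where "m = nat \<lfloor>x * real (p ^ n)\<rfloor>"
    have "0 \<le> x * real (p ^ n)" using x(1) by simp
    then obtain r where r: "r < p" "nat \<lfloor>x * real (p ^ n) * real p\<rfloor> = p * m + r"
      using nat_floor_mult[of "x * real (p ^ n)" p] p(2) unfolding m_def by auto
    have r': "nat \<lfloor>x * real (p ^ Suc n)\<rfloor> = p * m + r" using r(2) by (simp add: mult_ac)
    define h where "h = hilb (fspan 1 0 G P (pow_gens (p ^ n) hs)) m"
    define h' where "h' = hilb (fspan 1 0 G P (pow_gens (p ^ Suc n) hs)) (p * m + r)"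
    have pp: "pow_gens p (pow_gens (p ^ n) hs) = pow_gens (p ^ Suc n) hs"
      using pow_gens_pow_gens[OF hs] by (simp add: mult.commute)
    have "\<bar>h' - real p ^ \<delta> * h\<bar> \<le> err u (pow_gens (p ^ n) hs) m"
      using step[OF valid_pow_gens[OF hs, of "p ^ n"] r(1), of m] unfolding pp h_def h'_def .
    also have "\<dots> \<le> K * q ^ \<delta> / q" using K(2)[of n] q by (simp add: field_simps q_def m_def)
    finally have *: "\<bar>h' - real p ^ \<delta> * h\<bar> \<le> K * q ^ \<delta> / q" .
    have g: "?g (Suc n) - ?g n = (h' - real p ^ \<delta> * h) / (real p ^ \<delta> * q ^ \<delta>)"
      unfolding r' h'_def[symmetric] m_def[symmetric] h_def[symmetric] q_def
      using p(2) by (simp add: field_simps power_mult_distrib)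
    have pos: "real p ^ \<delta> * q ^ \<delta> > 0" using p(2) q by simp
    have "\<bar>?g (Suc n) - ?g n\<bar> \<le> (K * q ^ \<delta> / q) / (real p ^ \<delta> * q ^ \<delta>)"
    proof -
      have "\<bar>?g (Suc n) - ?g n\<bar> = \<bar>h' - real p ^ \<delta> * h\<bar> / (real p ^ \<delta> * q ^ \<delta>)"
        unfolding g abs_divide using pos by (simp only: abs_of_pos)
      also have "\<dots> \<le> (K * q ^ \<delta> / q) / (real p ^ \<delta> * q ^ \<delta>)"
        by (rule divide_right_mono[OF *]) (use pos in simp)
      finally show ?thesis .
    qed
    also have "\<dots> = (K / q) * (1 / real p ^ \<delta>)" using q by (simp add: field_simps)
    also have "\<dots> \<le> (K / q) * 1" using p(2) K(1) q by (intro mult_left_mono) (auto simp: one_le_power)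
    finally show "\<bar>?g (Suc n) - ?g n\<bar> \<le> K / real p ^ n" by (simp add: q_def)
  qed
qed

text \<open>One Frobenius step of fixed size \<open>q = p ^ e\<close> replaces the ring by the
  primes \<open>Ps\<close>, for which the limits exist. The term of index \<open>n + e\<close> is
  then close to the sum of the prime terms of index \<open>n\<close>, divided by
  \<open>q ^ \<delta>\<close>.\<close>

theorem normalized_length_convergent:
  assumes bound: "\<And>P. hprime P \<Longrightarrow> eventually_poly (Suc \<delta>) (hilb P)" and hZ: "eventually_poly (Suc \<delta>) (hilb Z)"
    and p: "frob p" "p \<ge> 2" and hs: "valid 1 0 hs" and x: "x > 0" "\<And>t. t \<in> set hs \<Longrightarrow> x \<noteq> real (fst t)"
  shows "convergent (\<lambda>n. hilb (fspan 1 0 G Z (pow_gens (p ^ n) hs)) (nat \<lfloor>x * real (p ^ n)\<rfloor>) / real (p ^ n) ^ \<delta>)"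
    (is "convergent ?f")
proof -
  obtain L where L: "prime_filt 1 Z L" "fspan 1 0 G Z (map snd L) = G" using prime_filt_exists_1[OF homog_Z] by blast
  \<comment> \<open>Any exponent with \<open>p ^ e\<close> at least the length of \<open>L\<close>
    would do, and \<open>p \<ge> 2\<close> makes this one suffice.\<close>
  define e where "e = length L"
  define q where "q = p ^ e"
  have lq: "length L \<le> q" unfolding q_def e_def using p(2) by (meson less_exp order.strict_implies_order power_mono le_trans zero_le)
  have fq: "frob q" unfolding q_def by (rule frob_power[OF p(1)])
  have q0: "real q > 0" using frob_pos[OF fq] by simp
  obtain Ps u where Ps: "\<And>P. P \<in> set Ps \<Longrightarrow> big \<delta> P \<and> Z \<le> P" and u: "growth \<delta> u" "\<And>m. u m \<ge> 0"
    and step: "\<And>hs r m. valid 1 0 hs \<Longrightarrow> r < q \<Longrightarrow>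
      \<bar>hilb (fspan 1 0 G Z (pow_gens q hs)) (q * m + r) - (\<Sum>P\<leftarrow>Ps. hilb (fspan 1 0 G P hs) m)\<bar> \<le> err u hs m"
    using frobenius_step[OF bound homog_Z hZ L fq lq] by metis
  define g where "g P n = hilb (fspan 1 0 G P (pow_gens (p ^ n) hs)) (nat \<lfloor>x * real (p ^ n)\<rfloor>) / real (p ^ n) ^ \<delta>" for P n
  have "convergent (g P)" if "P \<in> set Ps" for P
    unfolding g_def using prime_limit[OF bound _ p hs x] Ps[OF that] by blast
  then have "convergent (\<lambda>n. \<Sum>P\<leftarrow>Ps. g P n)"
    by (induction Ps) (auto intro!: convergent_const convergent_add)
  then have conv: "convergent (\<lambda>n. (\<Sum>P\<leftarrow>Ps. g P n) / real q ^ \<delta>)"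
    by (auto simp: convergent_def divide_inverse intro: tendsto_mult_right)
  have "\<exists>K\<ge>0. \<forall>n. err u (map (\<lambda>t. (p ^ n * fst t, snd t [^] (p ^ n))) hs) (nat \<lfloor>x * real (p ^ n)\<rfloor>) * real (p ^ n) \<le> K * real (p ^ n) ^ \<delta>"
    by (rule err_sampled_bound[OF u x(1) _ x(2)]) (use p in auto)
  then obtain K where K: "K \<ge> 0"
    "\<And>n. err u (pow_gens (p ^ n) hs) (nat \<lfloor>x * real (p ^ n)\<rfloor>) * real (p ^ n) \<le> K * real (p ^ n) ^ \<delta>"
    unfolding pow_gens_def by blast
  have bd: "norm (?f (n + e) - (\<Sum>P\<leftarrow>Ps. g P n) / real q ^ \<delta>) \<le> K * (1 / real p) ^ n" for n
  proof -
    define Q where "Q = real (p ^ n)"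
    have Q: "Q > 0" using p(2) by (simp add: Q_def)
    define m where "m = nat \<lfloor>x * real (p ^ n)\<rfloor>"
    have "0 \<le> x * real (p ^ n)" using x(1) by simp
    then obtain r where r: "r < q" "nat \<lfloor>x * real (p ^ n) * real q\<rfloor> = q * m + r"
      using nat_floor_mult[of "x * real (p ^ n)" q] q0 unfolding m_def by auto
    have pe: "p ^ (n + e) = p ^ n * q" by (simp add: q_def power_add)
    have r': "nat \<lfloor>x * real (p ^ (n + e))\<rfloor> = q * m + r" using r(2) unfolding pe by (simp add: mult_ac)
    define h' where "h' = hilb (fspan 1 0 G Z (pow_gens (p ^ (n + e)) hs)) (q * m + r)"
    define H where "H = (\<Sum>P\<leftarrow>Ps. hilb (fspan 1 0 G P (pow_gens (p ^ n) hs)) m)"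
    have pp: "pow_gens q (pow_gens (p ^ n) hs) = pow_gens (p ^ (n + e)) hs"
      unfolding pe by (rule pow_gens_pow_gens[OF hs])
    have "\<bar>h' - H\<bar> \<le> err u (pow_gens (p ^ n) hs) m"
      using step[OF valid_pow_gens[OF hs, of "p ^ n"] r(1), of m] unfolding pp H_def h'_def .
    also have "\<dots> \<le> K * Q ^ \<delta> / Q" using K(2)[of n] Q by (simp add: field_simps Q_def m_def)
    finally have *: "\<bar>h' - H\<bar> \<le> K * Q ^ \<delta> / Q" .
    have gs: "(\<Sum>P\<leftarrow>Ps. g P n) = H / Q ^ \<delta>"
      unfolding H_def g_def m_def[symmetric] Q_def by (induction Ps) (auto simp: add_divide_distrib)
    have "real (p ^ (n + e)) ^ \<delta> = Q ^ \<delta> * real q ^ \<delta>" unfolding pe by (simp add: Q_def power_mult_distrib)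
    then have "?f (n + e) - (\<Sum>P\<leftarrow>Ps. g P n) / real q ^ \<delta> = (h' - H) / (Q ^ \<delta> * real q ^ \<delta>)"
      unfolding r' gs h'_def[symmetric] by (simp add: diff_divide_distrib)
    then have "norm (?f (n + e) - (\<Sum>P\<leftarrow>Ps. g P n) / real q ^ \<delta>) = \<bar>h' - H\<bar> / (Q ^ \<delta> * real q ^ \<delta>)"
      using Q by (simp add: abs_mult)
    also have "\<dots> \<le> (K * Q ^ \<delta> / Q) / (Q ^ \<delta> * real q ^ \<delta>)"
      using * Q q0 by (intro divide_right_mono) auto
    also have "\<dots> = (K / Q) * (1 / real q ^ \<delta>)" using Q by (simp add: field_simps)
    also have "\<dots> \<le> (K / Q) * 1"
    proof (rule mult_left_mono)
      have "1 \<le> real q" using q0 by simp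
      then have "1 \<le> real q ^ \<delta>" by (rule one_le_power)
      then show "1 / real q ^ \<delta> \<le> 1" using q0 by simp
    qed (use K(1) Q in auto)
    also have "(K / Q) * 1 = K * (1 / real p) ^ n" by (simp add: Q_def power_one_over)
    finally show ?thesis .
  qed
  have "(\<lambda>n. K * (1 / real p) ^ n) \<longlonglongrightarrow> K * 0"
    by (intro tendsto_mult tendsto_const LIMSEQ_power_zero) (use p(2) in auto)
  then have "(\<lambda>n. ?f (n + e) - (\<Sum>P\<leftarrow>Ps. g P n) / real q ^ \<delta>) \<longlonglongrightarrow> 0"
    using Lim_null_comparison[OF always_eventually[OF allI[OF bd]]] by simp
  then have "convergent (\<lambda>n. (?f (n + e) - (\<Sum>P\<leftarrow>Ps. g P n) / real q ^ \<delta>) + (\<Sum>P\<leftarrow>Ps. g P n) / real q ^ \<delta>)"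
    by (intro convergent_add conv) (rule convergentI)
  then have "convergent (\<lambda>n. ?f (n + e))" by simp
  then show ?thesis using convergent_ignore_initial_segment[of ?f e] by blast
qed

section \<open>A common bound for the supports\<close>

lemma frobenius_support_step:
  assumes A: "homog A" and A': "homog A'" and E: "\<And>m. m \<ge> E \<Longrightarrow> A m = G m"
    and p: "\<And>i c. c \<in> A i \<Longrightarrow> c [^] p \<in> A' (p * i)"
    and span: "\<And>m. m \<ge> b \<Longrightarrow> power_span p m = G m" and p0: "p > 0"
  shows "m \<ge> b + p * E \<Longrightarrow> A' m = G m"
proof -
  \<comment> \<open>The number \<open>j\<close> counts the linear forms still to be collected. As
    long as the degree of \<open>w\<close> is at least \<open>b\<close>, it is a sum of products
    \<open>x [^] p\<close> times \<open>z\<close>, and \<open>x\<close> is moved into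
    \<open>y\<close>. Once \<open>y\<close> has degree at least \<open>E\<close> it lies in
    \<open>A\<close>, and its \<open>p\<close>-th power in \<open>A'\<close>.\<close>
  have "i + j \<ge> E \<Longrightarrow> m \<ge> b + p * j \<Longrightarrow> y \<in> G i \<Longrightarrow> w \<in> G m \<Longrightarrow> y [^] p \<otimes> w \<in> A' (p * i + m)" for i j m y w
  proof (induction j arbitrary: i m y w)
    case 0
    then have "y [^] p \<in> A' (p * i)" using p E[of i] by simp
    then show ?case using homog_mult2[OF A' 0(4)] by simp
  next
    case (Suc j)
    have yc: "y \<in> carrier R" using Suc.prems G_carrier by blast
    have sl: "semilinear (G m) (\<lambda>w. y [^] p \<otimes> w)"
      unfolding semilinear_def using yc by (auto simp: G_carrier r_distr intro!: bexI m_lcomm)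
    have "power_span p m \<subseteq> {w \<in> G m. y [^] p \<otimes> w \<in> A' (p * i + m)}"
    proof (rule power_span_least[OF ksub_preimage[OF sl ksub_G homog_ksub[OF A']]])
      fix x z assume x: "x \<in> G 1" and z: "z \<in> shift p G m"
      have le: "p \<le> m" using Suc.prems(2) p0 by (simp add: algebra_simps)
      then have zG: "z \<in> G (m - p)" using z by (simp add: shift_def)
      have xzG: "x [^] p \<otimes> z \<in> G m" using G_mult[OF G_pow[OF x, of p] zG] le by simp
      have "(y \<otimes> x) [^] p \<otimes> z \<in> A' (p * (i + 1) + (m - p))"
        by (rule Suc.IH[OF _ _ G_mult[OF Suc.prems(3) x] zG]) (use Suc.prems(1,2) le in \<open>auto simp: algebra_simps\<close>)
      moreover have "(y \<otimes> x) [^] p \<otimes> z = y [^] p \<otimes> (x [^] p \<otimes> z)"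
        using yc G_carrier[OF x] G_carrier[OF zG] by (simp add: nat_pow_distrib m_assoc)
      moreover have "p * (i + 1) + (m - p) = p * i + m" using le by simp
      ultimately show "x [^] p \<otimes> z \<in> {w \<in> G m. y [^] p \<otimes> w \<in> A' (p * i + m)}" using xzG by simp
    qed
    moreover have "power_span p m = G m" using span Suc.prems(2) by simp
    ultimately show ?case using Suc.prems(4) by blast
  qed
  from this[of 0 E m \<one>] have "w \<in> A' m" if "m \<ge> b + p * E" "w \<in> G m" for w
    using that one_G0 G_carrier by simp
  then show "m \<ge> b + p * E \<Longrightarrow> A' m = G m" using homog_sub[OF A'] by blast
qed

theorem frobenius_support:
  assumes p: "frob p" "p \<ge> 2" and hs: "valid 1 0 hs" and E: "\<And>m. m \<ge> E \<Longrightarrow> fspan 1 0 G Z hs m = G m"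
  obtains B where "\<And>n m. m \<ge> B * p ^ n \<Longrightarrow> fspan 1 0 G Z (pow_gens (p ^ n) hs) m = G m"
proof -
  obtain m1 where m1: "\<And>m. m \<ge> m1 \<Longrightarrow> power_span p m = G m" using power_span_eventually by blast
  \<comment> \<open>The bounds obey the recursion \<open>E' = m1 + p * E\<close>. Adding
    \<open>m1\<close> to the degree makes it purely multiplicative, since
    \<open>2 * m1 \<le> p * m1\<close>.\<close>
  have "m + m1 \<ge> (E + m1) * p ^ n \<Longrightarrow> fspan 1 0 G Z (pow_gens (p ^ n) hs) m = G m" for n m
  proof (induction n arbitrary: m)
    case 0
    then show ?case using E[of m] pow_gens_1[OF hs] by simp
  next
    case (Suc n)
    let ?A = "fspan 1 0 G Z (pow_gens (p ^ n) hs)"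
    note v = valid_pow_gens[OF hs, of "p ^ n"]
    have pp: "pow_gens p (pow_gens (p ^ n) hs) = pow_gens (p ^ Suc n) hs"
      using pow_gens_pow_gens[OF hs] by (simp add: mult.commute)
    have hA': "homog (fspan 1 0 G Z (pow_gens (p ^ Suc n) hs))" by (rule homog_fspan[OF homog_Z valid_pow_gens[OF hs]])
    have hA: "homog ?A" by (rule homog_fspan[OF homog_Z v])
    show ?case
    proof (rule frobenius_support_step[OF hA hA', where p = p and b = m1 and E = "(E + m1) * p ^ n - m1"])
      show "?A m = G m" if "m \<ge> (E + m1) * p ^ n - m1" for m using Suc.IH[of m] that by simp
      show "c [^] p \<in> fspan 1 0 G Z (pow_gens (p ^ Suc n) hs) (p * i)" if "c \<in> ?A i" for i c
        using frob_image_fspan[OF p(1) v that] unfolding pp .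
      have "m1 * 1 \<le> (E + m1) * p ^ n" by (intro mult_mono) (use p(2) in auto)
      then have ge: "m1 \<le> (E + m1) * p ^ n" by simp
      have "m1 + p * ((E + m1) * p ^ n - m1) + m1 \<le> p * ((E + m1) * p ^ n)"
      proof -
        obtain k where k: "(E + m1) * p ^ n = m1 + k" using ge le_Suc_ex by blast
        have "2 * m1 \<le> p * m1" using p(2) by (rule mult_le_mono1)
        then have "m1 + m1 \<le> p * m1" by linarith
        then show ?thesis unfolding k add_diff_cancel_left' distrib_left by linarith
      qed
      then show "m1 + p * ((E + m1) * p ^ n - m1) \<le> m" using Suc.prems by (simp add: mult_ac)
    qed (use m1 p in auto)
  qed
  then show thesis using that[of "E + m1"] by simp
qed

end

section \<open>The Frobenius endomorphism\<close>

context cring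
begin

lemma binomial_theorem:
  assumes x: "x \<in> carrier R" and y: "y \<in> carrier R"
  shows "(x \<oplus> y) [^] n = (\<Oplus>k\<in>{..n}. add_pow R (n choose k) (x [^] k \<otimes> y [^] (n - k)))"
proof (induction n)
  case 0
  show ?case by simp
next
  case (Suc n)
  let ?t = "\<lambda>n m k. add_pow R (m choose k) (x [^] k \<otimes> y [^] (n - k))"
  have c: "?t i m k \<in> carrier R" for i m k using x y by simp
  have x1: "(\<Oplus>k\<in>{..n}. ?t n n k) \<otimes> x = (\<Oplus>k\<in>{..n}. add_pow R (n choose k) (x [^] Suc k \<otimes> y [^] (n - k)))"
  proof -
    have "(\<Oplus>k\<in>{..n}. ?t n n k) \<otimes> x = (\<Oplus>k\<in>{..n}. ?t n n k \<otimes> x)"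
      by (rule finsum_ldistr) (use x c in auto)
    also have "\<dots> = (\<Oplus>k\<in>{..n}. add_pow R (n choose k) (x [^] Suc k \<otimes> y [^] (n - k)))"
      by (rule finsum_cong') (use x y in \<open>auto simp: add_pow_ldistr add_pow_rdistr m_ac\<close>)
    finally show ?thesis .
  qed
  have "(\<Oplus>k\<in>{..n}. ?t n n k) \<otimes> y = (\<Oplus>k\<in>{..n}. ?t n n k \<otimes> y)"
    by (rule finsum_ldistr) (use y c in auto)
  also have "\<dots> = (\<Oplus>k\<in>{..n}. ?t (Suc n) n k)"
    by (rule finsum_cong') (use x y in \<open>auto simp: add_pow_ldistr m_assoc Suc_diff_le\<close>)
  also have "\<dots> = (\<Oplus>k\<in>{..Suc n}. ?t (Suc n) n k)"
    using finsum_Suc[of "?t (Suc n) n" n] c x y by (simp add: binomial_eq_0)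
  also have "\<dots> = (\<Oplus>k\<in>{..n}. ?t (Suc n) n (Suc k)) \<oplus> ?t (Suc n) n 0"
    by (rule finsum_Suc2) (use c in auto)
  finally have y1: "(\<Oplus>k\<in>{..n}. ?t n n k) \<otimes> y = (\<Oplus>k\<in>{..n}. ?t (Suc n) n (Suc k)) \<oplus> ?t (Suc n) n 0" .
  have "(\<Oplus>k\<in>{..Suc n}. ?t (Suc n) (Suc n) k) = (\<Oplus>k\<in>{..n}. ?t (Suc n) (Suc n) (Suc k)) \<oplus> ?t (Suc n) (Suc n) 0"
    by (rule finsum_Suc2) (use c in auto)
  also have "(\<Oplus>k\<in>{..n}. ?t (Suc n) (Suc n) (Suc k))
      = (\<Oplus>k\<in>{..n}. add_pow R (n choose k) (x [^] Suc k \<otimes> y [^] (n - k)) \<oplus> ?t (Suc n) n (Suc k))"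
    by (rule finsum_cong') (use x y in \<open>auto simp: add.nat_pow_mult\<close>)
  also have "\<dots> = (\<Oplus>k\<in>{..n}. add_pow R (n choose k) (x [^] Suc k \<otimes> y [^] (n - k))) \<oplus> (\<Oplus>k\<in>{..n}. ?t (Suc n) n (Suc k))"
    by (rule finsum_addf) (use x y in auto)
  finally have rhs: "(\<Oplus>k\<in>{..Suc n}. ?t (Suc n) (Suc n) k) =
      (\<Oplus>k\<in>{..n}. add_pow R (n choose k) (x [^] Suc k \<otimes> y [^] (n - k))) \<oplus> (\<Oplus>k\<in>{..n}. ?t (Suc n) n (Suc k)) \<oplus> ?t (Suc n) n 0"
    by simp
  have "(x \<oplus> y) [^] Suc n = (\<Oplus>k\<in>{..n}. ?t n n k) \<otimes> x \<oplus> (\<Oplus>k\<in>{..n}. ?t n n k) \<otimes> y"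
    using Suc.IH x y c by (simp add: r_distr finsum_closed Pi_def)
  also have "\<dots> = (\<Oplus>k\<in>{..n}. add_pow R (n choose k) (x [^] Suc k \<otimes> y [^] (n - k))) \<oplus>
      ((\<Oplus>k\<in>{..n}. ?t (Suc n) n (Suc k)) \<oplus> ?t (Suc n) n 0)"
    unfolding x1 y1 ..
  also have "\<dots> = (\<Oplus>k\<in>{..Suc n}. ?t (Suc n) (Suc n) k)"
    unfolding rhs by (rule a_assoc[symmetric]) (use x y c in \<open>auto intro!: finsum_closed\<close>)
  finally show ?case .
qed

lemma frobenius_add:
  assumes p: "Factorial_Ring.prime (p::nat)" and char: "add_pow R (p) \<one> = \<zero>" and x: "x \<in> carrier R" and y: "y \<in> carrier R"
  shows "(x \<oplus> y) [^] p = x [^] p \<oplus> y [^] p"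
proof -
  have z: "add_pow R (p) a = \<zero>" if "a \<in> carrier R" for a
    using add_pow_ldistr[of \<one> a p] that char by simp
  let ?t = "\<lambda>k. add_pow R (p choose k) (x [^] k \<otimes> y [^] (p - k))"
  have c: "?t k \<in> carrier R" for k using x y by simp
  obtain n where n: "p = Suc (Suc n)" using prime_ge_2_nat[OF p] by (metis add_2_eq_Suc le_Suc_ex)
  have mid: "?t k = \<zero>" if "0 < k" "k < p" for k
  proof -
    have "p dvd (p choose k)" using dvd_choose_prime[of k p] that p by auto
    then obtain m where "p choose k = m * p" by (metis dvd_def mult.commute)
    then have "?t k = add_pow R (p) (add_pow R (m) (x [^] k \<otimes> y [^] (p - k)))"
      using x y by (simp add: add.nat_pow_pow)
    then show ?thesis using z x y by simp
  qed
  have "(x \<oplus> y) [^] p = (\<Oplus>k\<in>{..Suc (Suc n)}. ?t k)" using binomial_theorem[OF x y, of p] n by simp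
  also have "\<dots> = ?t (Suc (Suc n)) \<oplus> (\<Oplus>k\<in>{..Suc n}. ?t k)" by (rule finsum_Suc) (use c in auto)
  also have "(\<Oplus>k\<in>{..Suc n}. ?t k) = (\<Oplus>k\<in>{..n}. ?t (Suc k)) \<oplus> ?t 0" by (rule finsum_Suc2) (use c in auto)
  also have "(\<Oplus>k\<in>{..n}. ?t (Suc k)) = \<zero>"
  proof (rule add.finprod_one_eqI)
    show "?t (Suc k) = \<zero>" if "k \<in> {..n}" for k by (rule mid) (use that n in auto)
  qed
  also have "?t (Suc (Suc n)) \<oplus> (\<zero> \<oplus> ?t 0) = x [^] p \<oplus> y [^] p" using x y n by simp
  finally show ?thesis .
qed

end

lemma (in field) prime_ring_char:
  assumes "ring_char R > 0" shows "Factorial_Ring.prime (ring_char R)" "add_pow R (ring_char R) \<one> = \<zero>"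
proof -
  have iff: "add_pow R (n) \<one> = \<zero> \<longleftrightarrow> ring_char R dvd n" for n
    unfolding ring_char_def using add.pow_eq_id[of \<one> n] by (simp add: add_pow_def)
  then show "add_pow R (ring_char R) \<one> = \<zero>" by simp
  show "Factorial_Ring.prime (ring_char R)"
  proof (rule prime_natI)
    show "2 \<le> ring_char R"
    proof (rule ccontr)
      assume "\<not> 2 \<le> ring_char R"
      then have "ring_char R dvd 1" using assms by (cases "ring_char R = 1") auto
      then have "add_pow R (1::nat) \<one> = \<zero>" using iff by blast
      then show False by simp
    qed
    fix a b assume "ring_char R dvd a * b"
    then have "add_pow R (b * a) \<one> = \<zero>" using iff[of "b * a"] by (simp add: mult.commute)
    moreover have "(add_pow R (a) \<one>) \<otimes> (add_pow R (b) \<one>) = add_pow R (a) (add_pow R (b) \<one>)" by (simp add: add_pow_ldistr)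
    ultimately have "(add_pow R (a) \<one>) \<otimes> (add_pow R (b) \<one>) = \<zero>" by (simp add: add.nat_pow_pow)
    then have "add_pow R (a) \<one> = \<zero> \<or> add_pow R (b) \<one> = \<zero>" by (simp add: integral_iff)
    then show "ring_char R dvd a \<or> ring_char R dvd b" using iff by blast
  qed
qed

lemma (in algebraically_closed) exists_nth_root:
  assumes "n > 0" "c \<in> carrier L" obtains d where "d \<in> carrier L" "d [^] (n::nat) = c"
proof -
  \<comment> \<open>The coefficients of the polynomial \<open>X^n - c\<close>, leading coefficient
    first.\<close>
  define P where "P = \<one> # (replicate (n - 1) \<zero> @ [\<ominus> c])"
  have "polynomial (carrier L) P" unfolding P_def polynomial_def using assms by auto
  then have P: "P \<in> carrier (poly_ring L)" by (simp add: univ_poly_carrier)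
  then have "size (roots P) = degree P" using roots_over_carrier by (simp add: splitted_def)
  also have "degree P = n" using assms(1) by (simp add: P_def)
  finally have "roots P \<noteq> {#}" using assms(1) by auto
  then obtain d where "d \<in># roots P" by (meson multiset_nonemptyE)
  then have d: "d \<in> carrier L" "eval P d = \<zero>" using roots_mem_iff_is_root[OF P] by (auto simp: is_root_def)
  have "eval P d = d [^] n \<oplus> eval (replicate (n - 1) \<zero> @ [\<ominus> c]) d"
    using assms(1) d(1) by (simp add: P_def)
  also have "eval (replicate (n - 1) \<zero> @ [\<ominus> c]) d = \<ominus> c"
    using eval_replicate[of "[\<ominus> c]" d] assms(2) d(1) by simp
  finally have "d [^] n \<oplus> \<ominus> c = \<zero>" using d(2) by simp
  then have "d [^] n = c" using assms(2) d(1) by (metis a_minus_def nat_pow_closed r_right_minus_eq)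
  then show thesis using that d(1) by blast
qed


section \<open>Lengths of quotients\<close>

text \<open>Correspondence theorem: submodules of the image of \<open>V\<close> in the quotient by
  \<open>J\<close> are the stable subgroups between the intersection of \<open>J\<close> with
  \<open>V\<close> and \<open>V\<close>. It serves both for the length of the whole quotient ring
  and for single graded pieces.\<close>

lemma module_length_quotient:
  fixes R :: "('a, 'm) ring_scheme" (structure)
  assumes "ring R" and J: "ideal J R" and V: "subgroup V (add_monoid R)"
    and stable: "\<And>a v. a \<in> carrier A \<Longrightarrow> v \<in> V \<Longrightarrow> \<phi> a \<otimes> v \<in> V" and \<phi>: "\<And>a. a \<in> carrier A \<Longrightarrow> \<phi> a \<in> carrier R"
  shows "module_length A (restrict_scalars (\<lambda>a. J +> \<phi> a) (R Quot J) ((\<lambda>x. J +> x) ` V)) =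
    chain_length {W. subgroup W (add_monoid R) \<and> (\<forall>a\<in>carrier A. \<forall>w\<in>W. \<phi> a \<otimes> w \<in> W) \<and> J \<inter> V \<subseteq> W \<and> W \<subseteq> V}"
    (is "module_length A ?M = chain_length ?T")
proof -
  interpret R: ring R by (rule assms(1))
  interpret J: ideal J R by (rule J)
  let ?Q = "R Quot J"
  let ?h = "\<lambda>x. J +> x"
  interpret h: ring_hom_ring R ?Q ?h using J.rcos_ring_hom_ring .
  interpret hg: group_hom "add_monoid R" "add_monoid ?Q" ?h by (rule h.a_group_hom)
  have Vc: "V \<subseteq> carrier R" using subgroup.subset[OF V] by simp
  \<comment> \<open>The additive group of the restricted module is that of the quotient ring cut
    down to the image of \<open>V\<close>.\<close>
  have eqM: "subgroup H (add_monoid ?M) \<longleftrightarrow> subgroup H ((add_monoid ?Q)\<lparr>carrier := ?h ` V\<rparr>)" for H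
    by (simp add: restrict_scalars_def subgroup_def m_inv_def)
  have hV: "subgroup (?h ` V) (add_monoid ?Q)" by (rule hg.subgroup_img_is_subgroup[OF V])
  have sub_iff: "submodule H A ?M \<longleftrightarrow> subgroup H (add_monoid ?Q) \<and> H \<subseteq> ?h ` V \<and>
      (\<forall>a\<in>carrier A. \<forall>x\<in>H. (J +> \<phi> a) \<otimes>\<^bsub>?Q\<^esub> x \<in> H)" for H
  proof
    assume "submodule H A ?M"
    then have s: "subgroup H (add_monoid ?M)" and m: "\<And>a x. a \<in> carrier A \<Longrightarrow> x \<in> H \<Longrightarrow> a \<odot>\<^bsub>?M\<^esub> x \<in> H"
      by (auto simp: submodule_def submodule_axioms_def)
    have "subgroup H (add_monoid ?Q)"
      using h.S.add.incl_subgroup[OF hV] s unfolding eqM by blast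
    moreover have "H \<subseteq> ?h ` V" using subgroup.subset[OF s] by (simp add: restrict_scalars_def)
    ultimately show "subgroup H (add_monoid ?Q) \<and> H \<subseteq> ?h ` V \<and>
      (\<forall>a\<in>carrier A. \<forall>x\<in>H. (J +> \<phi> a) \<otimes>\<^bsub>?Q\<^esub> x \<in> H)"
      using m by (simp add: restrict_scalars_def)
  next
    assume H: "subgroup H (add_monoid ?Q) \<and> H \<subseteq> ?h ` V \<and>
      (\<forall>a\<in>carrier A. \<forall>x\<in>H. (J +> \<phi> a) \<otimes>\<^bsub>?Q\<^esub> x \<in> H)"
    have "subgroup H (add_monoid ?M)"
      using h.S.add.subgroup_incl[OF _ hV] H unfolding eqM by blast
    then show "submodule H A ?M"
      using H by (auto simp: submodule_def submodule_axioms_def restrict_scalars_def)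
  qed
  have "chain_length {H. submodule H A ?M} = chain_length ?T"
  proof (rule chain_length_bij[where f = "\<lambda>H. {x \<in> V. ?h x \<in> H}" and g = "\<lambda>W. ?h ` W"])
    fix H assume "H \<in> {H. submodule H A ?M}"
    then have H: "subgroup H (add_monoid ?Q)" "H \<subseteq> ?h ` V"
      "\<And>a x. a \<in> carrier A \<Longrightarrow> x \<in> H \<Longrightarrow> (J +> \<phi> a) \<otimes>\<^bsub>?Q\<^esub> x \<in> H" using sub_iff by auto
    define W where "W = {x \<in> V. ?h x \<in> H}"
    have "subgroup {x \<in> carrier R. ?h x \<in> H} (add_monoid R)"
    proof (rule R.add.subgroupI)
      have "?h \<zero> \<in> H" using subgroup.one_closed[OF H(1)] by simp
      then show "{x \<in> carrier R. ?h x \<in> H} \<noteq> {}" by blast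
      show "\<ominus> x \<in> {x \<in> carrier R. ?h x \<in> H}" if "x \<in> {x \<in> carrier R. ?h x \<in> H}" for x
        using subgroup.m_inv_closed[OF H(1), of "?h x"] that by (simp add: a_inv_def[of ?Q])
      show "x \<oplus> y \<in> {x \<in> carrier R. ?h x \<in> H}"
        if "x \<in> {x \<in> carrier R. ?h x \<in> H}" "y \<in> {x \<in> carrier R. ?h x \<in> H}" for x y
        using subgroup.m_closed[OF H(1), of "?h x" "?h y"] that by simp
    qed auto
    then have "subgroup (V \<inter> {x \<in> carrier R. ?h x \<in> H}) (add_monoid R)"
      by (rule R.add.subgroups_Inter_pair[OF V])
    moreover have "V \<inter> {x \<in> carrier R. ?h x \<in> H} = W" using Vc by (auto simp: W_def)
    ultimately have 1: "subgroup W (add_monoid R)" by simp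
    have 2: "\<phi> a \<otimes> w \<in> W" if "a \<in> carrier A" "w \<in> W" for a w
    proof -
      have w: "w \<in> V" "?h w \<in> H" using that(2) by (auto simp: W_def)
      have "w \<in> carrier R" using w(1) Vc by (rule rev_subsetD)
      then have "?h (\<phi> a \<otimes> w) = ?h (\<phi> a) \<otimes>\<^bsub>?Q\<^esub> ?h w" by (rule h.hom_mult[OF \<phi>[OF that(1)]])
      then show ?thesis using H(3)[OF that(1) w(2)] stable[OF that(1) w(1)] by (simp add: W_def)
    qed
    have 3: "J \<inter> V \<subseteq> W"
    proof
      fix x assume x: "x \<in> J \<inter> V"
      then have hx: "?h x = J" by (simp add: J.a_rcos_const)
      have "\<zero>\<^bsub>?Q\<^esub> \<in> H" using subgroup.one_closed[OF H(1)] by simp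
      then have "J \<in> H" unfolding FactRing_def by simp
      then have "?h x \<in> H" unfolding hx .
      then show "x \<in> W" using x unfolding W_def by blast
    qed
    have "W \<subseteq> V" unfolding W_def by (rule Collect_restrict)
    then have "W \<in> ?T" unfolding mem_Collect_eq using 1 2 3 by blast
    then show "{x \<in> V. ?h x \<in> H} \<in> ?T" unfolding W_def .
    show "?h ` {x \<in> V. ?h x \<in> H} = H" using H(2) by blast
  next
    fix W assume "W \<in> ?T"
    then have W: "subgroup W (add_monoid R)" "\<And>a w. a \<in> carrier A \<Longrightarrow> w \<in> W \<Longrightarrow> \<phi> a \<otimes> w \<in> W"
      "J \<inter> V \<subseteq> W" "W \<subseteq> V" by auto
    have st: "(J +> \<phi> a) \<otimes>\<^bsub>?Q\<^esub> x \<in> ?h ` W" if "a \<in> carrier A" "x \<in> ?h ` W" for a x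
    proof -
      from that(2) obtain w where w: "w \<in> W" "x = ?h w" by blast
      have "w \<in> carrier R" using w(1) W(4) Vc by blast
      then have "?h (\<phi> a \<otimes> w) = ?h (\<phi> a) \<otimes>\<^bsub>?Q\<^esub> ?h w" by (rule h.hom_mult[OF \<phi>[OF that(1)]])
      then show ?thesis using imageI[OF W(2)[OF that(1) w(1)], of ?h] w(2) by simp
    qed
    show "?h ` W \<in> {H. submodule H A ?M}"
      unfolding mem_Collect_eq sub_iff
      by (intro conjI ballI hg.subgroup_img_is_subgroup[OF W(1)] image_mono[OF W(4)] st)
    show "{x \<in> V. ?h x \<in> ?h ` W} = W"
    proof
      show "W \<subseteq> {x \<in> V. ?h x \<in> ?h ` W}" using W(4) by blast
      show "{x \<in> V. ?h x \<in> ?h ` W} \<subseteq> W"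
      proof
        fix x assume "x \<in> {x \<in> V. ?h x \<in> ?h ` W}"
        then obtain w where xw: "x \<in> V" "w \<in> W" "?h x = ?h w" by blast
        have c: "x \<in> carrier R" "w \<in> carrier R" "w \<in> V" using xw(1,2) W(4) Vc by blast+
        have "x \<in> J +> w" using J.a_rcos_self[OF c(1)] xw(3) by simp
        then obtain j where j: "j \<in> J" "x = j \<oplus> w" by (auto simp: a_r_coset_def')
        have jc: "j \<in> carrier R" using j(1) J.Icarr by blast
        have "j = x \<oplus> \<ominus> w" using j(2) jc c by (simp add: R.a_assoc R.r_neg)
        then have "j \<in> V" using subgroup.m_closed[OF V xw(1) subgroup.m_inv_closed[OF V c(3)]] c(2)
          by (simp add: a_inv_def)
        then have "j \<in> W" using j(1) W(3) by blast
        then show "x \<in> W" using subgroup.m_closed[OF W(1) _ xw(2), of j] j(2) by simp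
      qed
    qed
  qed blast+
  then show ?thesis by (simp add: module_length_def chain_length_def)
qed

section \<open>Homogeneous ideals and Frobenius powers\<close>

context graded_algebra
begin

lemma ksub_iff_subgroup:
  "ksub W \<longleftrightarrow> subgroup W (add_monoid R) \<and> (\<forall>c\<in>G 0. \<forall>x\<in>W. c \<otimes> x \<in> W)"
proof
  assume W: "ksub W"
  have "subgroup W (add_monoid R)"
  proof (rule add.subgroupI)
    show "W \<noteq> {}" using ksub_zero[OF W] by blast
  qed (use ksub_carrier[OF W] ksub_neg[OF W] ksub_add[OF W] in auto)
  then show "subgroup W (add_monoid R) \<and> (\<forall>c\<in>G 0. \<forall>x\<in>W. c \<otimes> x \<in> W)"
    using ksub_smult[OF W] by blast
next
  assume W: "subgroup W (add_monoid R) \<and> (\<forall>c\<in>G 0. \<forall>x\<in>W. c \<otimes> x \<in> W)"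
  then show "ksub W"
    using subgroup.subset[of W "add_monoid R"] subgroup.one_closed[of W "add_monoid R"]
      subgroup.m_closed[of W "add_monoid R"] by (intro ksubI) auto
qed

definition part :: "'a set \<Rightarrow> nat \<Rightarrow> 'a set" where
  "part I m = I \<inter> G m"

lemma homog_part: assumes "ideal I R" shows "homog (part I)"
  unfolding homog_def part_def
  using ksub_Int[OF ksub_ideal[OF assms] ksub_G] ideal.I_l_closed[OF assms] G_carrier G_mult by auto

lemma to_ideal_part_subset: assumes "ideal I R" shows "to_ideal (part I) \<subseteq> I"
proof
  fix x assume x: "x \<in> to_ideal (part I)"
  then have c: "x \<in> carrier R" "\<And>m. component x m \<in> I" by (auto simp: to_ideal_def part_def)
  have "finsum R (component x) {n. component x n \<noteq> \<zero>} \<in> I"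
    by (rule ksub_finsum[OF ksub_ideal[OF assms] finite_component[OF c(1)] c(2)])
  then show "x \<in> I" using finsum_component[OF c(1)] by simp
qed

lemma to_ideal_part: assumes "graded_ideal R G I" shows "to_ideal (part I) = I"
proof
  have id: "ideal I R" using assms by (simp add: graded_ideal_def)
  show "to_ideal (part I) \<subseteq> I" by (rule to_ideal_part_subset[OF id])
  have "(\<Union>n. I \<inter> G n) \<subseteq> to_ideal (part I)"
    using to_ideal_homogeneous[OF homog_part[OF id]] by (auto simp: part_def)
  from genideal_minimal[OF ideal_to_ideal[OF homog_part[OF id]] this]
  have "genideal R (\<Union>n. I \<inter> G n) \<subseteq> to_ideal (part I)" .
  moreover have "I = genideal R (\<Union>n. I \<inter> G n)" using assms unfolding graded_ideal_def by blast
  ultimately show "I \<subseteq> to_ideal (part I)" by simp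
qed

text \<open>As long as the ideal generated so far is smaller than \<open>A\<close>, adjoin a missing
  homogeneous element; \<open>wf_homog\<close> stops the process.\<close>

lemma homog_finitely_generated:
  assumes A: "homog A" obtains hs where "valid 1 0 hs" "fspan 1 0 G Z hs = A"
proof -
  have "\<And>hs. B = fspan 1 0 G Z hs \<Longrightarrow> valid 1 0 hs \<Longrightarrow> B \<le> A \<Longrightarrow> \<exists>hs'. valid 1 0 hs' \<and> fspan 1 0 G Z hs' = A" for B
  proof (induction B rule: wf_induct_rule[OF wf_homog])
    case (1 B)
    show ?case
    proof (cases "A \<le> B")
      case True
      then show ?thesis using 1(2,3,4) by (metis antisym)
    next
      case False
      then obtain m x where x: "x \<in> A m" "x \<notin> B m" by (auto simp: le_fun_def)
      let ?hs = "(m, x) # hs"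
      have v: "valid 1 0 ?hs" using homog_mem[OF A x(1)] 1(3) by simp
      have hB: "homog B" unfolding 1(2) by (rule homog_fspan[OF homog_Z 1(3)])
      have gens: "snd t \<in> A (fst t)" if "t \<in> set ?hs" for t
      proof (cases "t = (m, x)")
        case False
        then have "snd t \<in> B (fst t)" using that fspan_mem1[OF homog_Z 1(3), of t] 1(2) by simp
        then show ?thesis using 1(4) unfolding le_fun_def by blast
      qed (use x(1) in simp)
      have le: "fspan 1 0 G Z ?hs \<le> A" by (rule fspan_least[OF A Z_le[OF A] gens])
      have "B \<le> fspan 1 0 G Z ?hs" unfolding 1(2) le_fun_def using fspan_Cons_sub[OF frob_1 homog_G homog_Z v] by blast
      moreover have "x \<in> fspan 1 0 G Z ?hs m" using fspan_mem1[OF homog_Z v, of "(m, x)"] by simp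
      ultimately have "B < fspan 1 0 G Z ?hs" using x(2) by (auto simp: less_le_not_le le_fun_def)
      then have "(fspan 1 0 G Z ?hs, B) \<in> {(B, A). homog A \<and> homog B \<and> A < B}" using hB homog_fspan[OF homog_Z v] by simp
      from 1(1)[OF this refl v le] show ?thesis .
    qed
  qed
  from this[OF refl, of "[]"] have "\<exists>hs. valid 1 0 hs \<and> fspan 1 0 G Z hs = A"
    using Z_le[OF A] by (simp add: le_fun_def)
  then show thesis using that by blast
qed

text \<open>By additivity of the \<open>q\<close>-th power, \<open>a [^] q\<close> is the sum of the
  \<open>q\<close>-th powers of the components of \<open>a\<close>, and each of these lies in the
  ideal of the \<open>q\<close>-th powers of the generators. So a Frobenius power, defined through
  all elements, is homogeneous with generators \<open>pow_gens q hs\<close>.\<close>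

lemma frobenius_power_part:
  assumes q: "frob q" and I: "graded_ideal R G I" and hs: "valid 1 0 hs" "fspan 1 0 G Z hs = part I"
  shows "ideal (frobenius_power R I q) R" and "part (frobenius_power R I q) = fspan 1 0 G Z (pow_gens q hs)"
proof -
  have id: "ideal I R" using I by (simp add: graded_ideal_def)
  have Ic: "I \<subseteq> carrier R" using ideal.Icarr[OF id] by blast
  have sub: "(\<lambda>a. a [^] q) ` I \<subseteq> carrier R" using Ic by auto
  show J: "ideal (frobenius_power R I q) R" unfolding frobenius_power_def by (rule genideal_ideal[OF sub])
  let ?B = "fspan 1 0 G Z (pow_gens q hs)"
  have v: "valid 1 0 (pow_gens q hs)" by (rule valid_pow_gens[OF hs(1)])
  have hB: "homog ?B" by (rule homog_fspan[OF homog_Z v])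
  have iB: "ideal (to_ideal ?B) R" by (rule ideal_to_ideal[OF hB])
  have "a [^] q \<in> to_ideal ?B" if a: "a \<in> I" for a
  proof -
    have c: "a \<in> carrier R" using a Ic by blast
    have "a \<in> to_ideal (part I)" using a to_ideal_part[OF I] by simp
    then have mem: "component a n \<in> part I n" for n by (simp add: to_ideal_def)
    have "finsum R (component a) F [^] q \<in> to_ideal ?B" if "finite F" for F
      using that
    proof (induction F rule: finite_induct)
      case empty
      then show ?case using pow_zero[OF frob_pos[OF q]] additive_subgroup.zero_closed[OF ideal.axioms(1)[OF iB]] by simp
    next
      case (insert n F)
      have ca: "component a \<in> F \<rightarrow> carrier R" using component_carrier[OF c] by auto
      have "component a n [^] q \<in> ?B (q * n)" by (rule frob_image_fspan[OF q hs(1)]) (use mem hs(2) in auto)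
      then have "component a n [^] q \<in> to_ideal ?B"
        using to_ideal_homogeneous[OF hB, of "component a n [^] q" "q * n"] homog_mem[OF hB] by blast
      moreover have "finsum R (component a) (insert n F) [^] q = component a n [^] q \<oplus> finsum R (component a) F [^] q"
        using insert.hyps ca component_carrier[OF c] by (simp add: frob_add[OF q] finsum_closed)
      ultimately show ?case using insert.IH additive_subgroup.a_closed[OF ideal.axioms(1)[OF iB]] by simp
    qed
    from this[OF finite_component[OF c]] show ?thesis using finsum_component[OF c] by simp
  qed
  then have "frobenius_power R I q \<subseteq> to_ideal ?B"
    unfolding frobenius_power_def by (intro genideal_minimal[OF iB]) blast
  then have 1: "part (frobenius_power R I q) m \<subseteq> ?B m" for m
    using to_ideal_homogeneous[OF hB] by (auto simp: part_def)
  have "?B \<le> part (frobenius_power R I q)"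
  proof (rule fspan_least[OF homog_part[OF J] Z_le[OF homog_part[OF J]]])
    fix t assume "t \<in> set (pow_gens q hs)"
    then obtain s where s: "s \<in> set hs" "t = (q * fst s, snd s [^] q)" by (auto simp: pow_gens_def)
    have "snd s \<in> part I (fst s)" using fspan_mem1[OF homog_Z hs(1) s(1)] hs(2) by simp
    then have "snd s \<in> I" "snd s \<in> G (fst s)" by (auto simp: part_def)
    then show "snd t \<in> part (frobenius_power R I q) (fst t)"
      using genideal_self[OF sub] G_pow[of "snd s" "fst s" q] s(2) by (auto simp: part_def frobenius_power_def)
  qed
  then show "part (frobenius_power R I q) = ?B" using 1 by (intro ext) (auto simp: le_fun_def)
qed

text \<open>If no component of \<open>I\<close> were full, enlarging \<open>I\<close> by all degrees
  from \<open>n\<close> on would give ideals over \<open>I\<close> that decrease strictly with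
  \<open>n\<close>, so their chains would exceed the finite length. A full component in one degree
  makes all later ones full because the ring is generated in degree 1.\<close>

lemma part_eventually_full:
  assumes I: "graded_ideal R G I" and fin: "quotient_length R I < \<infinity>"
  obtains E where "\<And>m. m \<ge> E \<Longrightarrow> part I m = G m"
proof -
  have id: "ideal I R" using I by (simp add: graded_ideal_def)
  note hI = homog_part[OF id]
  have carr: "subgroup (carrier R) (add_monoid R)" using add.subgroup_self by simp
  have img: "(\<lambda>x. I +> x) ` carrier R = carrier (R Quot I)"
    by (auto simp: FactRing_def A_RCOSETS_def')
  let ?T = "{W. subgroup W (add_monoid R) \<and>
      (\<forall>a\<in>carrier R. \<forall>w\<in>W. a \<otimes> w \<in> W) \<and> I \<inter> carrier R \<subseteq> W \<and> W \<subseteq> carrier R}"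
  have "quotient_length R I = chain_length ?T"
    unfolding quotient_length_def img[symmetric]
    by (rule module_length_quotient[OF ring_axioms id carr]) auto
  then obtain L where L: "chain_length ?T = enat L" using fin by auto
  define E where "E n m = (if n \<le> m then G m else part I m)" for n m :: nat
  have hE: "homog (E n)" for n
    unfolding homog_def
  proof (intro conjI allI ballI)
    show "ksub (E n m)" "E n m \<subseteq> G m" for m
      using homog_ksub[OF hI, of m] homog_sub[OF hI, of m] ksub_G[of m] by (auto simp: E_def)
    show "a \<otimes> x \<in> E n (i + j)" if "a \<in> G i" "x \<in> E n j" for i j a x
      using that homog_mult[OF hI, of a i x j] G_mult[of a i x j] homog_mem[OF hI, of x j]
      by (auto simp: E_def split: if_splits)
  qed
  have mem: "to_ideal (E n) \<in> ?T" for n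
  proof -
    have iE: "ideal (to_ideal (E n)) R" by (rule ideal_to_ideal[OF hE])
    have 1: "subgroup (to_ideal (E n)) (add_monoid R)" using ksub_ideal[OF iE] ksub_iff_subgroup by blast
    have 2: "\<forall>a\<in>carrier R. \<forall>w\<in>to_ideal (E n). a \<otimes> w \<in> to_ideal (E n)" using ideal.I_l_closed[OF iE] by blast
    have "part I \<le> E n" using homog_sub[OF hI] by (auto simp: E_def le_fun_def)
    from to_ideal_mono[OF this] have 3: "I \<subseteq> to_ideal (E n)" using to_ideal_part[OF I] by simp
    have 4: "to_ideal (E n) \<subseteq> carrier R" by (auto simp: to_ideal_def)
    show ?thesis unfolding mem_Collect_eq using 1 2 3 4 by blast
  qed
  have "\<exists>n. part I n = G n"
  proof (rule ccontr)
    assume "\<not> (\<exists>n. part I n = G n)"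
    then have ne: "part I n \<noteq> G n" for n by blast
    have "E (Suc n) < E n" for n
    proof -
      have "E (Suc n) \<le> E n" using homog_sub[OF hI] by (auto simp: E_def le_fun_def)
      moreover have "\<not> E n n \<subseteq> E (Suc n) n" using ne[of n] homog_sub[OF hI, of n] by (auto simp: E_def)
      then have "\<not> E n \<le> E (Suc n)" by (auto simp: le_fun_def)
      ultimately show ?thesis by (simp add: less_le_not_le)
    qed
    then have ss: "to_ideal (E (Suc n)) \<subset> to_ideal (E n)" for n
      by (rule to_ideal_strict_mono[OF hE hE])
    have "enat (Suc L) \<le> chain_length ?T"
    proof (rule chain_length_geI[where N = "\<lambda>i. to_ideal (E (Suc L - i))"])
      show "\<forall>i\<le>Suc L. to_ideal (E (Suc L - i)) \<in> ?T" using mem by blast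
      show "\<forall>i<Suc L. to_ideal (E (Suc L - i)) \<subset> to_ideal (E (Suc L - Suc i))"
        using ss by (metis Suc_diff_Suc)
    qed
    then show False using L by simp
  qed
  then obtain n where n: "part I n = G n" by blast
  have "part I m = G m" if "m \<ge> n" for m
    using that
  proof (induction m rule: dec_induct)
    case (step m)
    have "G (Suc m) \<subseteq> part I (Suc m)"
    proof (rule ksub_span_G1[OF homog_ksub[OF hI]])
      fix x y assume "x \<in> G 1" "y \<in> G m"
      then show "x \<otimes> y \<in> part I (Suc m)" using homog_mult[OF hI, of x 1 y m] step.IH by simp
    qed
    then show ?case using homog_sub[OF hI] by blast
  qed (rule n)
  then show thesis by (rule that)
qed

end

section \<open>SG pairs as graded algebras\<close>

lemma sg_pair_graded_algebra:
  fixes K :: "'k ring" and P :: "('k, 'a) sg_data"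
  assumes K: "field K" and P: "sg_pair K P"
  shows "graded_algebra (sg_ring P) (sg_grade P)"
proof -
  interpret K: field K by (rule K)
  interpret R: cring "sg_ring P" using P by (simp add: sg_pair_def)
  interpret N: noetherian_ring "sg_ring P" using P by (simp add: sg_pair_def)
  have e: "sg_embed P \<in> ring_hom K (sg_ring P)" and b: "bij_betw (sg_embed P) (carrier K) (sg_grade P 0)"
    using P by (auto simp: sg_pair_def)
  interpret e: ring_hom_ring K "sg_ring P" "sg_embed P"
    by (rule ring_hom_ringI2[OF K.ring_axioms R.ring_axioms e])
  have inj: "inj_on (sg_embed P) (carrier K)" and im: "sg_embed P ` carrier K = sg_grade P 0"
    using b by (auto simp: bij_betw_def)
  show ?thesis
  proof
    show "graded_ring (sg_ring P) (sg_grade P)" using P by (simp add: sg_pair_def)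
    show "\<one>\<^bsub>sg_ring P\<^esub> \<in> sg_grade P 0" using im e.hom_one by (metis K.one_closed imageI)
    show "\<one>\<^bsub>sg_ring P\<^esub> \<noteq> \<zero>\<^bsub>sg_ring P\<^esub>"
    proof
      assume "\<one>\<^bsub>sg_ring P\<^esub> = \<zero>\<^bsub>sg_ring P\<^esub>"
      then have "sg_embed P \<one>\<^bsub>K\<^esub> = sg_embed P \<zero>\<^bsub>K\<^esub>" by simp
      from inj_onD[OF inj this] show False by simp
    qed
    show "generate_ring (sg_ring P) (sg_grade P 0 \<union> sg_grade P 1) = carrier (sg_ring P)"
      using P by (simp add: sg_pair_def)
    fix c assume "c \<in> sg_grade P 0" and nz: "c \<noteq> \<zero>\<^bsub>sg_ring P\<^esub>"
    then obtain k where k: "k \<in> carrier K" "c = sg_embed P k" using im by blast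
    have "k \<noteq> \<zero>\<^bsub>K\<^esub>" using nz k by auto
    then have u: "k \<in> Units K" using k(1) by (simp add: K.field_Units)
    have "c \<otimes>\<^bsub>sg_ring P\<^esub> sg_embed P (inv\<^bsub>K\<^esub> k) = sg_embed P (k \<otimes>\<^bsub>K\<^esub> inv\<^bsub>K\<^esub> k)"
      using k K.Units_inv_closed[OF u] by simp
    also have "\<dots> = \<one>\<^bsub>sg_ring P\<^esub>" using K.Units_r_inv[OF u] by simp
    finally show "\<exists>d\<in>sg_grade P 0. c \<otimes>\<^bsub>sg_ring P\<^esub> d = \<one>\<^bsub>sg_ring P\<^esub>"
      using K.Units_inv_closed[OF u] im by blast
  qed
qed

text \<open>Additivity comes from the characteristic, transported by the embedding; surjectivity on
  scalars comes from roots in the algebraically closed field.\<close>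

lemma sg_pair_frob:
  fixes K :: "'k ring" and P :: "('k, 'a) sg_data"
  assumes K: "algebraically_closed K" "ring_char K > 0" and P: "sg_pair K P"
  shows "graded_algebra.frob (sg_ring P) (sg_grade P) (ring_char K)" "ring_char K \<ge> 2"
proof -
  interpret K: algebraically_closed K by (rule K(1))
  interpret graded_algebra "sg_ring P" "sg_grade P"
    by (rule sg_pair_graded_algebra[OF K.field_axioms P])
  have e: "sg_embed P \<in> ring_hom K (sg_ring P)" and im: "sg_embed P ` carrier K = sg_grade P 0"
    using P by (auto simp: sg_pair_def bij_betw_def)
  interpret e: ring_hom_ring K "sg_ring P" "sg_embed P"
    by (rule ring_hom_ringI2[OF K.ring_axioms ring_axioms e])
  define p where "p = ring_char K"
  have p: "Factorial_Ring.prime p" "add_pow K p \<one>\<^bsub>K\<^esub> = \<zero>\<^bsub>K\<^esub>"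
    using K.prime_ring_char[OF K(2)] by (simp_all add: p_def)
  show "ring_char K \<ge> 2" using prime_ge_2_nat[OF p(1)] by (simp add: p_def)
  have "sg_embed P (add_pow K n \<one>\<^bsub>K\<^esub>) = add_pow (sg_ring P) n \<one>\<^bsub>sg_ring P\<^esub>" for n :: nat
    by (induction n) auto
  from this[of p] have char: "add_pow (sg_ring P) p \<one>\<^bsub>sg_ring P\<^esub> = \<zero>\<^bsub>sg_ring P\<^esub>" using p(2) by simp
  have "frob p" unfolding frob_def
  proof (intro conjI ballI)
    show "p > 0" using prime_gt_0_nat[OF p(1)] .
    show "(x \<oplus>\<^bsub>sg_ring P\<^esub> y) [^]\<^bsub>sg_ring P\<^esub> p = x [^]\<^bsub>sg_ring P\<^esub> p \<oplus>\<^bsub>sg_ring P\<^esub> y [^]\<^bsub>sg_ring P\<^esub> p"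
      if "x \<in> carrier (sg_ring P)" "y \<in> carrier (sg_ring P)" for x y
      by (rule frobenius_add[OF p(1) char that])
    fix c assume "c \<in> sg_grade P 0"
    then obtain k where k: "k \<in> carrier K" "c = sg_embed P k" using im by blast
    obtain l where l: "l \<in> carrier K" "l [^]\<^bsub>K\<^esub> p = k"
      using K.exists_nth_root[OF prime_gt_0_nat[OF p(1)] k(1)] by blast
    have "sg_embed P l [^]\<^bsub>sg_ring P\<^esub> p = c" using e.hom_nat_pow[OF l(1), of p] l k by simp
    then show "\<exists>d\<in>sg_grade P 0. d [^]\<^bsub>sg_ring P\<^esub> p = c" using l(1) im by blast
  qed
  then show "frob (ring_char K)" by (simp add: p_def)
qed

lemma graded_quotient_length_eq:
  fixes K :: "'k ring" and P :: "('k, 'a) sg_data"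
  assumes K: "field K" and P: "sg_pair K P" and J: "ideal J (sg_ring P)"
  shows "graded_quotient_length K P J m =
    graded_algebra.len (sg_ring P) (sg_grade P) (J \<inter> sg_grade P m) (sg_grade P m)"
proof -
  interpret graded_algebra "sg_ring P" "sg_grade P" by (rule sg_pair_graded_algebra[OF K P])
  have im: "sg_embed P ` carrier K = sg_grade P 0"
    using P by (auto simp: sg_pair_def bij_betw_def)
  have "graded_quotient_length K P J m = chain_length {W. subgroup W (add_monoid (sg_ring P)) \<and>
     (\<forall>a\<in>carrier K. \<forall>w\<in>W. sg_embed P a \<otimes>\<^bsub>sg_ring P\<^esub> w \<in> W) \<and> J \<inter> sg_grade P m \<subseteq> W \<and> W \<subseteq> sg_grade P m}"
    unfolding graded_quotient_length_def Let_def
  proof (rule module_length_quotient[OF ring_axioms J])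
    show "subgroup (sg_grade P m) (add_monoid (sg_ring P))" using ksub_G ksub_iff_subgroup by blast
    show "sg_embed P a \<otimes>\<^bsub>sg_ring P\<^esub> v \<in> sg_grade P m" if "a \<in> carrier K" "v \<in> sg_grade P m" for a v
      using that im G0_mult by blast
    show "sg_embed P a \<in> carrier (sg_ring P)" if "a \<in> carrier K" for a using that im G_carrier by blast
  qed
  also have "\<dots> = len (J \<inter> sg_grade P m) (sg_grade P m)"
    unfolding len_def ksub_iff_subgroup im[symmetric] by (rule arg_cong[where f = chain_length]) auto
  finally show ?thesis .
qed

section \<open>Fourier transforms of bounded functions with compact support\<close>

lemma fourier_integrand_borel [measurable]:
  assumes [measurable]: "f \<in> borel_measurable borel"
  shows "fourier_integrand f z \<in> borel_measurable borel"
  unfolding fourier_integrand_def[abs_def] by measurable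

lemma norm_exp_le: "norm (exp (\<i> * complex_of_real t * z)) \<le> exp (\<bar>t\<bar> * norm z)"
proof -
  have "norm (exp (\<i> * complex_of_real t * z)) \<le> exp (norm (\<i> * complex_of_real t * z))" by (rule norm_exp)
  then show ?thesis by (simp add: norm_mult)
qed

lemma fourier_integrand_bound:
  assumes "norm (f t) \<le> C * indicator {0..B} t" "C \<ge> 0" "B \<ge> (0::real)"
  shows "norm (fourier_integrand f z t) \<le> C * exp (B * norm z) * indicator {0..B} t"
proof (cases "t \<in> {0..B}")
  case True
  have "norm (fourier_integrand f z t) = \<bar>f t\<bar> * norm (exp (\<i> * complex_of_real t * z))"
    by (simp add: fourier_integrand_def norm_mult)
  also have "\<dots> \<le> C * exp (B * norm z)"
  proof (rule mult_mono)
    show "\<bar>f t\<bar> \<le> C" using assms(1) True by simp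
    have "\<bar>t\<bar> * norm z \<le> B * norm z" using True by (intro mult_right_mono) auto
    then show "norm (exp (\<i> * complex_of_real t * z)) \<le> exp (B * norm z)"
      using norm_exp_le[of t z] by (meson exp_le_cancel_iff order_trans)
  qed (use assms in auto)
  finally show ?thesis using True by simp
next
  case False
  then have "f t = 0" using assms(1) by simp
  then show ?thesis using False by (simp add: fourier_integrand_def)
qed

context
  fixes f :: "real \<Rightarrow> real" and C B :: real
  assumes f [measurable]: "f \<in> borel_measurable borel" and CB: "C \<ge> 0" "B \<ge> 0"
    and bd: "AE t in lborel. norm (f t) \<le> C * indicator {0..B} t"
begin

lemma integrable_indicator_Icc: "integrable lborel (indicat_real {0..B})"
  by (rule integrable_real_indicator) (use CB in auto)

lemma integrable_fourier_integrand: "integrable lborel (fourier_integrand f z)"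
proof (rule Bochner_Integration.integrable_bound)
  show "integrable lborel (\<lambda>t. C * exp (B * norm z) * indicator {0..B} t)"
    by (intro integrable_mult_right integrable_indicator_Icc)
  show "AE t in lborel. norm (fourier_integrand f z t) \<le> norm (C * exp (B * norm z) * indicator {0..B} t)"
    using bd
  proof eventually_elim
    case (elim t)
    then show ?case using fourier_integrand_bound[of f t C B z, OF elim CB] unfolding real_norm_def by linarith
  qed
qed measurable

text \<open>The exponential series is integrated term by term; on the support the terms are
  dominated by those of \<open>C\<close> times the exponential series at \<open>B * norm z\<close>.
  The bound on \<open>f\<close> is only almost everywhere because \<open>f\<close> will be a limit
  whose values at finitely many points are not controlled.\<close>

lemma fourier_transform_sums:
  defines "a \<equiv> \<lambda>n. LINT t|lborel. complex_of_real (f t) * ((\<i> * complex_of_real t) ^ n / fact n)"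
  shows "(\<lambda>n. a n * z ^ n) sums fourier_transform f z"
proof -
  define g where "g n t = complex_of_real (f t) * ((\<i> * complex_of_real t) ^ n / fact n) * z ^ n" for n t
  have [measurable]: "g n \<in> borel_measurable borel" for n unfolding g_def[abs_def] by measurable
  have gb: "norm (g n t) \<le> C * ((B * norm z) ^ n / fact n) * indicator {0..B} t"
    if t: "norm (f t) \<le> C * indicator {0..B} t" for n t
  proof (cases "t \<in> {0..B}")
    case True
    have "norm (g n t) = \<bar>f t\<bar> * ((\<bar>t\<bar> * norm z) ^ n / fact n)"
      by (simp add: g_def norm_mult norm_divide norm_power power_mult_distrib)
    also have "\<dots> \<le> C * ((B * norm z) ^ n / fact n)"
      using True t CB by (intro mult_mono divide_right_mono power_mono mult_right_mono) auto
    finally show ?thesis using True by simp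
  next
    case False
    then show ?thesis using t by (simp add: g_def)
  qed
  have int: "integrable lborel (\<lambda>t. C * ((B * norm z) ^ n / fact n) * indicator {0..B} t)" for n
    by (intro integrable_mult_right integrable_indicator_Icc)
  have gi: "integrable lborel (g n)" for n
  proof (rule Bochner_Integration.integrable_bound[OF int[of n]])
    show "AE t in lborel. norm (g n t) \<le> norm (C * ((B * norm z) ^ n / fact n) * indicator {0..B} t)"
      using bd
    proof eventually_elim
      case (elim t)
      then show ?case using gb[OF elim, of n] unfolding real_norm_def by linarith
    qed
  qed measurable
  have es: "summable (\<lambda>n. w ^ n / fact n)" for w :: real
    using summable_exp[of w] by (simp add: divide_inverse mult.commute)
  have s1: "AE t in lborel. summable (\<lambda>n. norm (g n t))"
    using bd
  proof eventually_elim
    case (elim t)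
    have "summable (\<lambda>n. C * ((B * norm z) ^ n / fact n) * indicator {0..B} t)"
      by (intro summable_mult summable_mult2 es)
    then show ?case
      by (rule summable_comparison_test'[where N = 0]) (use gb[OF elim] in simp)
  qed
  have s2: "summable (\<lambda>n. LINT t|lborel. norm (g n t))"
  proof (rule summable_comparison_test'[where N = 0])
    show "summable (\<lambda>n. (C * ((B * norm z) ^ n / fact n)) * B)"
      by (intro summable_mult summable_mult2 es)
    fix n
    have "(LINT t|lborel. norm (g n t)) \<le> (LINT t|lborel. C * ((B * norm z) ^ n / fact n) * indicator {0..B} t)"
      by (intro integral_mono_AE integrable_norm gi int) (use bd gb in \<open>auto elim!: eventually_mono\<close>)
    also have "\<dots> = (C * ((B * norm z) ^ n / fact n)) * B" using CB by simp
    finally show "norm (LINT t|lborel. norm (g n t)) \<le> (C * ((B * norm z) ^ n / fact n)) * B" by simp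
  qed
  have "(\<lambda>n. integral\<^sup>L lborel (g n)) sums (LINT t|lborel. suminf (\<lambda>n. g n t))"
    by (rule sums_integral[OF gi s1 s2])
  moreover have "integral\<^sup>L lborel (g n) = a n * z ^ n" for n
    unfolding g_def[abs_def] a_def by (rule integral_mult_left_zero)
  moreover have "suminf (\<lambda>n. g n t) = fourier_integrand f z t" for t
  proof -
    have "(\<lambda>n. (\<i> * complex_of_real t * z) ^ n /\<^sub>R fact n) sums exp (\<i> * complex_of_real t * z)"
      by (rule exp_converges)
    from sums_mult[OF this, of "complex_of_real (f t)"]
    have "(\<lambda>n. g n t) sums fourier_integrand f z t"
      by (simp add: g_def fourier_integrand_def power_mult_distrib scaleR_conv_of_real divide_inverse mult_ac)
    then show ?thesis by (simp add: sums_iff)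
  qed
  ultimately show ?thesis by (simp add: fourier_transform_def)
qed

lemma holomorphic_fourier_transform: "fourier_transform f holomorphic_on UNIV"
proof -
  define a where "a n = (LINT t|lborel. complex_of_real (f t) * ((\<i> * complex_of_real t) ^ n / fact n))" for n
  have a: "(\<lambda>n. a n * z ^ n) sums fourier_transform f z" for z
    unfolding a_def by (rule fourier_transform_sums)
  have "fourier_transform f = (\<lambda>z. suminf (\<lambda>n. a n * z ^ n))" using a by (auto simp: sums_iff)
  moreover have "((\<lambda>z. suminf (\<lambda>n. a n * z ^ n)) has_field_derivative suminf (\<lambda>n. diffs a n * w ^ n)) (at w)" for w
    by (rule termdiffs_strong_converges_everywhere) (use a in \<open>auto simp: sums_iff\<close>)
  ultimately show ?thesis
    by (auto simp: holomorphic_on_def field_differentiable_def)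
qed

end

section \<open>Invariance under isomorphism\<close>

lemma ring_iso_image_ideal:
  assumes "ring R" "ring S" and \<eta>: "\<eta> \<in> ring_iso R S" and I: "ideal I R"
  shows "ideal (\<eta> ` I) S"
proof -
  interpret R: ring R by (rule assms(1))
  interpret S: ring S by (rule assms(2))
  interpret I: ideal I R by (rule I)
  have h: "\<eta> \<in> ring_hom R S" and bij: "bij_betw \<eta> (carrier R) (carrier S)" using \<eta> by (auto simp: ring_iso_def)
  interpret h: ring_hom_ring R S \<eta> by (rule ring_hom_ringI2[OF assms(1,2) h])
  interpret g: group_hom "add_monoid R" "add_monoid S" \<eta> by (rule h.a_group_hom)
  show ?thesis
  proof (rule idealI[OF assms(2)])
    show "subgroup (\<eta> ` I) (add_monoid S)"
      by (rule g.subgroup_img_is_subgroup) (rule I.a_subgroup)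
    fix a x assume "a \<in> \<eta> ` I" and x: "x \<in> carrier S"
    then obtain i where i: "i \<in> I" "a = \<eta> i" by blast
    obtain r where r: "r \<in> carrier R" "x = \<eta> r" using x bij by (auto simp: bij_betw_def)
    have ic: "i \<in> carrier R" using i(1) I.Icarr by blast
    have "x \<otimes>\<^bsub>S\<^esub> a = \<eta> (r \<otimes>\<^bsub>R\<^esub> i)" using i(2) r h.hom_mult[OF r(1) ic] by simp
    then show "x \<otimes>\<^bsub>S\<^esub> a \<in> \<eta> ` I" using imageI[OF I.I_l_closed[OF i(1) r(1)]] by simp
    have "a \<otimes>\<^bsub>S\<^esub> x = \<eta> (i \<otimes>\<^bsub>R\<^esub> r)" using i(2) r h.hom_mult[OF ic r(1)] by simp
    then show "a \<otimes>\<^bsub>S\<^esub> x \<in> \<eta> ` I" using imageI[OF I.I_r_closed[OF i(1) r(1)]] by simp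
  qed
qed

lemma ring_iso_image_primeideal:
  assumes "cring R" "cring S" and \<eta>: "\<eta> \<in> ring_iso R S" and I: "primeideal I R"
  shows "primeideal (\<eta> ` I) S"
proof -
  interpret R: cring R by (rule assms(1))
  interpret S: cring S by (rule assms(2))
  interpret I: primeideal I R by (rule I)
  have h: "\<eta> \<in> ring_hom R S" and bij: "bij_betw \<eta> (carrier R) (carrier S)" using \<eta> by (auto simp: ring_iso_def)
  have inj: "inj_on \<eta> (carrier R)" and im: "\<eta> ` carrier R = carrier S" using bij by (auto simp: bij_betw_def)
  have Ic: "I \<subseteq> carrier R" using I.Icarr by blast
  have mem: "\<eta> r \<in> \<eta> ` I \<longleftrightarrow> r \<in> I" if "r \<in> carrier R" for r
    by (rule inj_on_image_mem_iff[OF inj that Ic])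
  show ?thesis
  proof (rule primeidealI)
    show "ideal (\<eta> ` I) S" by (rule ring_iso_image_ideal[OF R.ring_axioms S.ring_axioms \<eta> I.is_ideal])
    show "cring S" by (rule assms(2))
    show "carrier S \<noteq> \<eta> ` I"
    proof
      assume "carrier S = \<eta> ` I"
      then have "carrier R \<subseteq> I" using im mem by blast
      then show False using I.I_notcarr Ic by blast
    qed
    fix a b assume "a \<in> carrier S" "b \<in> carrier S" and ab: "a \<otimes>\<^bsub>S\<^esub> b \<in> \<eta> ` I"
    then obtain x y where xy: "x \<in> carrier R" "y \<in> carrier R" "a = \<eta> x" "b = \<eta> y" using im by blast
    then have "\<eta> (x \<otimes>\<^bsub>R\<^esub> y) \<in> \<eta> ` I" using ab ring_hom_mult[OF h xy(1,2)] by simp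
    then have "x \<otimes>\<^bsub>R\<^esub> y \<in> I" using mem xy by simp
    then show "a \<in> \<eta> ` I \<or> b \<in> \<eta> ` I" using I.I_prime[OF xy(1,2)] xy by blast
  qed
qed

lemma inv_into_image_cancel:
  assumes "bij_betw \<eta> A B"
  shows "V \<subseteq> A \<Longrightarrow> inv_into A \<eta> ` \<eta> ` V = V" and "W \<subseteq> B \<Longrightarrow> \<eta> ` inv_into A \<eta> ` W = W"
  using assms by (auto simp: bij_betw_def inv_into_image_cancel image_inv_into_cancel)

lemma krull_dim_iso:
  assumes "cring R" "cring S" and \<eta>: "\<eta> \<in> ring_iso R S"
  shows "krull_dim R = krull_dim S"
proof -
  let ?i = "inv_into (carrier R) \<eta>"
  have bij: "bij_betw \<eta> (carrier R) (carrier S)" using \<eta> by (auto simp: ring_iso_def)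
  have i: "?i \<in> ring_iso S R" by (rule ring_iso_set_sym[OF cring.axioms(1)[OF assms(1)] \<eta>])
  have subR: "I \<subseteq> carrier R" if "primeideal I R" for I
    using ideal.Icarr[OF primeideal.axioms(1)[OF that]] by blast
  have subS: "I \<subseteq> carrier S" if "primeideal I S" for I
    using ideal.Icarr[OF primeideal.axioms(1)[OF that]] by blast
  have "chain_length {I. primeideal I R} = chain_length {I. primeideal I S}"
  proof (rule chain_length_bij[where f = "\<lambda>I. \<eta> ` I" and g = "\<lambda>I. ?i ` I"])
    show "\<eta> ` I \<in> {I. primeideal I S}" if "I \<in> {I. primeideal I R}" for I
      using ring_iso_image_primeideal[OF assms] that by blast
    show "?i ` I \<in> {I. primeideal I R}" if "I \<in> {I. primeideal I S}" for I
      using ring_iso_image_primeideal[OF assms(2,1) i] that by blast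
    show "?i ` \<eta> ` I = I" if "I \<in> {I. primeideal I R}" for I
      by (rule inv_into_image_cancel(1)[OF bij]) (use that subR in simp)
    show "\<eta> ` ?i ` I = I" if "I \<in> {I. primeideal I S}" for I
      by (rule inv_into_image_cancel(2)[OF bij]) (use that subS in simp)
  qed (rule image_mono, assumption)+
  then show ?thesis by (simp add: krull_dim_def chain_length_def)
qed

lemma frobenius_power_iso_subset:
  assumes "ring R" "ring S" and \<eta>: "\<eta> \<in> ring_iso R S" and I: "I \<subseteq> carrier R"
  shows "\<eta> ` frobenius_power R I q \<subseteq> frobenius_power S (\<eta> ` I) q"
proof -
  interpret R: ring R by (rule assms(1))
  interpret S: ring S by (rule assms(2))
  have h: "\<eta> \<in> ring_hom R S" and bij: "bij_betw \<eta> (carrier R) (carrier S)" using \<eta> by (auto simp: ring_iso_def)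
  interpret h: ring_hom_ring R S \<eta> by (rule ring_hom_ringI2[OF assms(1,2) h])
  let ?i = "inv_into (carrier R) \<eta>"
  have i: "?i \<in> ring_iso S R" by (rule ring_iso_set_sym[OF assms(1) \<eta>])
  have sub: "(\<lambda>a. a [^]\<^bsub>S\<^esub> q) ` \<eta> ` I \<subseteq> carrier S" using I by auto
  let ?J = "frobenius_power S (\<eta> ` I) q"
  have J: "ideal ?J S" unfolding frobenius_power_def by (rule S.genideal_ideal[OF sub])
  have Jc: "?J \<subseteq> carrier S" using ideal.Icarr[OF J] by blast
  have iJ: "ideal (?i ` ?J) R" by (rule ring_iso_image_ideal[OF assms(2,1) i J])
  have "(\<lambda>a. a [^]\<^bsub>R\<^esub> q) ` I \<subseteq> ?i ` ?J"
  proof (rule image_subsetI)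
    fix a assume a: "a \<in> I"
    then have ac: "a \<in> carrier R" using I by blast
    have "\<eta> a [^]\<^bsub>S\<^esub> q \<in> ?J" using S.genideal_self[OF sub] a unfolding frobenius_power_def by blast
    then have "\<eta> (a [^]\<^bsub>R\<^esub> q) \<in> ?J" using h.hom_nat_pow[OF ac, of q] by simp
    then have "?i (\<eta> (a [^]\<^bsub>R\<^esub> q)) \<in> ?i ` ?J" by (rule imageI)
    then show "a [^]\<^bsub>R\<^esub> q \<in> ?i ` ?J"
      using bij ac by (simp add: bij_betw_def inv_into_f_f)
  qed
  then have "frobenius_power R I q \<subseteq> ?i ` ?J"
    unfolding frobenius_power_def[of R] by (rule R.genideal_minimal[OF iJ])
  then have "\<eta> ` frobenius_power R I q \<subseteq> \<eta> ` ?i ` ?J" by (rule image_mono)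
  also have "\<dots> = ?J" by (rule inv_into_image_cancel(2)[OF bij Jc])
  finally show ?thesis .
qed

lemma frobenius_power_iso:
  assumes "ring R" "ring S" and \<eta>: "\<eta> \<in> ring_iso R S" and I: "ideal I R"
  shows "\<eta> ` frobenius_power R I q = frobenius_power S (\<eta> ` I) q"
proof
  have Ic: "I \<subseteq> carrier R" using ideal.Icarr[OF I] by blast
  have bij: "bij_betw \<eta> (carrier R) (carrier S)" using \<eta> by (auto simp: ring_iso_def)
  show "\<eta> ` frobenius_power R I q \<subseteq> frobenius_power S (\<eta> ` I) q"
    by (rule frobenius_power_iso_subset[OF assms(1-3) Ic])
  let ?i = "inv_into (carrier R) \<eta>"
  have i: "?i \<in> ring_iso S R" by (rule ring_iso_set_sym[OF assms(1) \<eta>])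
  interpret S: ring S by (rule assms(2))
  have e: "\<eta> ` I \<subseteq> carrier S" using Ic bij by (auto simp: bij_betw_def)
  have sub: "(\<lambda>a. a [^]\<^bsub>S\<^esub> q) ` \<eta> ` I \<subseteq> carrier S" using e by auto
  have Jc: "frobenius_power S (\<eta> ` I) q \<subseteq> carrier S"
    using ideal.Icarr[OF S.genideal_ideal[OF sub]] unfolding frobenius_power_def by blast
  have "?i ` frobenius_power S (\<eta> ` I) q \<subseteq> frobenius_power R (?i ` \<eta> ` I) q"
    by (rule frobenius_power_iso_subset[OF assms(2,1) i e])
  then have "\<eta> ` ?i ` frobenius_power S (\<eta> ` I) q \<subseteq> \<eta> ` frobenius_power R I q"
    unfolding inv_into_image_cancel(1)[OF bij Ic] by (rule image_mono)
  then show "frobenius_power S (\<eta> ` I) q \<subseteq> \<eta> ` frobenius_power R I q"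
    unfolding inv_into_image_cancel(2)[OF bij Jc] .
qed

text \<open>The isomorphism may move scalars, but it maps the degree-0 field onto the degree-0
  field, and this is enough to preserve subspaces.\<close>

lemma ksub_iso:
  assumes "graded_algebra R G" "graded_algebra S H" and \<eta>: "\<eta> \<in> ring_iso R S" and G0: "\<eta> ` G 0 = H 0"
    and W: "graded_algebra.ksub R G W"
  shows "graded_algebra.ksub S H (\<eta> ` W)"
proof -
  interpret R: graded_algebra R G by (rule assms(1))
  interpret S: graded_algebra S H by (rule assms(2))
  have h: "\<eta> \<in> ring_hom R S" using \<eta> by (simp add: ring_iso_def)
  interpret h: ring_hom_ring R S \<eta> by (rule ring_hom_ringI2[OF R.ring_axioms S.ring_axioms h])
  have Wc: "W \<subseteq> carrier R" using R.ksub_carrier[OF W] by blast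
  show ?thesis
  proof (rule S.ksubI)
    show "x \<in> carrier S" if "x \<in> \<eta> ` W" for x using that Wc by auto
    show "\<zero>\<^bsub>S\<^esub> \<in> \<eta> ` W" using imageI[OF R.ksub_zero[OF W], of \<eta>] by simp
  next
    fix x y assume "x \<in> \<eta> ` W" "y \<in> \<eta> ` W"
    then obtain a b where ab: "a \<in> W" "b \<in> W" "x = \<eta> a" "y = \<eta> b" by blast
    have "a \<in> carrier R" "b \<in> carrier R" using ab Wc by auto
    then have "x \<oplus>\<^bsub>S\<^esub> y = \<eta> (a \<oplus>\<^bsub>R\<^esub> b)" using ab by simp
    then show "x \<oplus>\<^bsub>S\<^esub> y \<in> \<eta> ` W" using imageI[OF R.ksub_add[OF W ab(1,2)]] by simp
  next
    fix c x assume "c \<in> H 0" "x \<in> \<eta> ` W"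
    then obtain d a where ab: "d \<in> G 0" "a \<in> W" "c = \<eta> d" "x = \<eta> a" using G0 by blast
    have "d \<in> carrier R" "a \<in> carrier R" using ab Wc R.G_carrier by auto
    then have "c \<otimes>\<^bsub>S\<^esub> x = \<eta> (d \<otimes>\<^bsub>R\<^esub> a)" using ab by simp
    then show "c \<otimes>\<^bsub>S\<^esub> x \<in> \<eta> ` W" using imageI[OF R.ksub_smult[OF W ab(1,2)]] by simp
  qed
qed

lemma len_iso:
  assumes R: "graded_algebra R G" and S: "graded_algebra S H" and \<eta>: "\<eta> \<in> ring_iso R S" and G0: "\<eta> ` G 0 = H 0"
    and sub: "U \<subseteq> carrier R" "V \<subseteq> carrier R"
  shows "graded_algebra.len R G U V = graded_algebra.len S H (\<eta> ` U) (\<eta> ` V)"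
proof -
  interpret R: graded_algebra R G by (rule R)
  interpret S: graded_algebra S H by (rule S)
  let ?i = "inv_into (carrier R) \<eta>"
  have bij: "bij_betw \<eta> (carrier R) (carrier S)" using \<eta> by (auto simp: ring_iso_def)
  have i: "?i \<in> ring_iso S R" by (rule ring_iso_set_sym[OF R.ring_axioms \<eta>])
  have G0c: "G 0 \<subseteq> carrier R" using R.G_carrier by blast
  have i0: "?i ` H 0 = G 0" unfolding G0[symmetric] by (rule inv_into_image_cancel(1)[OF bij G0c])
  have U: "?i ` \<eta> ` U = U" and V: "?i ` \<eta> ` V = V" using inv_into_image_cancel(1)[OF bij] sub by auto
  show ?thesis unfolding R.len_def S.len_def
  proof (rule chain_length_bij[where f = "\<lambda>I. \<eta> ` I" and g = "\<lambda>I. ?i ` I"])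
    fix W assume "W \<in> {W. R.ksub W \<and> U \<subseteq> W \<and> W \<subseteq> V}"
    then have W: "R.ksub W" "U \<subseteq> W" "W \<subseteq> V" by auto
    show "\<eta> ` W \<in> {W. S.ksub W \<and> \<eta> ` U \<subseteq> W \<and> W \<subseteq> \<eta> ` V}"
      by (intro CollectI conjI ksub_iso[OF R S \<eta> G0 W(1)] image_mono W(2,3))
    show "?i ` \<eta> ` W = W" by (rule inv_into_image_cancel(1)[OF bij order_trans[OF W(3) sub(2)]])
  next
    fix W assume "W \<in> {W. S.ksub W \<and> \<eta> ` U \<subseteq> W \<and> W \<subseteq> \<eta> ` V}"
    then have W: "S.ksub W" "\<eta> ` U \<subseteq> W" "W \<subseteq> \<eta> ` V" by auto
    have "U \<subseteq> ?i ` W" "?i ` W \<subseteq> V" using image_mono[OF W(2), of ?i] image_mono[OF W(3), of ?i] U V by auto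
    then show "?i ` W \<in> {W. R.ksub W \<and> U \<subseteq> W \<and> W \<subseteq> V}"
      by (intro CollectI conjI ksub_iso[OF S R i i0 W(1)])
    have "W \<subseteq> carrier S" using S.ksub_carrier[OF W(1)] by blast
    then show "\<eta> ` ?i ` W = W" by (rule inv_into_image_cancel(2)[OF bij])
  qed (rule image_mono, assumption)+
qed

text \<open>Dimension, Frobenius powers and lengths are all determined by the graded ring and the
  ideal, so even the functions before passing to the limit agree.\<close>

lemma hk_fn_isomorphic:
  fixes K :: "'k ring" and P :: "('k, 'a) sg_data" and Q :: "('k, 'b) sg_data"
  assumes K: "field K" and P: "sg_pair K P" and Q: "sg_pair K Q" and iso: "sg_isomorphic P Q"
  shows "hk_fn K P = hk_fn K Q"
proof -
  obtain \<eta> where \<eta>: "\<eta> \<in> ring_iso (sg_ring P) (sg_ring Q)" "\<And>n. \<eta> ` sg_grade P n = sg_grade Q n"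
    "\<eta> ` sg_ideal P = sg_ideal Q" using iso by (auto simp: sg_isomorphic_def)
  note gP = sg_pair_graded_algebra[OF K P] and gQ = sg_pair_graded_algebra[OF K Q]
  interpret P: graded_algebra "sg_ring P" "sg_grade P" by (rule gP)
  interpret Q: graded_algebra "sg_ring Q" "sg_grade Q" by (rule gQ)
  have inj: "inj_on \<eta> (carrier (sg_ring P))" using \<eta>(1) by (auto simp: ring_iso_def bij_betw_def)
  have idP: "ideal (sg_ideal P) (sg_ring P)" using P by (auto simp: sg_pair_def graded_ideal_def)
  have dim: "sg_dim P = sg_dim Q"
    unfolding sg_dim_def using krull_dim_iso[OF P.is_cring Q.is_cring \<eta>(1)] by simp
  have len: "graded_quotient_length K P (frobenius_power (sg_ring P) (sg_ideal P) q) m =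
      graded_quotient_length K Q (frobenius_power (sg_ring Q) (sg_ideal Q) q) m" for q m
  proof -
    let ?J = "frobenius_power (sg_ring P) (sg_ideal P) q"
    have "(\<lambda>a. a [^]\<^bsub>sg_ring P\<^esub> q) ` sg_ideal P \<subseteq> carrier (sg_ring P)" using ideal.Icarr[OF idP] by auto
    then have J: "ideal ?J (sg_ring P)" unfolding frobenius_power_def by (rule P.genideal_ideal)
    have J': "\<eta> ` ?J = frobenius_power (sg_ring Q) (sg_ideal Q) q"
      using frobenius_power_iso[OF P.ring_axioms Q.ring_axioms \<eta>(1) idP] \<eta>(3) by simp
    have iJ: "ideal (\<eta> ` ?J) (sg_ring Q)" by (rule ring_iso_image_ideal[OF P.ring_axioms Q.ring_axioms \<eta>(1) J])
    have c: "?J \<subseteq> carrier (sg_ring P)" "sg_grade P m \<subseteq> carrier (sg_ring P)"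
      using ideal.Icarr[OF J] P.G_carrier by blast+
    have "P.len (?J \<inter> sg_grade P m) (sg_grade P m) = Q.len (\<eta> ` (?J \<inter> sg_grade P m)) (\<eta> ` sg_grade P m)"
      by (rule len_iso[OF gP gQ \<eta>(1)]) (use \<eta>(2) c in auto)
    also have "\<eta> ` (?J \<inter> sg_grade P m) = \<eta> ` ?J \<inter> sg_grade Q m"
      using inj_on_image_Int[OF inj c] \<eta>(2) by simp
    finally show ?thesis
      using graded_quotient_length_eq[OF K P J] graded_quotient_length_eq[OF K Q iJ] \<eta>(2) J' by simp
  qed
  show ?thesis by (intro ext) (simp add: hk_fn_def Let_def dim len)
qed

section \<open>Limits of Fourier transforms\<close>

text \<open>Dominated convergence; on the finite set \<open>S\<close>, a null set,
  \<open>lim\<close> may be unspecified. The limit inherits the bound almost everywhere and so has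
  an entire transform.\<close>

lemma fourier_transform_limit:
  fixes f :: "nat \<Rightarrow> real \<Rightarrow> real"
  assumes f [measurable]: "\<And>n. f n \<in> borel_measurable borel" and CB: "C \<ge> 0" "B \<ge> (0::real)"
    and bd: "\<And>n t. norm (f n t) \<le> C * indicator {0..B} t"
    and S: "finite S" and conv: "\<And>t. t \<notin> S \<Longrightarrow> convergent (\<lambda>n. f n t)"
  defines "g \<equiv> \<lambda>t. lim (\<lambda>n. f n t)"
  shows "(\<lambda>n. fourier_transform (f n) z) \<longlonglongrightarrow> fourier_transform g z"
    and "integrable lborel (fourier_integrand g z)" and "fourier_transform g holomorphic_on UNIV"
proof -
  have g [measurable]: "g \<in> borel_measurable borel" unfolding g_def by measurable
  have "AE t in lborel. t \<notin> S" by (rule AE_not_in[OF finite_imp_null_set_lborel[OF S]])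
  then have lim: "AE t in lborel. (\<lambda>n. f n t) \<longlonglongrightarrow> g t"
    by eventually_elim (use conv in \<open>simp add: g_def convergent_LIMSEQ_iff\<close>)
  have gb: "AE t in lborel. norm (g t) \<le> C * indicator {0..B} t"
    using lim
  proof eventually_elim
    case (elim t)
    from tendsto_norm[OF this] show ?case
      by (rule LIMSEQ_le_const2) (use bd in blast)
  qed
  show "integrable lborel (fourier_integrand g z)" by (rule integrable_fourier_integrand[OF g CB gb])
  show "fourier_transform g holomorphic_on UNIV" by (rule holomorphic_fourier_transform[OF g CB gb])
  show "(\<lambda>n. fourier_transform (f n) z) \<longlonglongrightarrow> fourier_transform g z"
    unfolding fourier_transform_def
  proof (rule integral_dominated_convergence)
    show "integrable lborel (\<lambda>t. C * exp (B * norm z) * indicator {0..B} t)"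
      by (intro integrable_mult_right integrable_indicator_Icc[OF g CB gb])
    show "AE t in lborel. (\<lambda>n. fourier_integrand (f n) z t) \<longlonglongrightarrow> fourier_integrand g z t"
      using lim by eventually_elim (auto simp: fourier_integrand_def intro!: tendsto_intros)
    show "AE t in lborel. norm (fourier_integrand (f n) z t) \<le> C * exp (B * norm z) * indicator {0..B} t" for n
      by (intro always_eventually allI fourier_integrand_bound[OF bd CB])
  qed measurable
qed

text \<open>The substitution of \<open>x / q\<close> for \<open>x\<close>. In dimension 0 it turns
  concentration of the functions at 0 into evaluation of one transform near 0.\<close>

lemma fourier_transform_scale:
  assumes "q > 0"
  shows "fourier_transform (\<lambda>x. q * w (q * x)) z = fourier_transform w (z / complex_of_real q)"
proof -
  have "fourier_transform (\<lambda>x. q * w (q * x)) z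
      = \<bar>1 / q\<bar> *\<^sub>R (LINT x|lborel. fourier_integrand (\<lambda>x. q * w (q * x)) z (0 + 1 / q * x))"
    unfolding fourier_transform_def by (rule lborel_integral_real_affine) (use assms in simp)
  also have "\<dots> = (LINT x|lborel. \<bar>1 / q\<bar> *\<^sub>R fourier_integrand (\<lambda>x. q * w (q * x)) z (0 + 1 / q * x))"
    by (rule integral_scaleR_right[symmetric])
  also have "\<dots> = (LINT x|lborel. fourier_integrand w (z / complex_of_real q) x)"
  proof (rule Bochner_Integration.integral_cong[OF refl])
    fix x
    show "\<bar>1 / q\<bar> *\<^sub>R fourier_integrand (\<lambda>x. q * w (q * x)) z (0 + 1 / q * x)
        = fourier_integrand w (z / complex_of_real q) x"
      using assms by (simp add: fourier_integrand_def scaleR_conv_of_real)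
  qed
  finally show ?thesis by (simp add: fourier_transform_def)
qed

lemma step_function_borel:
  "(\<lambda>x::real. if x < 0 then 0 else c * v (nat \<lfloor>x * a\<rfloor>) :: real) \<in> borel_measurable borel"
proof -
  have [measurable]: "(\<lambda>x::real. v (nat \<lfloor>x * a\<rfloor>)) \<in> borel_measurable borel"
    by (rule measurable_compose[where N = "count_space UNIV" and g = "\<lambda>k. v (nat k)"]) measurable
  show ?thesis by measurable
qed

lemma hk_fourier:
  fixes K :: "'k ring" and P :: "('k, 'a) sg_data"
  assumes K: "algebraically_closed K" "ring_char K > 0" and P: "sg_pair K P"
  shows "(\<forall>z. convergent (\<lambda>n. fourier_transform (hk_fn K P n) z)) \<and> hk_F K P holomorphic_on UNIV \<and>
    (krull_dim (sg_ring P) \<ge> 1 \<longrightarrow> (\<forall>z. integrable lborel (fourier_integrand (hk_density K P) z) \<and>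
      hk_F K P z = fourier_transform (hk_density K P) z))"
proof -
  interpret K: algebraically_closed K by (rule K(1))
  interpret graded_algebra "sg_ring P" "sg_grade P"
    by (rule sg_pair_graded_algebra[OF K.field_axioms P])
  define p where "p = ring_char K"
  have p: "frob p" "p \<ge> 2" using sg_pair_frob[OF K P] by (simp_all add: p_def)
  have p1: "1 \<le> real (p ^ n)" for n using p(2) by simp
  define I where "I = sg_ideal P"
  have I: "graded_ideal (sg_ring P) (sg_grade P) I" "I \<noteq> carrier (sg_ring P)"
    and fin: "quotient_length (sg_ring P) I < \<infinity>" using P by (auto simp: sg_pair_def I_def)
  have idI: "ideal I (sg_ring P)" using I(1) by (simp add: graded_ideal_def)
  obtain hs where hs: "valid 1 0 hs" "fspan 1 0 (sg_grade P) Z hs = part I"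
    using homog_finitely_generated[OF homog_part[OF idI]] by blast
  define N where "N n = fspan 1 0 (sg_grade P) Z (pow_gens (p ^ n) hs)" for n
  have hN: "homog (N n)" for n unfolding N_def by (rule homog_fspan[OF homog_Z valid_pow_gens[OF hs(1)]])
  obtain d where d: "krull_dim (sg_ring P) = enat d" "eventually_poly d (hilb Z)"
    "\<And>P. hprime P \<Longrightarrow> eventually_poly d (hilb P)" using krull_dim_hilb by blast
  have sd: "sg_dim P = d" by (simp add: sg_dim_def d(1))
  have fn: "hk_fn K P n = (\<lambda>x. if x < 0 then 0 else
      1 / real (p ^ n) powi (int d - 1) * hilb (N n) (nat \<lfloor>x * real (p ^ n)\<rfloor>))" for n
  proof
    fix x
    let ?J = "frobenius_power (sg_ring P) I (p ^ n)"
    note J = frobenius_power_part[OF frob_power[OF p(1)] I(1) hs, of n]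
    have "real (the_enat (graded_quotient_length K P ?J m)) = hilb (N n) m" for m
      unfolding graded_quotient_length_eq[OF K.field_axioms P J(1)] N_def J(2)[symmetric]
      by (simp add: hilb_def rlen_def part_def)
    then show "hk_fn K P n x = (if x < 0 then 0 else
        1 / real (p ^ n) powi (int d - 1) * hilb (N n) (nat \<lfloor>x * real (p ^ n)\<rfloor>))"
      by (simp add: hk_fn_def Let_def p_def[symmetric] I_def[symmetric] sd)
  qed
  have meas: "hk_fn K P n \<in> borel_measurable borel" for n
    unfolding fn by (rule step_function_borel)
  show ?thesis
  proof (cases d)
    case (Suc \<delta>)
    have powi: "real (p ^ n) powi (int d - 1) = real (p ^ n) ^ \<delta>" for n by (simp add: Suc)
    obtain E where "\<And>m. m \<ge> E \<Longrightarrow> part I m = sg_grade P m" using part_eventually_full[OF I(1) fin] by blast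
    then obtain B where B: "\<And>n m. m \<ge> B * p ^ n \<Longrightarrow> N n m = sg_grade P m"
      using frobenius_support[OF p hs(1)] hs(2) unfolding N_def by metis
    have "growth (Suc \<delta>) (hilb Z)" using eventually_poly_growth[OF d(2)] Suc by simp
    then obtain C :: nat where C: "\<And>m. hilb Z m \<le> real C * (real m + 1) ^ \<delta>"
      unfolding growth_def by auto
    \<comment> \<open>On the support the sampled degree satisfies
      \<open>m + 1 \<le> (B + 1) * q\<close>, which with the bound on \<open>hilb Z\<close> gives
      this constant after division by \<open>q ^ \<delta>\<close>.\<close>
    define C' where "C' = real C * (real B + 1) ^ \<delta>"
    have bd: "norm (hk_fn K P n t) \<le> C' * indicator {0..real B} t" for n t
    proof (cases "0 \<le> t \<and> t \<le> real B")
      case True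
      define q where "q = real (p ^ n)"
      have q: "q \<ge> 1" unfolding q_def by (rule p1)
      let ?m = "nat \<lfloor>t * q\<rfloor>"
      have "real ?m \<le> t * q" using True q by (intro of_nat_floor) simp
      also have "\<dots> \<le> real B * q" using True q by (intro mult_right_mono) auto
      finally have "real ?m + 1 \<le> (real B + 1) * q" using q by (simp add: algebra_simps)
      then have "(real ?m + 1) ^ \<delta> \<le> ((real B + 1) * q) ^ \<delta>" by (intro power_mono) auto
      then have "real C * (real ?m + 1) ^ \<delta> \<le> C' * q ^ \<delta>"
        unfolding C'_def by (simp add: power_mult_distrib mult_left_mono mult.assoc)
      moreover have "hilb (N n) ?m \<le> hilb Z ?m" by (rule hilb_antimono[OF homog_Z Z_le[OF hN]])
      ultimately have "hilb (N n) ?m \<le> C' * q ^ \<delta>" using C[of ?m] by linarith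
      then have "hilb (N n) ?m / q ^ \<delta> \<le> C'" using q by (simp add: field_simps)
      moreover have "hk_fn K P n t = hilb (N n) ?m / q ^ \<delta>" unfolding fn powi using True by (simp add: q_def)
      moreover have "hilb (N n) ?m / q ^ \<delta> \<ge> 0" using q by simp
      ultimately show ?thesis using True by simp
    next
      case False
      have "hk_fn K P n t = 0"
      proof (cases "t < 0")
        case True
        then show ?thesis unfolding fn by simp
      next
        case neg: False
        then have "real B \<le> t" using False by simp
        then have "real B * real (p ^ n) \<le> t * real (p ^ n)" by (rule mult_right_mono) simp
        then have "real (B * p ^ n) \<le> t * real (p ^ n)" by simp
        then have "B * p ^ n \<le> nat \<lfloor>t * real (p ^ n)\<rfloor>" by (rule le_nat_floor)
        from B[OF this] show ?thesis unfolding fn by (simp add: hilb_def)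
      qed
      then show ?thesis by (simp add: C'_def)
    qed
    \<comment> \<open>The points left out by \<open>normalized_length_convergent\<close>.\<close>
    define S where "S = insert 0 ((\<lambda>t. real (fst t)) ` set hs)"
    have conv: "convergent (\<lambda>n. hk_fn K P n t)" if t: "t \<notin> S" for t
    proof (cases "t < 0")
      case True
      then show ?thesis unfolding fn by (simp add: convergent_const)
    next
      case False
      then have "t > 0" "\<And>s. s \<in> set hs \<Longrightarrow> t \<noteq> real (fst s)" using t by (auto simp: S_def)
      from normalized_length_convergent[OF d(3)[unfolded Suc] d(2)[unfolded Suc] p hs(1) this]
      show ?thesis unfolding fn powi using \<open>t > 0\<close> by (simp add: N_def)
    qed
    have "finite S" by (simp add: S_def)
    have C0: "C' \<ge> 0" "real B \<ge> 0" by (simp_all add: C'_def)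
    have dens: "hk_density K P = (\<lambda>t. lim (\<lambda>n. hk_fn K P n t))" by (rule ext) (simp add: hk_density_def)
    note lim = fourier_transform_limit[OF meas C0 bd \<open>finite S\<close> conv, folded dens]
    have F: "hk_F K P z = fourier_transform (hk_density K P) z" for z
      unfolding hk_F_def by (rule limI[OF lim(1)])
    then have "hk_F K P = fourier_transform (hk_density K P)" by blast
    then show ?thesis using lim F by (auto intro: convergentI)
  next
    case 0
    obtain M where M: "\<And>m. m \<ge> M \<Longrightarrow> hilb Z m = 0" using d(2) 0 by auto
    have G0: "sg_grade P m = {\<zero>\<^bsub>sg_ring P\<^esub>}" if "m \<ge> M" for m
      using hilb_zero_imp[OF homog_Z M[OF that]] by simp
    \<comment> \<open>Nonzero elements of degree 0 are units and \<open>I\<close> is proper, so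
      every nonzero generator has positive degree.\<close>
    have I0: "part I 0 = {\<zero>\<^bsub>sg_ring P\<^esub>}"
    proof -
      have "c = \<zero>\<^bsub>sg_ring P\<^esub>" if c: "c \<in> part I 0" for c
      proof (rule ccontr)
        assume nz: "c \<noteq> \<zero>\<^bsub>sg_ring P\<^esub>"
        have cG: "c \<in> sg_grade P 0" "c \<in> I" using c by (auto simp: part_def)
        obtain e where e: "e \<in> sg_grade P 0" "c \<otimes>\<^bsub>sg_ring P\<^esub> e = \<one>\<^bsub>sg_ring P\<^esub>" using G0_inverse[OF cG(1) nz] by blast
        have "\<one>\<^bsub>sg_ring P\<^esub> \<in> I" using ideal.I_r_closed[OF idI cG(2) G_carrier[OF e(1)]] e(2) by simp
        then show False using ideal.one_imp_carrier[OF idI] I(2) by blast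
      qed
      then show ?thesis using homog_zero[OF homog_part[OF idI]] by blast
    qed
    \<comment> \<open>The \<open>p ^ n\<close>-th power of a generator of positive degree lands in a
      degree of at least \<open>M\<close>, where the ring vanishes.\<close>
    have NZ: "N n = Z" if n: "p ^ n \<ge> M" for n
    proof (rule antisym)
      have "snd s \<in> Z (fst s)" if s: "s \<in> set (pow_gens (p ^ n) hs)" for s
      proof -
        obtain t where t: "t \<in> set hs" "s = (p ^ n * fst t, snd t [^]\<^bsub>sg_ring P\<^esub> (p ^ n))"
          using s by (auto simp: pow_gens_def)
        have tI: "snd t \<in> part I (fst t)" using fspan_mem1[OF homog_Z hs(1) t(1)] hs(2) by simp
        have "snd t [^]\<^bsub>sg_ring P\<^esub> (p ^ n) = \<zero>\<^bsub>sg_ring P\<^esub>"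
        proof (cases "fst t = 0")
          case True
          then have "snd t = \<zero>\<^bsub>sg_ring P\<^esub>" using tI I0 by simp
          then show ?thesis using pow_zero[of "p ^ n"] p(2) by simp
        next
          case False
          have "snd t \<in> sg_grade P (fst t)" using tI by (simp add: part_def)
          then have "snd t [^]\<^bsub>sg_ring P\<^esub> (p ^ n) \<in> sg_grade P (p ^ n * fst t)" by (rule G_pow)
          moreover have "M \<le> p ^ n * fst t" using n False by (metis le_trans mult_le_mono2 nat_mult_1_right One_nat_def Suc_leI neq0_conv)
          ultimately show ?thesis using G0 by blast
        qed
        then show ?thesis using t(2) by simp
      qed
      then show "N n \<le> Z" unfolding N_def by (intro fspan_least homog_Z order_refl)
      show "Z \<le> N n" by (rule Z_le[OF hN])
    qed
    \<comment> \<open>The step function of the Hilbert function of the ring itself, to which all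
      late Frobenius powers lead.\<close>
    define w where "w t = (if t < 0 then 0 else hilb Z (nat \<lfloor>t\<rfloor>))" for t :: real
    have w: "w \<in> borel_measurable borel" using step_function_borel[of 1 "hilb Z" 1] by (simp add: w_def[abs_def])
    define C where "C = (\<Sum>m<M. hilb Z m)"
    have C0: "C \<ge> 0" "real M \<ge> 0" by (auto simp: C_def intro: sum_nonneg)
    have wb: "norm (w t) \<le> C * indicator {0..real M} t" for t
    proof (cases "0 \<le> t \<and> nat \<lfloor>t\<rfloor> < M")
      case True
      have "hilb Z (nat \<lfloor>t\<rfloor>) \<le> C" unfolding C_def by (rule member_le_sum) (use True in auto)
      moreover have "t \<le> real M" using True by linarith
      ultimately show ?thesis using True by (simp add: w_def)
    next
      case False
      then have "w t = 0" using M[of "nat \<lfloor>t\<rfloor>"] by (auto simp: w_def)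
      then show ?thesis using C0 by simp
    qed
    have hol: "fourier_transform w holomorphic_on UNIV"
      by (rule holomorphic_fourier_transform[OF w C0]) (use wb in simp)
    \<comment> \<open>With dimension 0 the exponent is \<open>-1\<close>, so the normalizing factor
      is multiplication by \<open>p ^ n\<close>.\<close>
    have "hk_fn K P n = (\<lambda>x. real (p ^ n) * w (real (p ^ n) * x))" if "p ^ n \<ge> M" for n
    proof
      fix x :: real
      have "real (p ^ n) * x < 0 \<longleftrightarrow> x < 0" using p(2) by (simp add: mult_less_0_iff)
      then show "hk_fn K P n x = real (p ^ n) * w (real (p ^ n) * x)"
        unfolding fn NZ[OF that] w_def using 0 by (simp add: power_int_minus divide_inverse mult.commute)
    qed
    then have ft: "fourier_transform (hk_fn K P n) z = fourier_transform w (z / complex_of_real (real (p ^ n)))"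
      if "p ^ n \<ge> M" for n z using fourier_transform_scale[of "real (p ^ n)" w z] p(2) that by simp
    have lim: "(\<lambda>n. fourier_transform (hk_fn K P n) z) \<longlonglongrightarrow> fourier_transform w 0" for z
    proof -
      have "(\<lambda>n. z * (1 / complex_of_real (real p)) ^ n) \<longlonglongrightarrow> z * 0"
        by (intro tendsto_mult tendsto_const LIMSEQ_power_zero) (use p(2) in \<open>simp add: norm_divide\<close>)
      then have z0: "(\<lambda>n. z / complex_of_real (real (p ^ n))) \<longlonglongrightarrow> 0" by (simp add: power_one_over)
      have "isCont (fourier_transform w) 0"
        using holomorphic_on_imp_continuous_on[OF hol] by (simp add: continuous_on_eq_continuous_at)
      from isCont_tendsto_compose[OF this z0]
      have "(\<lambda>n. fourier_transform w (z / complex_of_real (real (p ^ n)))) \<longlonglongrightarrow> fourier_transform w 0" .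
      moreover have "\<forall>\<^sub>F n in sequentially. fourier_transform w (z / complex_of_real (real (p ^ n))) = fourier_transform (hk_fn K P n) z"
      proof (rule eventually_sequentiallyI[of M])
        fix n assume "n \<ge> M"
        have "n \<le> p ^ n" using p(2) by (metis less_exp less_imp_le order_trans power_mono zero_le)
        then show "fourier_transform w (z / complex_of_real (real (p ^ n))) = fourier_transform (hk_fn K P n) z"
          using ft \<open>n \<ge> M\<close> by simp
      qed
      ultimately show ?thesis by (rule Lim_transform_eventually)
    qed
    have "hk_F K P = (\<lambda>z. fourier_transform w 0)" unfolding hk_F_def[abs_def] using limI[OF lim] by blast
    then show ?thesis using lim d(1) 0 by (auto intro: convergentI simp: one_enat_def)
  qed
qed

theorem lemma3p2:
  fixes K :: "'k ring"
  assumes "algebraically_closed K" and "ring_char K > 0"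
  shows
    "(\<forall>P :: ('k, 'a) sg_data. sg_pair K P \<longrightarrow>
        (\<forall>z. convergent (\<lambda>n. fourier_transform (hk_fn K P n) z)) \<and>
        hk_F K P holomorphic_on UNIV) \<and>
     (\<forall>(P :: ('k, 'a) sg_data) (Q :: ('k, 'b) sg_data).
        sg_pair K P \<and> sg_pair K Q \<and> sg_isomorphic P Q \<longrightarrow> hk_F K P = hk_F K Q) \<and>
     (\<exists>!\<Phi>. \<Phi> \<in> (sg_classes K :: ('k, 'a) sg_data set set) \<rightarrow>\<^sub>E {F. F holomorphic_on UNIV} \<and>
        (\<forall>P. sg_pair K P \<longrightarrow> \<Phi> (sg_iso_rel K `` {P}) = hk_F K P)) \<and>
     (\<forall>P :: ('k, 'a) sg_data. sg_pair K P \<and> krull_dim (sg_ring P) \<ge> 1 \<longrightarrow>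
        (\<forall>z. integrable lborel (fourier_integrand (hk_density K P) z) \<and>
             hk_F K P z = fourier_transform (hk_density K P) z))"
proof -
  interpret K: algebraically_closed K by (rule assms(1))
  note main = hk_fourier[OF assms]
  \<comment> \<open>Stated for two arbitrary element types, so that it yields both the comparison
    between different types and the invariance within one class.\<close>
  have inv: "hk_F K P = hk_F K Q" if "sg_pair K P" "sg_pair K Q" "sg_isomorphic P Q"
    for P :: "('k, 'c) sg_data" and Q :: "('k, 'd) sg_data"
    by (rule ext) (simp add: hk_F_def hk_fn_isomorphic[OF K.field_axioms that])
  have refl: "P \<in> sg_iso_rel K `` {P}" if "sg_pair K P" for P :: "('k, 'a) sg_data"
  proof -
    have "sg_isomorphic P P" unfolding sg_isomorphic_def using ring_iso_set_refl by (intro bexI[of _ id]) auto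
    then show ?thesis using that by (auto simp: sg_iso_rel_def)
  qed
  \<comment> \<open>The value on a class is taken at a chosen representative, which is harmless by
    \<open>inv\<close>. Restriction to the classes fixes the value \<open>undefined\<close>
    elsewhere, as the extensional function space requires for uniqueness.\<close>
  define \<Phi> where "\<Phi> = (\<lambda>A\<in>(sg_classes K :: ('k, 'a) sg_data set set). hk_F K (SOME P. P \<in> A))"
  have cl: "sg_iso_rel K `` {P} \<in> sg_classes K" if "sg_pair K P" for P :: "('k, 'a) sg_data"
    unfolding sg_classes_def by (rule quotientI) (use that in simp)
  have val: "\<Phi> (sg_iso_rel K `` {P}) = hk_F K P" if "sg_pair K P" for P :: "('k, 'a) sg_data"
  proof -
    define Q where "Q = (SOME Q. Q \<in> sg_iso_rel K `` {P})"
    have "Q \<in> sg_iso_rel K `` {P}" unfolding Q_def using refl[OF that] by (rule someI)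
    then have "hk_F K Q = hk_F K P" using inv[of P Q] by (simp add: sg_iso_rel_def)
    then show ?thesis using cl[OF that] by (simp add: \<Phi>_def Q_def)
  qed
  have rep: "\<exists>P. sg_pair K P \<and> A = sg_iso_rel K `` {P}" if "A \<in> sg_classes K" for A :: "('k, 'a) sg_data set"
    using that unfolding sg_classes_def by (auto elim!: quotientE)
  have ex: "\<exists>!\<Phi>. \<Phi> \<in> (sg_classes K :: ('k, 'a) sg_data set set) \<rightarrow>\<^sub>E {F. F holomorphic_on UNIV} \<and>
        (\<forall>P. sg_pair K P \<longrightarrow> \<Phi> (sg_iso_rel K `` {P}) = hk_F K P)"
  proof (rule ex1I[of _ \<Phi>], intro conjI allI impI)
    show "\<Phi> \<in> sg_classes K \<rightarrow>\<^sub>E {F. F holomorphic_on UNIV}"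
    proof (rule PiE_I)
      show "\<Phi> A \<in> {F. F holomorphic_on UNIV}" if "A \<in> sg_classes K" for A proof -
        obtain P where P: "sg_pair K P" "A = sg_iso_rel K `` {P}" using rep[OF \<open>A \<in> sg_classes K\<close>] by blast
        show ?thesis using main[OF P(1)] by (simp add: P(2) val[OF P(1)])
      qed
      show "\<Phi> A = undefined" if "A \<notin> sg_classes K" for A using that by (simp add: \<Phi>_def)
    qed
    show "\<Phi> (sg_iso_rel K `` {P}) = hk_F K P" if "sg_pair K P" for P by (rule val[OF that])
    fix \<Psi> assume \<Psi>: "\<Psi> \<in> (sg_classes K :: ('k, 'a) sg_data set set) \<rightarrow>\<^sub>E {F. F holomorphic_on UNIV} \<and>
        (\<forall>P. sg_pair K P \<longrightarrow> \<Psi> (sg_iso_rel K `` {P}) = hk_F K P)"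
    show "\<Psi> = \<Phi>"
    proof
      fix A
      show "\<Psi> A = \<Phi> A"
      proof (cases "A \<in> sg_classes K")
        case True
        then obtain P where "sg_pair K P" "A = sg_iso_rel K `` {P}" using rep by blast
        then show ?thesis using \<Psi> val by simp
      next
        case False
        then show ?thesis using PiE_arb[OF conjunct1[OF \<Psi>]] by (simp add: \<Phi>_def)
      qed
    qed
  qed
  have lim: "\<forall>P :: ('k, 'a) sg_data. sg_pair K P \<longrightarrow>
      (\<forall>z. convergent (\<lambda>n. fourier_transform (hk_fn K P n) z)) \<and> hk_F K P holomorphic_on UNIV"
    using main by blast
  have iso: "\<forall>(P :: ('k, 'a) sg_data) (Q :: ('k, 'b) sg_data).
      sg_pair K P \<and> sg_pair K Q \<and> sg_isomorphic P Q \<longrightarrow> hk_F K P = hk_F K Q"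
    using inv by blast
  have dens: "\<forall>P :: ('k, 'a) sg_data. sg_pair K P \<and> krull_dim (sg_ring P) \<ge> 1 \<longrightarrow>
      (\<forall>z. integrable lborel (fourier_integrand (hk_density K P) z) \<and>
        hk_F K P z = fourier_transform (hk_density K P) z)"
    using main by blast
  show ?thesis by (rule conjI[OF lim conjI[OF iso conjI[OF ex dens]]])
qed

end
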